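(* Let $\lambda_i,\alpha_i\in\mathbb{C}^*$ and $\beta_i,\gamma_i,\eta_i,\epsilon_i,\theta_i\in\mathbb{C}$ for $i=1,2$. Let $M$ be one of the symbols $\Omega,\Delta,\Theta$ (the same for both $i=1,2$), where in the case $M=\Theta$ it is assumed that $2\beta_1\notin\mathbb{Z}_+$ and $2\beta_2\notin\mathbb{Z}_+$. Then $M(\lambda_1,\alpha_1,\beta_1,\gamma_1)\otimes V(\eta_1,\epsilon_1,\theta_1)$ and $M(\lambda_2,\alpha_2,\beta_2,\gamma_2)\otimes V(\eta_2,\epsilon_2,\theta_2)$ are isomorphic as $\mathfrak{L}$-modules if and only if $M(\lambda_1,\alpha_1,\beta_1,\gamma_1)\cong M(\lambda_2,\alpha_2,\beta_2,\gamma_2)$ and $V(\eta_1,\epsilon_1,\theta_1)\cong V(\eta_2,\epsilon_2,\theta_2)$ as $\mathfrak{L}$-modules.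
   Context: All vector spaces are over $\mathbb{C}$; $\mathbb{C}^*=\mathbb{C}\setminus\{0\}$, $\mathbb{Z}_+$ is the set of nonnegative integers, $\mathbb{N}$ the set of positive integers. The affine-Virasoro algebra of type $A_1$, denoted $\mathfrak{L}$, is the Lie algebra with basis $\{e_i,f_i,h_i,d_i,C\mid i\in\mathbb{Z}\}$ and brackets $[e_i,f_j]=h_{i+j}+i\delta_{i+j,0}C$, $[h_i,e_j]=2e_{i+j}$, $[h_i,f_j]=-2f_{i+j}$, $[d_i,d_j]=(j-i)d_{i+j}+\delta_{i+j,0}\frac{i^3-i}{12}C$, $[d_i,h_j]=jh_{i+j}$, $[h_i,h_j]=2i\delta_{i+j,0}C$, $[d_i,e_j]=je_{i+j}$, $[d_i,f_j]=jf_{i+j}$, $[e_i,e_j]=[f_i,f_j]=[C,\mathfrak{L}]=0$. For $\lambda,\alpha\in\mathbb{C}^*$, $\beta,\gamma\in\mathbb{C}$, the $\mathfrak{L}$-modules $\Omega(\lambda,\alpha,\beta,\gamma)$, $\Delta(\lambda,\alpha,\beta,\gamma)$, $\Theta(\lambda,\alpha,\beta,\gamma)$ are all equal to the polynomial algebra $\mathbb{C}[s,t]$ as vector spaces. In all three, for $i\in\mathbb{Z}$ and $g(s,t)\in\mathbb{C}[s,t]$: $h_i\cdot g(s,t)=\lambda^i t\,g(s-i,t)$, $d_i\cdot g(s,t)=\lambda^i(s+i\gamma)g(s-i,t)$, $C\cdot g(s,t)=0$. The remaining actions are: - $\Omega$: $e_i\cdot g(s,t)=\lambda^i\alpha\,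 g(s-i,t-2)$, $f_i\cdot g(s,t)=-\frac{\lambda^i}{\alpha}(\frac t2-\beta)(\frac t2+\beta+1)g(s-i,t+2)$; - $\Delta$: $e_i\cdot g(s,t)=-\frac{\lambda^i}{\alpha}(\frac t2+\beta)(\frac t2-\beta-1)g(s-i,t-2)$, $f_i\cdot g(s,t)=\lambda^i\alpha\, g(s-i,t+2)$; - $\Theta$: $e_i\cdot g(s,t)=\lambda^i\alpha(\frac t2+\beta)g(s-i,t-2)$, $f_i\cdot g(s,t)=-\frac{\lambda^i}{\alpha}(\frac t2-\beta)g(s-i,t+2)$. For $\eta,\epsilon,\theta\in\mathbb{C}$, the Verma module is $\overline{V}(\eta,\epsilon,\theta)=U(\mathfrak{L})/I(\eta,\epsilon,\theta)$, where $I(\eta,\epsilon,\theta)$ is the left ideal of $U(\mathfrak{L})$ generated by $\{e_0,e_i,f_i,h_i,d_i\mid i\in\mathbb{N}\}\cup\{d_0-\eta,h_0-\epsilon,C-\theta\}$. $V(\eta,\epsilon,\theta)$ denotes the irreducible highest weight module $\overline{V}(\eta,\epsilon,\theta)/J$, where $J$ is the unique maximal proper submodule of $\overline{V}(\eta,\epsilon,\theta)$. Tensor products carry the usual action $x(u\otimes v)=xu\otimes v+u\otimes xv$ for $x\in\mathfrak{L}$. *)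

theory Defs
  imports
    "HOL-Algebra.Algebraic_Closure_Type"
    "HOL-Library.Poly_Mapping"
    Complex_Main
begin

section \<open>The affine-Virasoro algebra of type \<open>A\<^sub>1\<close>\<close>

text \<open>
  A complex vector space with basis \<open>'a\<close> is represented by the type \<open>'a \<Rightarrow>\<^sub>0 complex\<close> of
  finitely supported functions.
\<close>

abbreviation basis_vec :: "'a \<Rightarrow> ('a \<Rightarrow>\<^sub>0 complex)"
  where "basis_vec a \<equiv> Poly_Mapping.single a 1"

definition scale :: "complex \<Rightarrow> ('a \<Rightarrow>\<^sub>0 complex) \<Rightarrow> ('a \<Rightarrow>\<^sub>0 complex)"
  where "scale c = Poly_Mapping.map ((*) c)"

definition lin_extend :: "('a \<Rightarrow> ('b \<Rightarrow>\<^sub>0 complex)) \<Rightarrow> ('a \<Rightarrow>\<^sub>0 complex) \<Rightarrow> ('b \<Rightarrow>\<^sub>0 complex)"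
  where "lin_extend f x = (\<Sum>a\<in>Poly_Mapping.keys x. scale (Poly_Mapping.lookup x a) (f a))"

datatype gen = Egen int | Fgen int | Hgen int | Dgen int | Cgen

type_synonym affvir = "gen \<Rightarrow>\<^sub>0 complex"

text \<open>The brackets that are not among the defining ones are obtained by antisymmetry.\<close>

fun gen_bracket :: "gen \<Rightarrow> gen \<Rightarrow> affvir" where
  "gen_bracket (Egen i) (Fgen j) =
     basis_vec (Hgen (i + j)) + (if i + j = 0 then scale (of_int i) (basis_vec Cgen) else 0)"
| "gen_bracket (Fgen j) (Egen i) =
     - (basis_vec (Hgen (i + j)) + (if i + j = 0 then scale (of_int i) (basis_vec Cgen) else 0))"
| "gen_bracket (Hgen i) (Egen j) = scale 2 (basis_vec (Egen (i + j)))"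
| "gen_bracket (Egen j) (Hgen i) = - scale 2 (basis_vec (Egen (i + j)))"
| "gen_bracket (Hgen i) (Fgen j) = - scale 2 (basis_vec (Fgen (i + j)))"
| "gen_bracket (Fgen j) (Hgen i) = scale 2 (basis_vec (Fgen (i + j)))"
| "gen_bracket (Dgen i) (Dgen j) =
     scale (of_int (j - i)) (basis_vec (Dgen (i + j))) +
     (if i + j = 0 then scale ((of_int i ^ 3 - of_int i) / 12) (basis_vec Cgen) else 0)"
| "gen_bracket (Dgen i) (Hgen j) = scale (of_int j) (basis_vec (Hgen (i + j)))"
| "gen_bracket (Hgen j) (Dgen i) = - scale (of_int j) (basis_vec (Hgen (i + j)))"
| "gen_bracket (Hgen i) (Hgen j) =
     (if i + j = 0 then scale (2 * of_int i) (basis_vec Cgen) else 0)"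
| "gen_bracket (Dgen i) (Egen j) = scale (of_int j) (basis_vec (Egen (i + j)))"
| "gen_bracket (Egen j) (Dgen i) = - scale (of_int j) (basis_vec (Egen (i + j)))"
| "gen_bracket (Dgen i) (Fgen j) = scale (of_int j) (basis_vec (Fgen (i + j)))"
| "gen_bracket (Fgen j) (Dgen i) = - scale (of_int j) (basis_vec (Fgen (i + j)))"
| "gen_bracket (Egen i) (Egen j) = 0"
| "gen_bracket (Fgen i) (Fgen j) = 0"
| "gen_bracket Cgen x = 0"
| "gen_bracket x Cgen = 0"

definition bracket :: "affvir \<Rightarrow> affvir \<Rightarrow> affvir"
  where "bracket x y = lin_extend (\<lambda>a. lin_extend (\<lambda>b. gen_bracket a b) y) x"


section \<open>Modules, quotients, isomorphisms and tensor products\<close>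

abbreviation complex_ring :: "complex ring"
  where "complex_ring \<equiv> ring_of_type_algebra"

text \<open>
  The record of modules extends the one of rings; its fields \<^const>\<open>monoid.mult\<close> and
  \<^const>\<open>monoid.one\<close> play no role for modules and are left unspecified below.
\<close>

record 'a lie_module = "(complex, 'a) module" +
  act :: "affvir \<Rightarrow> 'a \<Rightarrow> 'a"

definition lie_submodule :: "'a set \<Rightarrow> 'a lie_module \<Rightarrow> bool"
  where "lie_submodule N M \<longleftrightarrow>
    submodule N complex_ring M \<and> (\<forall>x. \<forall>v\<in>N. act M x v \<in> N)"

definition lie_quot :: "'a lie_module \<Rightarrow> 'a set \<Rightarrow> 'a set lie_module"
  where "lie_quot M N =
    \<lparr>carrier = a_rcosets\<^bsub>M\<^esub> N, monoid.mult = undefined, one = undefined,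
     ring.zero = N, add = set_add M,
     module.smult = (\<lambda>c A. \<Union>a\<in>A. N +>\<^bsub>M\<^esub> (c \<odot>\<^bsub>M\<^esub> a)),
     act = (\<lambda>x A. \<Union>a\<in>A. N +>\<^bsub>M\<^esub> act M x a)\<rparr>"

definition lie_iso :: "'a lie_module \<Rightarrow> 'b lie_module \<Rightarrow> ('a \<Rightarrow> 'b) set"
  where "lie_iso M N = {\<phi>. bij_betw \<phi> (carrier M) (carrier N) \<and>
    (\<forall>u\<in>carrier M. \<forall>v\<in>carrier M. \<phi> (u \<oplus>\<^bsub>M\<^esub> v) = \<phi> u \<oplus>\<^bsub>N\<^esub> \<phi> v) \<and>
    (\<forall>c. \<forall>v\<in>carrier M. \<phi> (c \<odot>\<^bsub>M\<^esub> v) = c \<odot>\<^bsub>N\<^esub> \<phi> v) \<and>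
    (\<forall>x. \<forall>v\<in>carrier M. \<phi> (act M x v) = act N x (\<phi> v))}"

definition lie_isomorphic :: "'a lie_module \<Rightarrow> 'b lie_module \<Rightarrow> bool"  (infix \<open>\<cong>\<^sub>L\<close> 50)
  where "M \<cong>\<^sub>L N \<longleftrightarrow> lie_iso M N \<noteq> {}"

text \<open>
  The tensor product is the free vector space on the set of pairs modulo the bilinearity
  relations. The action on \<open>pair_module\<close> is the linear extension of
  \<open>x(u, v) = (xu, v) + (u, xv)\<close>; it only becomes linear in \<open>x\<close> after passing to the quotient.
\<close>

definition pair_module :: "'a lie_module \<Rightarrow> 'b lie_module \<Rightarrow> ('a \<times> 'b \<Rightarrow>\<^sub>0 complex) lie_module"
  where "pair_module M N =
    \<lparr>carrier = {p. Poly_Mapping.keys p \<subseteq> carrier M \<times> carrier N},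
     monoid.mult = undefined, one = undefined, ring.zero = 0, add = (+),
     module.smult = scale,
     act = (\<lambda>x. lin_extend (\<lambda>(u, v). basis_vec (act M x u, v) + basis_vec (u, act N x v)))\<rparr>"

definition tensor_relations :: "'a lie_module \<Rightarrow> 'b lie_module \<Rightarrow> ('a \<times> 'b \<Rightarrow>\<^sub>0 complex) set"
  where "tensor_relations M N =
    {basis_vec (u \<oplus>\<^bsub>M\<^esub> u', v) - basis_vec (u, v) - basis_vec (u', v) | u u' v.
       u \<in> carrier M \<and> u' \<in> carrier M \<and> v \<in> carrier N} \<union>
    {basis_vec (u, v \<oplus>\<^bsub>N\<^esub> v') - basis_vec (u, v) - basis_vec (u, v') | u v v'.
       u \<in> carrier M \<and> v \<in> carrier N \<and> v' \<in> carrier N} \<union>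
    {basis_vec (c \<odot>\<^bsub>M\<^esub> u, v) - scale c (basis_vec (u, v)) | c u v.
       u \<in> carrier M \<and> v \<in> carrier N} \<union>
    {basis_vec (u, c \<odot>\<^bsub>N\<^esub> v) - scale c (basis_vec (u, v)) | c u v.
       u \<in> carrier M \<and> v \<in> carrier N}"

definition tensor :: "'a lie_module \<Rightarrow> 'b lie_module \<Rightarrow> ('a \<times> 'b \<Rightarrow>\<^sub>0 complex) set lie_module"
    (infixr \<open>\<otimes>\<^sub>L\<close> 70)
  where "M \<otimes>\<^sub>L N = lie_quot (pair_module M N)
    (\<Inter>{K. submodule K complex_ring (pair_module M N) \<and> tensor_relations M N \<subseteq> K})"


section \<open>The universal enveloping algebra\<close>

text \<open>
  The tensor algebra of a vector space with basis \<open>gen\<close> is the free associative algebra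
  on \<open>gen\<close>, i.e. the monoid algebra of the free monoid of words. The product of
  \<open>word \<Rightarrow>\<^sub>0 complex\<close> is the convolution product, which requires the concatenation of words to be
  written additively.
\<close>

datatype word = Word "gen list"

instantiation word :: monoid_add
begin

definition zero_word :: word
  where "zero_word = Word []"

fun plus_word :: "word \<Rightarrow> word \<Rightarrow> word"
  where "plus_word (Word xs) (Word ys) = Word (xs @ ys)"

instance
proof
  fix a b c :: word
  show "a + b + c = a + (b + c)" by (cases a; cases b; cases c) simp
  show "0 + a = a" by (cases a) (simp add: zero_word_def)
  show "a + 0 = a" by (cases a) (simp add: zero_word_def)
qed

end

type_synonym tensor_alg = "word \<Rightarrow>\<^sub>0 complex"

abbreviation tensor_ring :: "tensor_alg ring"
  where "tensor_ring \<equiv> ring_of_type_algebra"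

definition word_embed :: "affvir \<Rightarrow> tensor_alg"
  where "word_embed = lin_extend (\<lambda>a. basis_vec (Word [a]))"

definition env_ideal :: "tensor_alg set"
  where "env_ideal = Idl\<^bsub>tensor_ring\<^esub>
    {word_embed x * word_embed y - word_embed y * word_embed x - word_embed (bracket x y) | x y. True}"

definition env :: "tensor_alg set ring"
  where "env = tensor_ring Quot env_ideal"

definition env_proj :: "tensor_alg \<Rightarrow> tensor_alg set"
  where "env_proj p = env_ideal +>\<^bsub>tensor_ring\<^esub> p"

definition env_module :: "tensor_alg set lie_module"
  where "env_module =
    \<lparr>carrier = carrier env, monoid.mult = undefined, one = undefined,
     ring.zero = \<zero>\<^bsub>env\<^esub>, add = add env,
     module.smult = (\<lambda>c u. env_proj (scale c 1) \<otimes>\<^bsub>env\<^esub> u),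
     act = (\<lambda>x u. env_proj (word_embed x) \<otimes>\<^bsub>env\<^esub> u)\<rparr>"

definition left_ideal :: "'a set \<Rightarrow> 'a ring \<Rightarrow> bool"
  where "left_ideal I R \<longleftrightarrow>
    additive_subgroup I R \<and> (\<forall>r\<in>carrier R. \<forall>a\<in>I. r \<otimes>\<^bsub>R\<^esub> a \<in> I)"


section \<open>Verma modules and irreducible highest weight modules\<close>

definition verma_gens :: "complex \<Rightarrow> complex \<Rightarrow> complex \<Rightarrow> tensor_alg set set"
  where "verma_gens \<eta> \<epsilon> \<theta> = env_proj `
    ({word_embed (basis_vec (Egen 0))} \<union>
     {word_embed (basis_vec (g i)) | g i. g \<in> {Egen, Fgen, Hgen, Dgen} \<and> 0 < i} \<union>
     {word_embed (basis_vec (Dgen 0)) - scale \<eta> 1,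
      word_embed (basis_vec (Hgen 0)) - scale \<epsilon> 1,
      word_embed (basis_vec Cgen) - scale \<theta> 1})"

definition verma_ideal :: "complex \<Rightarrow> complex \<Rightarrow> complex \<Rightarrow> tensor_alg set set"
  where "verma_ideal \<eta> \<epsilon> \<theta> = \<Inter>{I. left_ideal I env \<and> verma_gens \<eta> \<epsilon> \<theta> \<subseteq> I}"

definition verma :: "complex \<Rightarrow> complex \<Rightarrow> complex \<Rightarrow> tensor_alg set set lie_module"
  where "verma \<eta> \<epsilon> \<theta> = lie_quot env_module (verma_ideal \<eta> \<epsilon> \<theta>)"

definition proper_submodule :: "'a set \<Rightarrow> 'a lie_module \<Rightarrow> bool"
  where "proper_submodule N M \<longleftrightarrow> lie_submodule N M \<and> N \<noteq> carrier M"

definition maximal_submodule :: "'a set \<Rightarrow> 'a lie_module \<Rightarrow> bool"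
  where "maximal_submodule N M \<longleftrightarrow> proper_submodule N M \<and>
    (\<forall>K. proper_submodule K M \<longrightarrow> N \<subseteq> K \<longrightarrow> K = N)"

definition irr_hw :: "complex \<Rightarrow> complex \<Rightarrow> complex \<Rightarrow> tensor_alg set set set lie_module"
  where "irr_hw \<eta> \<epsilon> \<theta> =
    lie_quot (verma \<eta> \<epsilon> \<theta>) (THE J. maximal_submodule J (verma \<eta> \<epsilon> \<theta>))"


section \<open>The modules \<open>\<Omega>\<close>, \<open>\<Delta>\<close> and \<open>\<Theta>\<close>\<close>

text \<open>
  The polynomial algebra in \<open>s\<close> and \<open>t\<close> is \<open>complex poly poly\<close>: the outer variable is \<open>s\<close>,
  the coefficients are polynomials in \<open>t\<close>. \<open>shift i c g\<close> is \<open>g(s - i, t + c)\<close>.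
\<close>

type_synonym poly2 = "complex poly poly"

definition const2 :: "complex \<Rightarrow> poly2"
  where "const2 c = [:[:c:]:]"

definition s_var :: poly2
  where "s_var = [:0, 1:]"

definition t_var :: poly2
  where "t_var = [:[:0, 1:]:]"

definition shift :: "int \<Rightarrow> complex \<Rightarrow> poly2 \<Rightarrow> poly2"
  where "shift i c g = pcompose (map_poly (\<lambda>p. pcompose p [:c, 1:]) g) [:- of_int i, 1:]"

datatype family = Omega | Delta | Theta

context
  fixes lam \<alpha> \<beta> \<gamma> :: complex
begin

fun gen_act :: "family \<Rightarrow> gen \<Rightarrow> poly2 \<Rightarrow> poly2" where
  "gen_act M (Hgen i) g = const2 (lam powi i) * t_var * shift i 0 g"
| "gen_act M (Dgen i) g = const2 (lam powi i) * (s_var + const2 (of_int i * \<gamma>)) * shift i 0 g"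
| "gen_act M Cgen g = 0"
| "gen_act Omega (Egen i) g = const2 (lam powi i * \<alpha>) * shift i (-2) g"
| "gen_act Omega (Fgen i) g = - const2 (lam powi i / \<alpha>) *
     (const2 (1/2) * t_var - const2 \<beta>) * (const2 (1/2) * t_var + const2 \<beta> + 1) * shift i 2 g"
| "gen_act Delta (Egen i) g = - const2 (lam powi i / \<alpha>) *
     (const2 (1/2) * t_var + const2 \<beta>) * (const2 (1/2) * t_var - const2 \<beta> - 1) * shift i (-2) g"
| "gen_act Delta (Fgen i) g = const2 (lam powi i * \<alpha>) * shift i 2 g"
| "gen_act Theta (Egen i) g = const2 (lam powi i * \<alpha>) *
     (const2 (1/2) * t_var + const2 \<beta>) * shift i (-2) g"
| "gen_act Theta (Fgen i) g = - const2 (lam powi i / \<alpha>) *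
     (const2 (1/2) * t_var - const2 \<beta>) * shift i 2 g"

end

definition poly_module ::
    "family \<Rightarrow> complex \<Rightarrow> complex \<Rightarrow> complex \<Rightarrow> complex \<Rightarrow> poly2 lie_module"
  where "poly_module M lam \<alpha> \<beta> \<gamma> =
    \<lparr>carrier = UNIV, monoid.mult = undefined, one = undefined, ring.zero = 0, add = (+),
     module.smult = (\<lambda>c g. const2 c * g),
     act = (\<lambda>x g. \<Sum>a\<in>Poly_Mapping.keys x.
       const2 (Poly_Mapping.lookup x a) * gen_act lam \<alpha> \<beta> \<gamma> M a g)\<rparr>"

end

theory Submission
  imports Defs
begin

text \<open>
  An irreducible highest weight module \<open>V\<close> is smooth: each of its vectors is annihilated by all
  generators of sufficiently large index. On \<open>g(s,t) \<otimes> v\<close> the generators of large index \<open>m\<close> therefore act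
  through the polynomial factor alone, by \<open>\<lambda>\<^sup>m\<close> times an expression that is polynomial in \<open>m\<close>. Let \<open>\<phi>\<close> be
  an isomorphism between two tensor products. Comparing the action of \<open>h\<^sub>m\<close> before and after \<open>\<phi>\<close> gives
  \<open>\<lambda>\<^sub>1 = \<lambda>\<^sub>2\<close> and shows that \<open>\<phi>(1 \<otimes> v)\<close> does not involve \<open>s\<close>, since a polynomial in \<open>s\<close> that is invariant
  under a shift is constant. Comparing \<open>e\<^sub>m\<close> and \<open>f\<^sub>m\<close> gives \<open>\<alpha>\<^sub>1 = \<alpha>\<^sub>2\<close> and, by the same principle in \<open>t\<close>,
  \<open>\<phi>(1 \<otimes> v) = 1 \<otimes> \<tau>(v)\<close>; in the family \<open>\<Theta>\<close> a nonconstant polynomial in \<open>t\<close> is possible only if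
  \<open>2\<beta>\<^sub>2\<close> is a nonnegative integer. The remaining operators give \<open>\<gamma>\<^sub>1 = \<gamma>\<^sub>2\<close> and, for \<open>\<Omega>\<close> and \<open>\<Delta>\<close>,
  \<open>\<beta>\<^sub>1(\<beta>\<^sub>1 + 1) = \<beta>\<^sub>2(\<beta>\<^sub>2 + 1)\<close>, which is all that the action depends on. So the two polynomial modules
  are equal, and \<open>\<tau>\<close> turns out to be an isomorphism of the second factors. This is
  \<open>tensor_model_rigidity\<close>. Applied with a trivial second factor it also shows that isomorphic polynomial
  modules of the same family are equal, so that the converse implication only has to transport the
  second factor.

  The argument needs the second factor to be nonzero, and this is where the structure of the
  enveloping algebra enters. The straightening procedure behind the Poincare-Birkhoff-Witt theorem
  (\<open>straighten_swap\<close>) yields a linear functional \<open>F\<close> on the enveloping algebra with \<open>F(1) = 1\<close> and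
  \<open>F(ux) = \<chi>(x) F(u)\<close> for all \<open>x\<close> in the nonnegative part of the algebra, where \<open>\<chi>\<close> is the highest weight;
  it also vanishes on nonempty words of negative generators. Its left translates make everything
  explicit. The element \<open>p\<close> is mapped to the function \<open>w \<mapsto> F(wp)\<close> on words, and the kernel of the induced
  map on the Verma module is its only maximal submodule (\<open>maximal_submodule_iff\<close>): a submodule on which
  some \<open>F(wp)\<close> is nonzero contains the highest weight vector, because the eigenvalues of \<open>3d\<^sub>0 + h\<^sub>0\<close>
  separate that vector from all lower ones. So \<open>V\<close> is a space of complex functions on words on which a
  generator acts by translation (\<open>irr_hw_isomorphic\<close>). Accordingly the tensor product with a polynomial
  module is a space of functions from words to \<open>\<complex>[s,t]\<close> (\<open>tensor_isomorphic\<close>), and all comparisons of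
  coefficients are made there, one word at a time.
\<close>

section \<open>Linear functionals and the straightening of words\<close>

abbreviation "single \<equiv> Poly_Mapping.single"
abbreviation "keys \<equiv> Poly_Mapping.keys"
abbreviation "lookup \<equiv> Poly_Mapping.lookup"

lemma lookup_scale [simp]: "lookup (scale c x) a = c * lookup x a"
  unfolding scale_def by (simp add: Poly_Mapping.map.rep_eq when_def)

lemma scale_single [simp]: "scale c (single a d) = single a (c * d)"
  by (rule poly_mapping_eqI) (simp add: lookup_single when_def)

lemma keys_scale_subset: "keys (scale c x) \<subseteq> keys x"
  by (auto simp: in_keys_iff)

lemma sum_keys_superset:
  fixes h :: "'a \<Rightarrow> complex \<Rightarrow> 'm::comm_monoid_add"
  assumes "finite B" "keys x \<subseteq> B" "\<And>a. h a 0 = 0"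
  shows "(\<Sum>a\<in>keys x. h a (lookup x a)) = (\<Sum>a\<in>B. h a (lookup x a))"
  by (rule sum.mono_neutral_left) (use assms in \<open>auto simp: in_keys_iff\<close>)

lemma sum_keys_add:
  fixes h :: "'a \<Rightarrow> complex \<Rightarrow> 'm::comm_monoid_add"
  assumes "\<And>a. h a 0 = 0" "\<And>a c d. h a (c + d) = h a c + h a d"
  shows "(\<Sum>a\<in>keys (x + y). h a (lookup (x + y) a)) =
    (\<Sum>a\<in>keys x. h a (lookup x a)) +
    (\<Sum>a\<in>keys y. h a (lookup y a))"
proof -
  let ?B = "keys x \<union> keys y"
  have "keys (x + y) \<subseteq> ?B" by (rule Poly_Mapping.keys_add)
  then show ?thesis
    using sum_keys_superset[of ?B x h] sum_keys_superset[of ?B y h] sum_keys_superset[of ?B "x + y" h]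
    by (simp add: assms lookup_add sum.distrib)
qed

text \<open>
  The value at \<open>x\<close> of the linear functional that is \<open>f\<close> on basis vectors. Identities between vectors are
  mostly used in the form of such values, where ring simplification applies.
\<close>

definition evalf :: "('a \<Rightarrow> complex) \<Rightarrow> ('a \<Rightarrow>\<^sub>0 complex) \<Rightarrow> complex"
  where "evalf f x = (\<Sum>a\<in>keys x. lookup x a * f a)"

lemma evalf_add [simp]: "evalf f (x + y) = evalf f x + evalf f y"
  unfolding evalf_def by (rule sum_keys_add) (auto simp: algebra_simps)

lemma evalf_single [simp]: "evalf f (single a c) = c * f a"
  unfolding evalf_def by (cases "c = 0") auto

lemma evalf_zero [simp]: "evalf f 0 = 0"
  unfolding evalf_def by simp

lemma evalf_scale [simp]: "evalf f (scale c x) = c * evalf f x"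
  using sum_keys_superset[OF _ keys_scale_subset[of c x], of "\<lambda>a d. d * f a"]
  unfolding evalf_def by (simp add: sum_distrib_left mult.assoc)

lemma evalf_uminus [simp]: "evalf f (- x) = - evalf f x"
  using evalf_add[of f x "- x"] by (simp add: add_eq_0_iff)

lemma evalf_diff [simp]: "evalf f (x - y) = evalf f x - evalf f y"
  using evalf_add[of f x "- y"] by simp

lemma evalf_sum: "evalf f (sum g A) = (\<Sum>a\<in>A. evalf f (g a))"
  by (induction A rule: infinite_finite_induct) auto

lemma evalf_lin_extend: "evalf f (lin_extend g x) = evalf (\<lambda>a. evalf f (g a)) x"
  unfolding lin_extend_def evalf_sum by (simp add: evalf_def[of "\<lambda>a. evalf f (g a)"])

lemma evalf_fun_add: "evalf (\<lambda>a. f a + g a) x = evalf f x + evalf g x"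
  unfolding evalf_def by (simp add: algebra_simps sum.distrib)

lemma evalf_fun_diff: "evalf (\<lambda>a. f a - g a) x = evalf f x - evalf g x"
  unfolding evalf_def by (simp add: algebra_simps sum_subtractf)

lemma evalf_fun_mult: "evalf (\<lambda>a. c * f a) x = c * evalf f x"
  unfolding evalf_def by (simp add: algebra_simps sum_distrib_left)

lemma evalf_cong: "(\<And>a. a \<in> keys x \<Longrightarrow> f a = g a) \<Longrightarrow> evalf f x = evalf g x"
  unfolding evalf_def by (rule sum.cong) auto

lemma evalf_swap: "evalf (\<lambda>a. evalf (f a) y) x = evalf (\<lambda>b. evalf (\<lambda>a. f a b) x) y"
  unfolding evalf_def by (simp add: sum_distrib_left sum_distrib_right ac_simps)
    (subst sum.swap, simp add: ac_simps)

text \<open>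
  A Lie algebra given by structure constants. The Jacobi identity is stated under an arbitrary linear
  functional \<open>f\<close>, the form in which straightening consumes it. The order on the basis comes from \<open>key\<close>.
\<close>

locale lie_basis =
  fixes br :: "'g \<Rightarrow> 'g \<Rightarrow> ('g \<Rightarrow>\<^sub>0 complex)" and key :: "'g \<Rightarrow> int"
  assumes inj_key: "inj key"
    and br_antisym: "br b a = - br a b"
    and br_jacobi: "evalf (\<lambda>d. evalf f (br d c)) (br a b) + evalf (\<lambda>d. evalf f (br d a)) (br b c)
       + evalf (\<lambda>d. evalf f (br d b)) (br c a) = 0"
begin

fun inversions :: "'g list \<Rightarrow> nat" where
  "inversions [] = 0"
| "inversions (a # w) = length (filter (\<lambda>b. key b < key a) w) + inversions w"

lemma inversions_swap:
  "key b < key a \<Longrightarrow> inversions (u @ a # b # v) = Suc (inversions (u @ b # a # v))"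
  by (induction u) auto

text \<open>
  Words are straightened at an arbitrarily chosen descent. That the choice does not matter is the
  content of \<open>straighten_swap\<close>.
\<close>

definition descent :: "'g list \<Rightarrow> 'g list \<times> 'g \<times> 'g \<times> 'g list" where
  "descent w = (SOME (u, a, b, v). w = u @ a # b # v \<and> key b < key a)"

lemma descent_exists: "\<not> sorted (map key w) \<Longrightarrow> \<exists>u a b v. w = u @ a # b # v \<and> key b < key a"
proof (induction w)
  case (Cons x w)
  show ?case
  proof (cases "sorted (map key w)")
    case False
    then obtain u a b v where "w = u @ a # b # v" "key b < key a" using Cons by blast
    then have "x # w = (x # u) @ a # b # v \<and> key b < key a" by simp
    then show ?thesis by blast
  next
    case True
    then obtain y w' where w: "w = y # w'" using Cons.prems by (cases w) auto
    have "key y < key x"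
      using Cons.prems True by (auto simp: w intro: order.trans)
    then have "x # w = [] @ x # y # w' \<and> key y < key x" using w by simp
    then show ?thesis by blast
  qed
qed simp

lemma descentD:
  assumes "\<not> sorted (map key w)" "descent w = (u, a, b, v)"
  shows "w = u @ a # b # v" "key b < key a"
proof -
  have "case descent w of (u, a, b, v) \<Rightarrow> w = u @ a # b # v \<and> key b < key a"
    unfolding descent_def by (rule someI_ex) (use descent_exists[OF assms(1)] in auto)
  then show "w = u @ a # b # v" "key b < key a" using assms by auto
qed

lemma descent_eqD:
  assumes "\<not> sorted (map key w)" "(u, a, b, v) = descent w"
  shows "w = u @ a # b # v \<and> key b < key a"
  using descentD[OF assms(1) assms(2)[symmetric]] by simp

text \<open>
  The function on words that extends \<open>f\<close>, given on sorted words, along the relations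
  \<open>ab = ba + [a,b]\<close>. A swap at a descent lowers the number of inversions, and the bracket term has a
  shorter word.
\<close>

function straighten :: "('g list \<Rightarrow> complex) \<Rightarrow> 'g list \<Rightarrow> complex" where
  "straighten f w = (if sorted (map key w) then f w
     else case descent w of (u, a, b, v) \<Rightarrow> straighten f (u @ b # a # v) +
       (\<Sum>c\<in>keys (br a b). lookup (br a b) c * straighten f (u @ c # v)))"
  by auto
termination
proof (relation "measures [\<lambda>(f, w). length w, \<lambda>(f, w). inversions w]")
  fix f :: "'g list \<Rightarrow> complex" and w u p a q b v
  assume "\<not> sorted (map key w)" "(u, p) = descent w" "(a, q) = p" "(b, v) = q"
  then have w: "w = u @ a # b # v \<and> key b < key a" using descent_eqD[of w u a b v] by simp
  then show "((f, u @ b # a # v), f, w) \<in> measures [\<lambda>(f, w). length w, \<lambda>(f, w). inversions w]"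
    by (simp add: inversions_swap)
  fix c show "((f, u @ c # v), f, w) \<in> measures [\<lambda>(f, w). length w, \<lambda>(f, w). inversions w]"
    using w by simp
qed simp

declare straighten.simps [simp del]

text \<open>
  The right hand side of the relation \<open>ab = ba + [a,b]\<close> inside a word, evaluated by \<open>F\<close>.
\<close>

definition swapped :: "('g list \<Rightarrow> complex) \<Rightarrow> 'g list \<Rightarrow> 'g \<Rightarrow> 'g \<Rightarrow> 'g list \<Rightarrow> complex" where
  "swapped F u a b v = F (u @ b # a # v) + evalf (\<lambda>c. F (u @ c # v)) (br a b)"

lemma straighten_sorted: "sorted (map key w) \<Longrightarrow> straighten f w = f w"
  by (simp add: straighten.simps)

lemma straighten_descent:
  assumes "\<not> sorted (map key w)"
  obtains u a b v where "w = u @ a # b # v" "key b < key a"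
    "straighten f w = swapped (straighten f) u a b v"
proof -
  obtain u a b v where d: "descent w = (u, a, b, v)" by (metis prod_cases4)
  show thesis
    by (rule that[OF descentD[OF assms d]])
      (subst straighten.simps, simp add: assms d swapped_def evalf_def)
qed

lemma br_same [simp]: "br a a = 0"
proof (rule poly_mapping_eqI)
  fix k
  have "lookup (br a a) k = - lookup (br a a) k"
    using br_antisym[of a a] by (metis lookup_uminus)
  then show "lookup (br a a) k = lookup 0 k" by simp
qed

text \<open>
  If the relation holds at all descents of words of length \<open>n\<close>, then it holds at all positions: at an
  ascent it is the relation of the swapped word, by antisymmetry.
\<close>

lemma swapped_of_descents:
  assumes "\<And>u a b v. length (u @ a # b # v) = n \<Longrightarrow> key b < key a \<Longrightarrow> F (u @ a # b # v) = swapped F u a b v"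
    and "length (u @ a # b # v) = n"
  shows "F (u @ a # b # v) = swapped F u a b v"
proof (cases rule: linorder_cases[of "key a" "key b"])
  case less
  then have "F (u @ b # a # v) = swapped F u b a v" using assms by simp
  then show ?thesis unfolding swapped_def by (simp add: br_antisym[of a b])
next
  case equal
  then have "a = b" using inj_key by (auto dest: injD)
  then show ?thesis by (simp add: swapped_def)
qed (use assms in simp)

text \<open>
  Two descents of a word lead to the same value. Disjoint descents commute. Overlapping ones
  are the two ways to reverse \<open>abc\<close>, and the difference of the two results is the Jacobi identity. The
  relation is available for all shorter words and for the descents of words with fewer inversions,
  which covers every intermediate word.
\<close>

lemma swapped_confluent:
  fixes F :: "'g list \<Rightarrow> complex"
  assumes shorter: "\<And>u a b v. length (u @ a # b # v) < length w \<Longrightarrow> F (u @ a # b # v) = swapped F u a b v"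
    and fewer: "\<And>u a b v. length (u @ a # b # v) = length w \<Longrightarrow> inversions (u @ a # b # v) < inversions w
       \<Longrightarrow> key b < key a \<Longrightarrow> F (u @ a # b # v) = swapped F u a b v"
    and w: "w = u @ a # b # v" "w = u' @ a' # b' # v'"
    and desc: "key b < key a" "key b' < key a'"
    and less: "length u < length u'"
  shows "swapped F u a b v = swapped F u' a' b' v'"
proof -
  have "u' = u @ a # drop (Suc (length u)) u'"
    using w less by (metis append_eq_append_conv_if id_take_nth_drop less_imp_le_nat nth_append_length append_eq_conv_conj nth_append)
  then obtain y where y: "u' = u @ a # y" by blast
  show ?thesis
  proof (cases y)
    case Nil
    then have eqs: "u' = u @ [a]" "a' = b" "v = b' # v'" using w y by auto
    define c where "c = b'"
    define V where "V l = F (u @ l @ v')" for l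
    have iw: "inversions w = Suc (inversions (u @ [b, a, c] @ v'))" "inversions w = Suc (inversions (u @ [a, c, b] @ v'))"
      using inversions_swap[of b a u "c # v'"] inversions_swap[of c b "u @ [a]" v'] desc w eqs
      by (simp_all add: c_def)
    have cb: "key c < key b" "key b < key a" "key c < key a" using desc eqs by (auto simp: c_def)
    have lw: "length w = length u + 3 + length v'" using w eqs by simp
    have 1: "V [b, a, c] = V [b, c, a] + evalf (\<lambda>d. V [b, d]) (br a c)"
      using fewer[of "u @ [b]" a c v'] iw cb lw by (simp add: V_def swapped_def)
    have iw2: "inversions (u @ [b, c, a] @ v') < inversions w"
      using iw inversions_swap[of c a "u @ [b]" v'] cb by simp
    have 2: "V [b, c, a] = V [c, b, a] + evalf (\<lambda>d. V [d, a]) (br b c)"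
      using fewer[of u b c "a # v'"] iw2 cb lw by (simp add: V_def swapped_def)
    have 3: "V [a, c, b] = V [c, a, b] + evalf (\<lambda>d. V [d, b]) (br a c)"
      using fewer[of u a c "b # v'"] iw cb lw by (simp add: V_def swapped_def)
    have iw3: "inversions (u @ [c, a, b] @ v') < inversions w"
      using iw inversions_swap[of c a u "b # v'"] cb by simp
    have 4: "V [c, a, b] = V [c, b, a] + evalf (\<lambda>d. V [c, d]) (br a b)"
      using fewer[of "u @ [c]" a b v'] iw3 cb lw by (simp add: V_def swapped_def)
    have 5: "V [d, e] - V [e, d] = evalf (\<lambda>x. V [x]) (br d e)" for d e
      using shorter[of u d e v'] lw by (simp add: V_def swapped_def)
    have "swapped F u a b v - swapped F u' a' b' v' =
      (V [b, a, c] + evalf (\<lambda>d. V [d, c]) (br a b)) - (V [a, c, b] + evalf (\<lambda>d. V [a, d]) (br b c))"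
      using eqs by (simp add: swapped_def V_def c_def)
    also have "\<dots> = (evalf (\<lambda>d. V [d, c]) (br a b) - evalf (\<lambda>d. V [c, d]) (br a b))
       + (evalf (\<lambda>d. V [d, a]) (br b c) - evalf (\<lambda>d. V [a, d]) (br b c))
       + (evalf (\<lambda>d. V [b, d]) (br a c) - evalf (\<lambda>d. V [d, b]) (br a c))"
      by (simp add: 1 2 3 4)
    also have "\<dots> = evalf (\<lambda>d. V [d, c] - V [c, d]) (br a b) + evalf (\<lambda>d. V [d, a] - V [a, d]) (br b c)
       + evalf (\<lambda>d. V [d, b] - V [b, d]) (br c a)"
      by (simp add: evalf_fun_diff br_antisym[of c a])
    also have "\<dots> = 0" unfolding 5 by (rule br_jacobi)
    finally show ?thesis by simp
  next
    case (Cons d x)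
    then have eqs: "u' = u @ a # b # x" "v = x @ a' # b' # v'" using w y by auto
    have iw: "inversions (u @ b # a # x @ a' # b' # v') < inversions w"
      "inversions (u @ a # b # x @ b' # a' # v') < inversions w"
      using inversions_swap[of b a u v] inversions_swap[of b' a' u' v'] desc w eqs by simp_all
    have 1: "F (u @ b # a # x @ a' # b' # v') = swapped F (u @ b # a # x) a' b' v'"
      using fewer[of "u @ b # a # x" a' b' v'] iw desc w eqs by simp
    have 2: "F (u @ a # b # x @ b' # a' # v') = swapped F u a b (x @ b' # a' # v')"
      using fewer[of u a b "x @ b' # a' # v'"] iw desc w eqs by simp
    have 3: "F (u @ c # x @ a' # b' # v') = swapped F (u @ c # x) a' b' v'" for c
      using shorter[of "u @ c # x" a' b' v'] w eqs by simp
    have 4: "F (u @ a # b # x @ c # v') = swapped F u a b (x @ c # v')" for c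
      using shorter[of u a b "x @ c # v'"] w eqs by simp
    show ?thesis
      using evalf_swap[of "\<lambda>c d. F (u @ c # x @ d # v')" "br a' b'" "br a b"]
      unfolding eqs swapped_def
      by (simp add: 1 2 3 4) (simp add: swapped_def evalf_fun_add)
  qed
qed

lemma descent_induct [case_names sorted descent]:
  assumes "\<And>w. sorted (map key w) \<Longrightarrow> P w"
    and "\<And>u a b v. key b < key a \<Longrightarrow> P (u @ b # a # v) \<Longrightarrow>
      (\<And>c. c \<in> keys (br a b) \<Longrightarrow> P (u @ c # v)) \<Longrightarrow> P (u @ a # b # v)"
  shows "P w"
proof (induction w rule: wf_induct[OF wf_measures[of "[length, inversions]"]])
  case (1 w)
  then have IH: "P w'" if "(w', w) \<in> measures [length, inversions]" for w' using that by blast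
  show ?case
  proof (cases "sorted (map key w)")
    case False
    from descent_exists[OF this] obtain u a b v where w: "w = u @ a # b # v" "key b < key a" by blast
    show ?thesis
      unfolding w(1) by (rule assms(2)[OF w(2)]; rule IH) (use w in \<open>simp_all add: inversions_swap\<close>)
  qed (rule assms(1))
qed

text \<open>
  Every function on sorted words extends to a linear functional on the enveloping algebra. This is the
  linear independence half of the Poincare-Birkhoff-Witt theorem, in dual form.
\<close>

theorem straighten_swap:
  "straighten f (u @ a # b # v) = swapped (straighten f) u a b v"
proof -
  let ?F = "straighten f"
  have main: "\<forall>u a b v. w = u @ a # b # v \<longrightarrow> key b < key a \<longrightarrow> ?F w = swapped ?F u a b v" for w
  proof (induction w rule: wf_induct[OF wf_measures[of "[length, inversions]"]])
    case (1 w)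
    then have IH0: "(y, w) \<in> measures [length, inversions] \<Longrightarrow> y = u @ a # b # v \<Longrightarrow> key b < key a
      \<Longrightarrow> ?F y = swapped ?F u a b v" for y u a b v by blast
    have IH: "?F (u @ a # b # v) = swapped ?F u a b v"
      if "length (u @ a # b # v) < length w \<or>
        length (u @ a # b # v) = length w \<and> inversions (u @ a # b # v) < inversions w" "key b < key a" for u a b v
      using that by (intro IH0) auto
    have shorter: "?F (u @ a # b # v) = swapped ?F u a b v"
      if "length (u @ a # b # v) < length w" for u a b v
      by (rule swapped_of_descents[where n = "length (u @ a # b # v)"]) (use IH that in auto)
    show ?case
    proof (intro allI impI)
      fix u a b v assume w: "w = u @ a # b # v" and ab: "key b < key a"
      then have "\<not> sorted (map key w)" by (auto simp: sorted_append)
      from straighten_descent[OF this, of f] obtain u' a' b' v' where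
        w': "w = u' @ a' # b' # v'" "key b' < key a'" and eq: "?F w = swapped ?F u' a' b' v'" by blast
      \<comment> \<open>Two descents at the same position coincide, since a word determines its letters.\<close>
      consider "length u < length u'" | "length u' < length u" | "length u = length u'" by linarith
      then have "swapped ?F u a b v = swapped ?F u' a' b' v'"
      proof cases
        case 1
        show ?thesis
          by (rule swapped_confluent[of w]) (use shorter IH w w' ab 1 in auto)
      next
        case 2
        show ?thesis
          by (rule swapped_confluent[of w, symmetric]) (use shorter IH w w' ab 2 in auto)
      next
        case 3
        then show ?thesis using w w' by auto
      qed
      then show "?F w = swapped ?F u a b v" using eq by simp
    qed
  qed
  show ?thesis
    by (rule swapped_of_descents[where n = "length (u @ a # b # v)"]) (use main in auto)
qed

end

text \<open>
  The order lists the generators by index, within an index as \<open>f, h, d, e\<close>, with \<open>C\<close> after \<open>e\<^sub>0\<close>. The offsets are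
  chosen such that the annihilators and eigen-operators of a highest weight vector, that is \<open>C\<close>, \<open>e\<^sub>i\<close>, \<open>h\<^sub>i\<close>, \<open>d\<^sub>i\<close>
  with \<open>i \<ge> 0\<close> and \<open>f\<^sub>i\<close> with \<open>i > 0\<close>, are exactly the generators with a positive key. The others are called negative below, and the former
  nonnegative.
\<close>

fun gkey :: "gen \<Rightarrow> int" where
  "gkey (Egen i) = 5 * i + 3" | "gkey (Fgen i) = 5 * i" | "gkey (Hgen i) = 5 * i + 1"
| "gkey (Dgen i) = 5 * i + 2" | "gkey Cgen = 4"

lemma int_zero_sum2: "x + y = 0 \<Longrightarrow> x = - (y :: int)" by simp
lemma int_zero_sum3: "x + (y + z) = 0 \<Longrightarrow> x = - y - (z :: int)" by simp

text \<open>
  Checked on all combinations of generators. The cases left over by simplification are those in which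
  the indices add up to zero; eliminating one index leaves polynomial identities.
\<close>

lemma gen_bracket_jacobi: "evalf (\<lambda>d. evalf f (gen_bracket d c)) (gen_bracket a b)
   + evalf (\<lambda>d. evalf f (gen_bracket d a)) (gen_bracket b c)
   + evalf (\<lambda>d. evalf f (gen_bracket d b)) (gen_bracket c a) = 0"
  by (cases a; cases b; cases c) (auto simp: ac_simps algebra_simps,
     ((drule int_zero_sum3 | drule int_zero_sum2), hypsubst, simp add: field_simps power3_eq_cube)+)

section \<open>The highest weight functional of the affine-Virasoro algebra\<close>

lemma gen_bracket_antisym: "gen_bracket b a = - gen_bracket a b"
  by (cases a; cases b)
    (auto intro!: poly_mapping_eqI simp: lookup_add lookup_minus lookup_single when_def add.commute split: if_splits,
     (drule int_zero_sum2, hypsubst, simp add: field_simps power3_eq_cube)+)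

lemma inj_gkey: "inj gkey"
proof (rule injI)
  fix a b assume "gkey a = gkey b" then show "a = b" by (cases a; cases b) (simp_all, presburger+)
qed

interpretation gen: lie_basis gen_bracket gkey
  by (unfold_locales) (rule inj_gkey, rule gen_bracket_antisym, rule gen_bracket_jacobi)

text \<open>
  The weight as a function on all generators: on those with a positive key it is the character of the
  subalgebra that they span, and on the others it is zero by convention.
\<close>

fun hw_char :: "complex \<Rightarrow> complex \<Rightarrow> complex \<Rightarrow> gen \<Rightarrow> complex" where
  "hw_char \<eta> \<epsilon> \<theta> (Dgen i) = (if i = 0 then \<eta> else 0)"
| "hw_char \<eta> \<epsilon> \<theta> (Hgen i) = (if i = 0 then \<epsilon> else 0)"
| "hw_char \<eta> \<epsilon> \<theta> Cgen = \<theta>"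
| "hw_char \<eta> \<epsilon> \<theta> _ = 0"

lemma hw_char_neg: "gkey g \<le> 0 \<Longrightarrow> hw_char \<eta> \<epsilon> \<theta> g = 0"
  by (cases g) auto

lemma keys_gen_bracket_pos:
  "0 < gkey a \<Longrightarrow> 0 < gkey b \<Longrightarrow> c \<in> keys (gen_bracket a b) \<Longrightarrow> 0 < gkey c"
  by (cases a; cases b) (auto simp: in_keys_iff lookup_add lookup_single when_def split: if_splits)

lemma keys_gen_bracket_neg:
  "gkey a \<le> 0 \<Longrightarrow> gkey b \<le> 0 \<Longrightarrow> c \<in> keys (gen_bracket a b) \<Longrightarrow> gkey c \<le> 0"
  by (cases a; cases b) (auto simp: in_keys_iff lookup_add lookup_single when_def split: if_splits)

lemma hw_char_bracket:
  "0 < gkey a \<Longrightarrow> 0 < gkey b \<Longrightarrow> evalf (hw_char \<eta> \<epsilon> \<theta>) (gen_bracket a b) = 0"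
proof (cases a; cases b)
  fix i j assume h: "0 < gkey a" "0 < gkey b" "a = Dgen i" "b = Dgen j"
  then have "i + j = 0 \<longleftrightarrow> i = 0 \<and> j = 0" by auto
  then show ?thesis using h by auto
qed auto

lemma sorted_split_sign:
  assumes "sorted (map gkey w)"
  obtains n b where "w = n @ b" "sorted (map gkey n)" "sorted (map gkey b)"
    "\<And>g. g \<in> set n \<Longrightarrow> gkey g \<le> 0" "\<And>g. g \<in> set b \<Longrightarrow> 0 < gkey g"
proof -
  have "\<exists>n b. w = n @ b \<and> (\<forall>g\<in>set n. gkey g \<le> 0) \<and> (\<forall>g\<in>set b. 0 < gkey g)" using assms
  proof (induction w)
    case (Cons g w)
    then obtain n b where nb: "w = n @ b" "\<forall>g\<in>set n. gkey g \<le> 0" "\<forall>g\<in>set b. 0 < gkey g" by auto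
    show ?case
    proof (cases "gkey g \<le> 0")
      case True
      then show ?thesis using nb by (intro exI[of _ "g # n"] exI[of _ b]) auto
    next
      case False
      then have "\<forall>x\<in>set w. 0 < gkey x" using Cons.prems by auto
      then show ?thesis using False by (intro exI[of _ "[]"] exI[of _ "g # w"]) auto
    qed
  qed simp
  then obtain n b where nb: "w = n @ b" "\<forall>g\<in>set n. gkey g \<le> 0" "\<forall>g\<in>set b. 0 < gkey g" by blast
  show ?thesis by (rule that[OF nb(1)]) (use nb assms in \<open>auto simp: sorted_append\<close>)
qed

context
  fixes \<eta> \<epsilon> \<theta> :: complex
begin

text \<open>
  On sorted words negative generators come first, so the product below vanishes as soon as one of them
  occurs. The functional is thus the projection of the enveloping algebra to the highest weight line of
  the Verma module.
\<close>

definition verma_functional :: "gen list \<Rightarrow> complex" where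
  "verma_functional = gen.straighten (\<lambda>w. prod_list (map (hw_char \<eta> \<epsilon> \<theta>) w))"

lemma verma_functional_swap:
  "verma_functional (u @ a # b # v) = verma_functional (u @ b # a # v) +
     evalf (\<lambda>c. verma_functional (u @ c # v)) (gen_bracket a b)"
  unfolding verma_functional_def by (rule gen.straighten_swap[unfolded gen.swapped_def])

lemma verma_functional_sorted:
  "sorted (map gkey w) \<Longrightarrow> verma_functional w = prod_list (map (hw_char \<eta> \<epsilon> \<theta>) w)"
  unfolding verma_functional_def by (rule gen.straighten_sorted)

lemma verma_functional_Nil [simp]: "verma_functional [] = 1"
  by (simp add: verma_functional_sorted)

text \<open>
  Straightening the nonnegative part \<open>b\<close> behind a sorted negative word never touches the negative part,
  and the bracket terms cancel because the weight vanishes on commutators of nonnegative generators.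
\<close>

lemma verma_functional_neg_pos:
  assumes "sorted (map gkey n)" "\<And>g. g \<in> set n \<Longrightarrow> gkey g \<le> 0" "\<And>g. g \<in> set b \<Longrightarrow> 0 < gkey g"
  shows "verma_functional (n @ b) = prod_list (map (hw_char \<eta> \<epsilon> \<theta>) (n @ b))"
  using assms(3)
proof (induction b rule: gen.descent_induct)
  case (sorted b)
  have "gkey x \<le> gkey y" if "x \<in> set n" "y \<in> set b" for x y
    using assms(2)[OF that(1)] sorted.prems[OF that(2)] by linarith
  then have "sorted (map gkey (n @ b))" using sorted.hyps assms(1) by (auto simp: sorted_append)
  then show ?case by (rule verma_functional_sorted)
next
  case (descent u a b v)
  let ?c = "hw_char \<eta> \<epsilon> \<theta>"
  have ab: "0 < gkey a" "0 < gkey b" using descent.prems by auto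
  have "evalf (\<lambda>c. verma_functional (n @ u @ c # v)) (gen_bracket a b) =
      evalf (\<lambda>c. (prod_list (map ?c n) * prod_list (map ?c u) * prod_list (map ?c v)) * ?c c) (gen_bracket a b)"
    by (rule evalf_cong, subst descent.IH(2)) (use descent.prems keys_gen_bracket_pos[OF ab] in auto)
  also have "\<dots> = 0" unfolding evalf_fun_mult by (simp add: hw_char_bracket[OF ab])
  finally have "verma_functional ((n @ u) @ a # b # v) = verma_functional (n @ u @ b # a # v)"
    using verma_functional_swap[of "n @ u" a b v] by simp
  moreover have "verma_functional (n @ u @ b # a # v) = prod_list (map ?c (n @ u @ b # a # v))"
    by (rule descent.IH(1)) (use descent.prems in auto)
  ultimately show ?case by (simp add: mult.left_commute)
qed

text \<open>
  The functional factors through the left ideal that defines the Verma module. For a sorted word this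
  is the previous lemma, applied with and without the last letter, and both sides of the straightening
  relation are compatible with appending a letter.
\<close>

lemma verma_functional_snoc:
  assumes "0 < gkey x"
  shows "verma_functional (w @ [x]) = hw_char \<eta> \<epsilon> \<theta> x * verma_functional w"
proof (induction w rule: gen.descent_induct)
  case (sorted w)
  from sorted_split_sign[OF this] obtain n b where w: "w = n @ b" "sorted (map gkey n)" "sorted (map gkey b)"
    "\<And>g. g \<in> set n \<Longrightarrow> gkey g \<le> 0" "\<And>g. g \<in> set b \<Longrightarrow> 0 < gkey g" by blast
  have "verma_functional (n @ b @ [x]) = prod_list (map (hw_char \<eta> \<epsilon> \<theta>) (n @ b @ [x]))"
    by (rule verma_functional_neg_pos) (use w assms in auto)
  then show ?case using verma_functional_neg_pos[of n b] w by simp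
next
  case (descent u a b v)
  have "evalf (\<lambda>c. verma_functional (u @ c # v @ [x])) (gen_bracket a b) =
    hw_char \<eta> \<epsilon> \<theta> x * evalf (\<lambda>c. verma_functional (u @ c # v)) (gen_bracket a b)"
    unfolding evalf_fun_mult[symmetric] by (rule evalf_cong) (use descent.IH in auto)
  then show ?case
    using descent.IH(1) verma_functional_swap[of u a b "v @ [x]"] verma_functional_swap[of u a b v]
    by (simp add: algebra_simps)
qed

lemma verma_functional_neg:
  assumes "w \<noteq> []" "\<And>g. g \<in> set w \<Longrightarrow> gkey g \<le> 0"
  shows "verma_functional w = 0"
  using assms
proof (induction w rule: gen.descent_induct)
  case (sorted w)
  then show ?case by (cases w) (simp_all add: verma_functional_sorted hw_char_neg)
next
  case (descent u a b v)
  have ab: "gkey a \<le> 0" "gkey b \<le> 0" using descent.prems by auto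
  have "evalf (\<lambda>c. verma_functional (u @ c # v)) (gen_bracket a b) = evalf (\<lambda>c. 0) (gen_bracket a b)"
    by (rule evalf_cong, subst descent.IH(2)) (use descent.prems keys_gen_bracket_neg[OF ab] in auto)
  then show ?case using verma_functional_swap[of u a b v] descent by (auto simp: evalf_def)
qed

end

fun index :: "gen \<Rightarrow> int" where
  "index (Egen i) = i" | "index (Fgen i) = i" | "index (Hgen i) = i" | "index (Dgen i) = i"
| "index Cgen = 0"

lemma gkey_index: "0 < index g \<Longrightarrow> 0 < gkey g" by (cases g) auto

lemma hw_char_index: "0 < index g \<Longrightarrow> hw_char \<eta> \<epsilon> \<theta> g = 0" by (cases g) auto

lemma keys_gen_bracket_index:
  "index a + index b \<noteq> 0 \<Longrightarrow> c \<in> keys (gen_bracket a b) \<Longrightarrow> index c = index a + index b"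
  by (cases a; cases b) (auto simp: in_keys_iff lookup_add lookup_single when_def split: if_splits)

text \<open>
  A generator of large index commutes past a fixed word up to generators whose index is still large,
  and at the right end of the word it gives zero.
\<close>

lemma verma_functional_smooth:
  "\<exists>K>0. \<forall>g. K \<le> index g \<longrightarrow> (\<forall>u. verma_functional \<eta> \<epsilon> \<theta> (u @ g # v) = 0)"
proof (induction v)
  case Nil
  show ?case
    by (rule exI[of _ 1]) (auto simp: verma_functional_snoc gkey_index hw_char_index)
next
  case (Cons a v)
  then obtain K where K: "K > 0" "\<And>g u. K \<le> index g \<Longrightarrow> verma_functional \<eta> \<epsilon> \<theta> (u @ g # v) = 0" by blast
  show ?case
  proof (intro exI[of _ "K + \<bar>index a\<bar>"] conjI allI impI)
    fix g u assume g: "K + \<bar>index a\<bar> \<le> index g"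
    have "evalf (\<lambda>c. verma_functional \<eta> \<epsilon> \<theta> (u @ c # v)) (gen_bracket g a) = evalf (\<lambda>c. 0) (gen_bracket g a)"
      by (rule evalf_cong, rule K(2), subst keys_gen_bracket_index[of g a]) (use g K(1) in auto)
    then show "verma_functional \<eta> \<epsilon> \<theta> (u @ g # a # v) = 0"
      using K(2)[of g "u @ [a]"] g verma_functional_swap[of \<eta> \<epsilon> \<theta> u g a v] by (simp add: evalf_def)
  qed (use K in auto)
qed

section \<open>Quotients of modules\<close>

definition lie_hom :: "'a lie_module \<Rightarrow> 'b lie_module \<Rightarrow> ('a \<Rightarrow> 'b) set"
  where "lie_hom M N = {\<phi>. \<phi> ` carrier M \<subseteq> carrier N \<and>
    (\<forall>u\<in>carrier M. \<forall>v\<in>carrier M. \<phi> (u \<oplus>\<^bsub>M\<^esub> v) = \<phi> u \<oplus>\<^bsub>N\<^esub> \<phi> v) \<and>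
    (\<forall>c. \<forall>v\<in>carrier M. \<phi> (c \<odot>\<^bsub>M\<^esub> v) = c \<odot>\<^bsub>N\<^esub> \<phi> v) \<and>
    (\<forall>x. \<forall>v\<in>carrier M. \<phi> (act M x v) = act N x (\<phi> v))}"

text \<open>
  The part of the module axioms that passing to quotients requires. Linearity of the action in the Lie
  algebra is left out, because it holds for the formal sums of pairs underlying a tensor product
  only modulo the tensor relations.
\<close>

locale linear_module = abelian_group M for M :: "'a lie_module" (structure) +
  assumes smult_closed [simp]: "v \<in> carrier M \<Longrightarrow> c \<odot> v \<in> carrier M"
    and smult_add: "u \<in> carrier M \<Longrightarrow> v \<in> carrier M \<Longrightarrow> c \<odot> (u \<oplus> v) = c \<odot> u \<oplus> c \<odot> v"
    and act_closed [simp]: "v \<in> carrier M \<Longrightarrow> act M x v \<in> carrier M"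
    and act_add: "u \<in> carrier M \<Longrightarrow> v \<in> carrier M \<Longrightarrow> act M x (u \<oplus> v) = act M x u \<oplus> act M x v"

lemma submodule_complex_iff:
  "submodule N complex_ring M \<longleftrightarrow> subgroup N (add_monoid M) \<and> (\<forall>c. \<forall>v\<in>N. c \<odot>\<^bsub>M\<^esub> v \<in> N)"
  by (auto simp: submodule_def submodule_axioms_def ring_of_type_algebra_def)

lemma (in abelian_subgroup) a_rcos_eq_iff:
  "u \<in> carrier G \<Longrightarrow> v \<in> carrier G \<Longrightarrow> H +> u = H +> v \<longleftrightarrow> u \<ominus> v \<in> H"
  unfolding a_minus_def
  by (metis a_rcos_self a_subset a_closed a_coset_add_inv1 a_coset_add_inv2 a_coset_join2 a_inv_closed
      a_subgroup)

definition induced_map :: "('a \<Rightarrow> 'b) \<Rightarrow> 'a set \<Rightarrow> 'b" where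
  "induced_map f A = f (SOME a. a \<in> A)"

context linear_module
begin

context
  fixes N assumes N: "lie_submodule N M"
begin

lemma submodule_subgroup: "subgroup N (add_monoid M)"
  and submodule_smult: "v \<in> N \<Longrightarrow> c \<odot> v \<in> N"
  and submodule_act: "v \<in> N \<Longrightarrow> act M x v \<in> N"
  using N by (auto simp: lie_submodule_def submodule_complex_iff)

lemma submodule_abelian: "abelian_subgroup N M"
  by (intro abelian_subgroupI3 additive_subgroup.intro submodule_subgroup abelian_group_axioms)

interpretation N: abelian_subgroup N M by (rule submodule_abelian)

lemma carrier_lie_quot: "carrier (lie_quot M N) = (\<lambda>v. N +> v) ` carrier M"
  by (auto simp: lie_quot_def A_RCOSETS_def')

lemma zero_lie_quot: "\<zero>\<^bsub>lie_quot M N\<^esub> = N +> \<zero>"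
  by (simp add: lie_quot_def N.a_subset)

lemma add_lie_quot:
  "u \<in> carrier M \<Longrightarrow> v \<in> carrier M \<Longrightarrow> (N +> u) \<oplus>\<^bsub>lie_quot M N\<^esub> (N +> v) = N +> (u \<oplus> v)"
  by (simp add: lie_quot_def N.a_rcos_sum)

text \<open>
  The operations of a quotient module are unions over all representatives of a coset. All members
  of such a union coincide.
\<close>

lemma coset_UN:
  assumes f: "\<And>u. u \<in> carrier M \<Longrightarrow> f u \<in> carrier M" "\<And>u. u \<in> N \<Longrightarrow> f u \<in> N"
    "\<And>u v. u \<in> carrier M \<Longrightarrow> v \<in> carrier M \<Longrightarrow> f (u \<oplus> v) = f u \<oplus> f v"
    and v: "v \<in> carrier M"
  shows "(\<Union>a\<in>N +> v. N +> f a) = N +> f v"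
proof -
  have "N +> f a = N +> f v" if "a \<in> N +> v" for a
  proof -
    from that obtain n where n: "n \<in> N" "a = n \<oplus> v" by (auto simp: a_r_coset_def')
    then have "f a \<in> N +> f v" using f v N.a_subset by (auto simp: a_r_coset_def')
    then show ?thesis using a_repr_independence f(1) submodule_subgroup v by blast
  qed
  then show ?thesis using N.a_rcos_self[OF v] by blast
qed

lemma smult_lie_quot: "v \<in> carrier M \<Longrightarrow> c \<odot>\<^bsub>lie_quot M N\<^esub> (N +> v) = N +> (c \<odot> v)"
  unfolding lie_quot_def by simp (rule coset_UN; simp add: submodule_smult smult_add)

lemma act_lie_quot: "v \<in> carrier M \<Longrightarrow> act (lie_quot M N) x (N +> v) = N +> act M x v"
  unfolding lie_quot_def by simp (rule coset_UN; simp add: submodule_act act_add)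

lemma linear_module_lie_quot: "linear_module (lie_quot M N)"
proof (intro linear_module.intro linear_module_axioms.intro abelian_groupI)
  fix x assume "x \<in> carrier (lie_quot M N)"
  then obtain u where u: "u \<in> carrier M" "x = N +> u" by (auto simp: carrier_lie_quot)
  have "(N +> \<ominus> u) \<oplus>\<^bsub>lie_quot M N\<^esub> x = \<zero>\<^bsub>lie_quot M N\<^esub>"
    using u by (simp add: zero_lie_quot add_lie_quot l_neg)
  then show "\<exists>y\<in>carrier (lie_quot M N). y \<oplus>\<^bsub>lie_quot M N\<^esub> x = \<zero>\<^bsub>lie_quot M N\<^esub>"
    using u by (auto simp: carrier_lie_quot)
qed (auto simp: carrier_lie_quot zero_lie_quot add_lie_quot smult_lie_quot act_lie_quot
      a_ac smult_add act_add)

context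
  fixes f and L :: "'b lie_module"
  assumes f: "f \<in> lie_hom M L" and L: "linear_module L" and kernel: "\<And>v. v \<in> N \<Longrightarrow> f v = \<zero>\<^bsub>L\<^esub>"
begin

interpretation L: linear_module L by (rule L)

lemma hom_minus:
  assumes "u \<in> carrier M" "v \<in> carrier M"
  shows "f u = f v \<longleftrightarrow> f (u \<ominus> v) = \<zero>\<^bsub>L\<^esub>"
proof -
  have "f ((u \<ominus> v) \<oplus> v) = f (u \<ominus> v) \<oplus>\<^bsub>L\<^esub> f v" using f assms by (auto simp: lie_hom_def)
  moreover have "(u \<ominus> v) \<oplus> v = u" using assms by (simp add: a_minus_def a_assoc l_neg)
  moreover have "f (u \<ominus> v) \<in> carrier L" "f v \<in> carrier L" using f assms by (auto simp: lie_hom_def)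
  ultimately show ?thesis by (metis L.add.r_cancel_one')
qed

lemma induced_map_coset: "v \<in> carrier M \<Longrightarrow> induced_map f (N +> v) = f v"
proof -
  assume v: "v \<in> carrier M"
  define a where "a = (SOME a. a \<in> N +> v)"
  have "a \<in> N +> v" unfolding a_def by (rule someI[of _ v]) (rule N.a_rcos_self[OF v])
  then obtain n where n: "n \<in> N" "a = n \<oplus> v" by (auto simp: a_r_coset_def')
  then have "n \<in> carrier M" using N.a_subset by auto
  then have "a \<in> carrier M" "a \<ominus> v \<in> N" using v n by (simp_all add: a_minus_def a_assoc r_neg)
  then show ?thesis using hom_minus[of a v] kernel v by (simp add: induced_map_def a_def)
qed

lemma induced_map_hom: "induced_map f \<in> lie_hom (lie_quot M N) L"
  using f by (auto simp: lie_hom_def carrier_lie_quot induced_map_coset add_lie_quot smult_lie_quot act_lie_quot)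

text \<open>
  The first isomorphism theorem.
\<close>

lemma induced_map_iso:
  assumes "f ` carrier M = carrier L" "\<And>v. v \<in> carrier M \<Longrightarrow> f v = \<zero>\<^bsub>L\<^esub> \<Longrightarrow> v \<in> N"
  shows "induced_map f \<in> lie_iso (lie_quot M N) L"
proof -
  have "inj_on (induced_map f) (carrier (lie_quot M N))"
    by (auto simp: inj_on_def carrier_lie_quot induced_map_coset N.a_rcos_eq_iff hom_minus intro: assms(2))
  moreover have "induced_map f ` carrier (lie_quot M N) = carrier L"
    unfolding assms(1)[symmetric] carrier_lie_quot image_image by (simp add: induced_map_coset)
  ultimately show ?thesis
    using induced_map_hom by (auto simp: lie_iso_def lie_hom_def bij_betw_def)
qed

end

end

end

lemma kernel_submodule:
  assumes "linear_module M" "linear_module L" "f \<in> lie_hom M L"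
  shows "lie_submodule {v \<in> carrier M. f v = \<zero>\<^bsub>L\<^esub>} M"
proof -
  interpret M: linear_module M by fact
  interpret L: linear_module L by fact
  have f: "f v \<in> carrier L" "f (u \<oplus>\<^bsub>M\<^esub> v) = f u \<oplus>\<^bsub>L\<^esub> f v" "f (c \<odot>\<^bsub>M\<^esub> v) = c \<odot>\<^bsub>L\<^esub> f v"
    "f (act M x v) = act L x (f v)" if "u \<in> carrier M" "v \<in> carrier M" for u v c x
    using assms(3) that by (auto simp: lie_hom_def)
  have zero: "c \<odot>\<^bsub>L\<^esub> \<zero>\<^bsub>L\<^esub> = \<zero>\<^bsub>L\<^esub>" "act L x \<zero>\<^bsub>L\<^esub> = \<zero>\<^bsub>L\<^esub>" for c x
    using L.smult_add[of "\<zero>\<^bsub>L\<^esub>" "\<zero>\<^bsub>L\<^esub>" c] L.act_add[of "\<zero>\<^bsub>L\<^esub>" "\<zero>\<^bsub>L\<^esub>" x]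
    by (simp_all add: L.add.r_cancel_one' L.add.l_cancel_one)
  have f0: "f \<zero>\<^bsub>M\<^esub> = \<zero>\<^bsub>L\<^esub>"
    using f(1,2)[of "\<zero>\<^bsub>M\<^esub>" "\<zero>\<^bsub>M\<^esub>"] by (simp add: L.add.r_cancel_one')
  have "subgroup {v \<in> carrier M. f v = \<zero>\<^bsub>L\<^esub>} (add_monoid M)"
  proof (rule group.subgroupI[OF M.a_group])
    fix v assume "v \<in> {v \<in> carrier M. f v = \<zero>\<^bsub>L\<^esub>}"
    then have v: "v \<in> carrier M" "f v = \<zero>\<^bsub>L\<^esub>" by auto
    have "f (\<ominus>\<^bsub>M\<^esub> v) \<oplus>\<^bsub>L\<^esub> f v = f (\<ominus>\<^bsub>M\<^esub> v \<oplus>\<^bsub>M\<^esub> v)" using f(2)[of "\<ominus>\<^bsub>M\<^esub> v" v] v by simp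
    then have "f (\<ominus>\<^bsub>M\<^esub> v) = \<zero>\<^bsub>L\<^esub>" using v f0 f(1)[of v "\<ominus>\<^bsub>M\<^esub> v"] by (simp add: M.l_neg)
    then show "inv\<^bsub>add_monoid M\<^esub> v \<in> {v \<in> carrier M. f v = \<zero>\<^bsub>L\<^esub>}"
      using v by (simp add: a_inv_def[symmetric])
  qed (use f f0 in auto)
  then show ?thesis
    using f zero by (auto simp: lie_submodule_def submodule_complex_iff)
qed

section \<open>The enveloping algebra and translates of the functional\<close>

text \<open>
  Linear statements about finitely supported functions are proved by induction on sums of monomials.
\<close>

lemma poly_mapping_monomials:
  "p = (\<Sum>k\<in>keys p. single k (lookup p k))"
  by (rule poly_mapping_eqI) (auto simp: lookup_sum lookup_single when_def in_keys_iff)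

lemma poly_mapping_add_induct [case_names single add]:
  fixes p :: "'a \<Rightarrow>\<^sub>0 'b::comm_monoid_add"
  assumes "\<And>k c. P (single k c)" "\<And>p q. P p \<Longrightarrow> P q \<Longrightarrow> P (p + q)"
  shows "P p"
proof -
  have "P (\<Sum>k\<in>A. single k (lookup p k))" if "finite A" for A
    using that by (induction A) (use assms assms(1)[of undefined 0] in auto)
  from this[OF finite_keys, of p] show ?thesis using poly_mapping_monomials[of p] by simp
qed

lemma evalf_mult: "evalf g (p * q) = evalf (\<lambda>v. evalf (\<lambda>w. g (v + w)) q) p"
proof (induction p rule: poly_mapping_add_induct)
  case (single k c)
  show ?case
    by (induction q rule: poly_mapping_add_induct) (simp_all add: mult_single algebra_simps)
qed (simp add: algebra_simps)

lemma scale_conv_mult: "scale c p = single 0 c * (p :: 'a::monoid_add \<Rightarrow>\<^sub>0 complex)"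
  unfolding scale_def by (rule mult_map_scale_conv_mult)

lemma single_zero_central:
  "(p :: 'a::monoid_add \<Rightarrow>\<^sub>0 complex) * single 0 c = single 0 c * p"
  by (induction p rule: poly_mapping_add_induct) (simp_all add: mult_single algebra_simps)

lemma lin_extend_add [simp]: "lin_extend f (x + y) = lin_extend f x + lin_extend f y"
  unfolding lin_extend_def
  by (rule sum_keys_add) (auto intro!: poly_mapping_eqI simp: lookup_add algebra_simps)

lemma lin_extend_single [simp]: "lin_extend f (single a c) = scale c (f a)"
  by (cases "c = 0") (auto simp: lin_extend_def intro!: poly_mapping_eqI)

lemma word_embed_add [simp]: "word_embed (x + y) = word_embed x + word_embed y"
  by (simp add: word_embed_def)

lemma word_embed_single [simp]: "word_embed (single a c) = single (Word [a]) c"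
  by (simp add: word_embed_def)

lemma word_embed_zero [simp]: "word_embed 0 = 0"
  by (simp add: word_embed_def lin_extend_def)

lemma word_embed_uminus [simp]: "word_embed (- x) = - word_embed x"
  using word_embed_add[of x "- x"] by (simp add: add_eq_0_iff)

lemma evalf_word_embed: "evalf f (word_embed x) = evalf (\<lambda>a. f (Word [a])) x"
  by (simp add: word_embed_def evalf_lin_extend)

lemma evalf_bracket: "evalf f (bracket x y) = evalf (\<lambda>a. evalf (\<lambda>b. evalf f (gen_bracket a b)) y) x"
  by (simp add: bracket_def evalf_lin_extend)

primrec letters :: "word \<Rightarrow> gen list" where "letters (Word w) = w"

lemma letters_add [simp]: "letters (v + w) = letters v @ letters w"
  by (cases v; cases w) simp

lemma letters_zero [simp]: "letters 0 = []"
  by (simp add: zero_word_def)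

text \<open>
  Spaces of functions on words that are stable under \<open>\<rho> \<mapsto> (w \<mapsto> \<rho>(wg))\<close>. For a functional \<open>F\<close> on the
  enveloping algebra and \<open>\<rho>(w) = F(wp)\<close>, this translate belongs to \<open>gp\<close>, so right translation of functions is
  the left action of the algebra.
\<close>

definition translation_closed :: "(gen list \<Rightarrow> complex) set \<Rightarrow> bool" where
  "translation_closed R \<longleftrightarrow> (\<lambda>_. 0) \<in> R \<and> (\<forall>\<rho>\<in>R. \<forall>\<sigma>\<in>R. (\<lambda>w. \<rho> w + \<sigma> w) \<in> R) \<and>
     (\<forall>c. \<forall>\<rho>\<in>R. (\<lambda>w. c * \<rho> w) \<in> R) \<and> (\<forall>g. \<forall>\<rho>\<in>R. (\<lambda>w. \<rho> (w @ [g])) \<in> R)"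

definition smooth :: "(gen list \<Rightarrow> complex) set \<Rightarrow> bool" where
  "smooth R \<longleftrightarrow> (\<forall>\<rho>\<in>R. \<exists>K. \<forall>g. K \<le> index g \<longrightarrow> (\<forall>w. \<rho> (w @ [g]) = 0))"

definition function_module :: "(gen list \<Rightarrow> complex) set \<Rightarrow> (gen list \<Rightarrow> complex) lie_module" where
  "function_module R = \<lparr>carrier = R, monoid.mult = undefined, one = undefined, ring.zero = (\<lambda>_. 0),
     add = (\<lambda>\<rho> \<sigma> w. \<rho> w + \<sigma> w), module.smult = (\<lambda>c \<rho> w. c * \<rho> w),
     act = (\<lambda>x \<rho> w. evalf (\<lambda>g. \<rho> (w @ [g])) x)\<rparr>"

lemma translation_closed_act:
  assumes R: "translation_closed R" and "\<rho> \<in> R"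
  shows "(\<lambda>w. evalf (\<lambda>g. \<rho> (w @ [g])) x) \<in> R"
proof (induction x rule: poly_mapping_add_induct)
  case (single g c)
  have "(\<lambda>w. c * (\<lambda>w. \<rho> (w @ [g])) w) \<in> R" using assms by (simp add: translation_closed_def)
  then show ?case by simp
next
  case (add x y)
  then show ?case using R by (simp add: translation_closed_def)
qed

lemma linear_module_function_module:
  assumes "translation_closed R" shows "linear_module (function_module R)"
proof (intro linear_module.intro linear_module_axioms.intro abelian_groupI)
  fix \<rho> assume "\<rho> \<in> carrier (function_module R)"
  then have "\<rho> \<in> R" by (simp add: function_module_def)
  moreover have "\<forall>c. \<forall>\<rho>\<in>R. (\<lambda>w. c * \<rho> w) \<in> R" using assms by (simp add: translation_closed_def)
  ultimately have "(\<lambda>w. - 1 * \<rho> w) \<in> R" by blast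
  then show "\<exists>y\<in>carrier (function_module R). y \<oplus>\<^bsub>function_module R\<^esub> \<rho> = \<zero>\<^bsub>function_module R\<^esub>"
    by (auto simp: function_module_def intro!: bexI)
qed (use assms translation_closed_act[OF assms] in
   \<open>auto simp: function_module_def translation_closed_def algebra_simps evalf_fun_add\<close>)

lemma tensor_ring_simps [simp]:
  "carrier tensor_ring = UNIV" "x \<otimes>\<^bsub>tensor_ring\<^esub> y = x * y" "\<one>\<^bsub>tensor_ring\<^esub> = 1"
  "\<zero>\<^bsub>tensor_ring\<^esub> = 0" "x \<oplus>\<^bsub>tensor_ring\<^esub> y = x + y"
  by (simp_all add: ring_of_type_algebra_def)

lemma tensor_ring: "ring tensor_ring"
  by (intro ringI abelian_groupI monoidI)
    (auto simp: algebra_simps intro: exI[of _ "- x" for x])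

lemma subgroup_tensor_ring:
  assumes "0 \<in> I" "\<And>p q. p \<in> I \<Longrightarrow> q \<in> I \<Longrightarrow> p + q \<in> I" "\<And>p. p \<in> I \<Longrightarrow> - p \<in> I"
  shows "subgroup I (add_monoid tensor_ring)"
proof -
  interpret ring tensor_ring by (rule tensor_ring)
  show ?thesis
  proof (rule group.subgroupI[OF a_group])
    fix a :: tensor_alg assume "a \<in> I"
    moreover have "\<ominus>\<^bsub>tensor_ring\<^esub> a = - a"
      by (rule minus_equality) simp_all
    ultimately show "inv\<^bsub>add_monoid tensor_ring\<^esub> a \<in> I"
      unfolding a_inv_def[symmetric] using assms(3) by simp
  qed (use assms in auto)
qed

lemma tensor_ring_minus [simp]: "a \<ominus>\<^bsub>tensor_ring\<^esub> b = a - b"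
proof -
  interpret ring tensor_ring by (rule tensor_ring)
  have "\<ominus>\<^bsub>tensor_ring\<^esub> b = - b" by (rule minus_equality) simp_all
  then show ?thesis by (simp add: a_minus_def)
qed

lemma ideal_env_ideal: "ideal env_ideal tensor_ring"
  unfolding env_ideal_def by (rule ring.genideal_ideal[OF tensor_ring]) simp

lemma abelian_subgroup_env_ideal: "abelian_subgroup env_ideal tensor_ring"
proof -
  interpret ideal env_ideal tensor_ring by (rule ideal_env_ideal)
  show ?thesis by (rule is_abelian_subgroup)
qed

abbreviation env_relation :: "affvir \<Rightarrow> affvir \<Rightarrow> tensor_alg" where
  "env_relation x y \<equiv> word_embed x * word_embed y - word_embed y * word_embed x - word_embed (bracket x y)"

lemma env_relation_mem: "env_relation x y \<in> env_ideal"
  unfolding env_ideal_def by (rule subsetD[OF ring.genideal_self[OF tensor_ring]]) auto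

lemma env_proj_eq_iff: "env_proj p = env_proj q \<longleftrightarrow> p - q \<in> env_ideal"
  using abelian_subgroup.a_rcos_eq_iff[OF abelian_subgroup_env_ideal, of p q] by (simp add: env_proj_def)

lemma carrier_env: "carrier env = range env_proj"
  by (auto simp: env_def FactRing_def A_RCOSETS_def' env_proj_def)

lemma env_ops [simp]:
  "env_proj p \<oplus>\<^bsub>env\<^esub> env_proj q = env_proj (p + q)"
  "env_proj p \<otimes>\<^bsub>env\<^esub> env_proj q = env_proj (p * q)"
  "\<zero>\<^bsub>env\<^esub> = env_proj 0"
  using abelian_subgroup.a_rcos_sum[OF abelian_subgroup_env_ideal, of p q]
    ideal.rcoset_mult_add[OF ideal_env_ideal, of p q]
    abelian_group.a_coset_add_zero[OF ring.is_abelian_group[OF tensor_ring], of env_ideal]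
  by (simp_all add: env_def FactRing_def env_proj_def)

lemma env_module_simps [simp]:
  "carrier env_module = range env_proj"
  "env_proj p \<oplus>\<^bsub>env_module\<^esub> env_proj q = env_proj (p + q)"
  "\<zero>\<^bsub>env_module\<^esub> = env_proj 0"
  "c \<odot>\<^bsub>env_module\<^esub> env_proj p = env_proj (scale c p)"
  "act env_module x (env_proj p) = env_proj (word_embed x * p)"
  by (simp_all add: env_module_def carrier_env scale_conv_mult)

lemma linear_module_env_module: "linear_module env_module"
proof (intro linear_module.intro linear_module_axioms.intro abelian_groupI)
  fix x assume "x \<in> carrier env_module"
  then obtain p where "x = env_proj p" by auto
  then have "env_proj (- p) \<oplus>\<^bsub>env_module\<^esub> x = \<zero>\<^bsub>env_module\<^esub>" by simp
  then show "\<exists>y\<in>carrier env_module. y \<oplus>\<^bsub>env_module\<^esub> x = \<zero>\<^bsub>env_module\<^esub>"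
    unfolding env_module_simps(1) by blast
qed (auto simp: algebra_simps scale_conv_mult)

context
  fixes \<eta> \<epsilon> \<theta> :: complex
begin

text \<open>
  The function \<open>u \<mapsto> F(up)\<close> on words.
\<close>

definition matrix_coeff :: "tensor_alg \<Rightarrow> gen list \<Rightarrow> complex" where
  "matrix_coeff p u = evalf (\<lambda>w. verma_functional \<eta> \<epsilon> \<theta> (u @ letters w)) p"

lemma matrix_coeff_add [simp]: "matrix_coeff (p + q) u = matrix_coeff p u + matrix_coeff q u"
  and matrix_coeff_diff [simp]: "matrix_coeff (p - q) u = matrix_coeff p u - matrix_coeff q u"
  and matrix_coeff_uminus [simp]: "matrix_coeff (- p) u = - matrix_coeff p u"
  and matrix_coeff_scale [simp]: "matrix_coeff (scale c p) u = c * matrix_coeff p u"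
  and matrix_coeff_single: "matrix_coeff (single w c) u = c * verma_functional \<eta> \<epsilon> \<theta> (u @ letters w)"
  and matrix_coeff_zero [simp]: "matrix_coeff 0 u = 0"
  by (simp_all add: matrix_coeff_def)

lemma matrix_coeff_mult: "matrix_coeff (p * q) u = evalf (\<lambda>w. matrix_coeff q (u @ letters w)) p"
  by (simp add: matrix_coeff_def evalf_mult)

lemma matrix_coeff_embed_mult:
  "matrix_coeff (word_embed x * q) u = evalf (\<lambda>a. matrix_coeff q (u @ [a])) x"
  by (simp add: matrix_coeff_mult evalf_word_embed)

lemma matrix_coeff_one: "matrix_coeff 1 u = verma_functional \<eta> \<epsilon> \<theta> u"
  by (simp flip: single_one add: matrix_coeff_single)

lemma matrix_coeff_swap:
  "matrix_coeff q (u @ [a, b]) = matrix_coeff q (u @ [b, a]) + evalf (\<lambda>c. matrix_coeff q (u @ [c])) (gen_bracket a b)"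
proof -
  have "matrix_coeff q (u @ [a, b]) = evalf (\<lambda>w. verma_functional \<eta> \<epsilon> \<theta> (u @ b # a # letters w) +
     evalf (\<lambda>c. verma_functional \<eta> \<epsilon> \<theta> (u @ c # letters w)) (gen_bracket a b)) q"
    unfolding matrix_coeff_def by (rule evalf_cong) (simp, rule verma_functional_swap)
  then show ?thesis by (simp add: evalf_fun_add evalf_swap[of _ "gen_bracket a b" q] matrix_coeff_def)
qed

lemma matrix_coeff_relation: "matrix_coeff (env_relation x y * q) u = 0"
proof -
  have "matrix_coeff (env_relation x y * q) u =
    evalf (\<lambda>a. evalf (\<lambda>b. matrix_coeff q (u @ [a, b])) y) x - evalf (\<lambda>b. evalf (\<lambda>a. matrix_coeff q (u @ [b, a])) x) y
    - evalf (\<lambda>a. evalf (\<lambda>b. evalf (\<lambda>c. matrix_coeff q (u @ [c])) (gen_bracket a b)) y) x"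
    by (simp add: left_diff_distrib mult.assoc matrix_coeff_embed_mult evalf_bracket)
  also have "evalf (\<lambda>a. evalf (\<lambda>b. matrix_coeff q (u @ [a, b])) y) x =
    evalf (\<lambda>a. evalf (\<lambda>b. matrix_coeff q (u @ [b, a]) +
      evalf (\<lambda>c. matrix_coeff q (u @ [c])) (gen_bracket a b)) y) x"
    by (rule evalf_cong, rule evalf_cong, rule matrix_coeff_swap)
  also have "\<dots> - evalf (\<lambda>b. evalf (\<lambda>a. matrix_coeff q (u @ [b, a])) x) y
    - evalf (\<lambda>a. evalf (\<lambda>b. evalf (\<lambda>c. matrix_coeff q (u @ [c])) (gen_bracket a b)) y) x = 0"
    by (simp add: evalf_fun_add evalf_swap[of _ x y])
  finally show ?thesis .
qed

text \<open>
  The elements \<open>p\<close> for which \<open>F\<close> vanishes on all \<open>upq\<close> form a two-sided ideal that contains the defining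
  relations of the enveloping algebra.
\<close>

lemma matrix_coeff_env_ideal:
  assumes "p \<in> env_ideal" shows "matrix_coeff (p * q) u = 0"
proof -
  let ?Z = "{p. \<forall>q u. matrix_coeff (p * q) u = 0}"
  have "ideal ?Z tensor_ring"
  proof (rule idealI[OF tensor_ring subgroup_tensor_ring])
    fix a x assume "a \<in> ?Z"
    then show "x \<otimes>\<^bsub>tensor_ring\<^esub> a \<in> ?Z" "a \<otimes>\<^bsub>tensor_ring\<^esub> x \<in> ?Z"
      by (auto simp: mult.assoc) (simp add: matrix_coeff_mult[of x] evalf_def)
  qed (auto simp: algebra_simps)
  then have "env_ideal \<subseteq> ?Z"
    unfolding env_ideal_def by (rule ring.genideal_minimal[OF tensor_ring]) (auto simp: matrix_coeff_relation)
  then show ?thesis using assms by auto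
qed

lemma matrix_coeff_highest_weight:
  assumes "0 < gkey x"
  shows "matrix_coeff (q * (single (Word [x]) 1 - single 0 (hw_char \<eta> \<epsilon> \<theta> x))) u = 0"
  by (simp add: matrix_coeff_mult matrix_coeff_single verma_functional_snoc[OF assms] evalf_def flip: append_assoc)

abbreviation "coeff_functions \<equiv> range matrix_coeff"

lemma translation_closed_coeff_functions: "translation_closed coeff_functions"
  unfolding translation_closed_def
proof (intro conjI ballI allI)
  show "(\<lambda>_. 0) \<in> coeff_functions" by (rule range_eqI[of _ _ 0]) auto
  fix \<rho> assume "\<rho> \<in> coeff_functions"
  then obtain p where p: "\<rho> = matrix_coeff p" by auto
  show "(\<lambda>w. c * \<rho> w) \<in> coeff_functions" for c by (rule range_eqI[of _ _ "scale c p"]) (auto simp: p)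
  show "(\<lambda>w. \<rho> (w @ [g])) \<in> coeff_functions" for g
    by (rule range_eqI[of _ _ "word_embed (basis_vec g) * p"]) (auto simp: p matrix_coeff_embed_mult simp del: word_embed_single)
  fix \<sigma> assume "\<sigma> \<in> coeff_functions"
  then obtain q where q: "\<sigma> = matrix_coeff q" by auto
  show "(\<lambda>w. \<rho> w + \<sigma> w) \<in> coeff_functions" by (rule range_eqI[of _ _ "p + q"]) (auto simp: p q)
qed

lemma smooth_coeff_functions: "smooth coeff_functions"
proof -
  have "\<exists>K. \<forall>g. K \<le> index g \<longrightarrow> (\<forall>w. matrix_coeff p (w @ [g]) = 0)" for p
  proof (induction p rule: poly_mapping_add_induct)
    case (single v c)
    then show ?case using verma_functional_smooth[of \<eta> \<epsilon> \<theta> "letters v"] by (auto simp: matrix_coeff_single)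
  next
    case (add p q)
    then obtain K L where "\<And>g w. K \<le> index g \<Longrightarrow> matrix_coeff p (w @ [g]) = 0"
      "\<And>g w. L \<le> index g \<Longrightarrow> matrix_coeff q (w @ [g]) = 0" by blast
    then show ?case by (intro exI[of _ "max K L"]) auto
  qed
  then show ?thesis by (auto simp: smooth_def)
qed

lemma coeff_functions_nonzero: "\<exists>\<rho>\<in>coeff_functions. \<rho> [] \<noteq> 0"
  by (rule bexI[of _ "matrix_coeff 1"]) (auto simp: matrix_coeff_one)

end

section \<open>Separation of the highest weight vector\<close>

abbreviation monom_word :: "gen list \<Rightarrow> tensor_alg" where
  "monom_word w \<equiv> single (Word w) 1"

abbreviation tensor_const :: "complex \<Rightarrow> tensor_alg" where
  "tensor_const \<equiv> single 0"

text \<open>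
  The eigenvalue of the adjoint action of \<open>3d\<^sub>0 + h\<^sub>0\<close> on a generator. The factor 3 makes it negative on every
  negative generator, including \<open>f\<^sub>0\<close> and \<open>e\<^sub>i\<close> with \<open>i < 0\<close>, so that this one operator separates the
  highest weight vector from all vectors of lower weight.
\<close>

fun weight :: "gen \<Rightarrow> int" where
  "weight (Egen i) = 3 * i + 2" | "weight (Fgen i) = 3 * i - 2" | "weight (Hgen i) = 3 * i"
| "weight (Dgen i) = 3 * i" | "weight Cgen = 0"

lemma weight_neg: "gkey g \<le> 0 \<Longrightarrow> weight g < 0"
  by (cases g; (simp; presburger)?)

definition grading_elt :: tensor_alg where
  "grading_elt = tensor_const 3 * monom_word [Dgen 0] + monom_word [Hgen 0]"

abbreviation word_relation :: "gen \<Rightarrow> gen \<Rightarrow> tensor_alg" where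
  "word_relation a b \<equiv> monom_word [a] * monom_word [b] - monom_word [b] * monom_word [a]
     - word_embed (gen_bracket a b)"

lemma bracket_basis [simp]: "bracket (basis_vec a) (basis_vec b) = gen_bracket a b"
proof -
  have [simp]: "scale 1 x = x" for x :: "'a \<Rightarrow>\<^sub>0 complex" by (rule poly_mapping_eqI) simp
  show ?thesis by (simp add: bracket_def)
qed

lemma word_relation_mem: "word_relation a b \<in> env_ideal"
  using env_relation_mem[of "basis_vec a" "basis_vec b"] by simp

lemma grading_commutator:
  "grading_elt * monom_word [g] - monom_word [g] * grading_elt - tensor_const (of_int (weight g)) * monom_word [g] =
   tensor_const 3 * word_relation (Dgen 0) g + word_relation (Hgen 0) g"
proof -
  have "tensor_const 3 * word_embed (gen_bracket (Dgen 0) g) + word_embed (gen_bracket (Hgen 0) g) =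
    tensor_const (of_int (weight g)) * monom_word [g]"
    by (cases g) (auto simp: mult_single simp del: single_numeral simp flip: single_add single_diff)
  then show ?thesis
    unfolding grading_elt_def
    using single_zero_central[of "monom_word [g]" 3]
    by (simp add: algebra_simps del: single_numeral) (simp flip: mult.assoc del: single_numeral)
qed

lemma monom_word_Cons: "single (Word (g # w)) c = monom_word [g] * single (Word w) c"
  by (simp add: mult_single)

definition tensor_left_ideal :: "tensor_alg set \<Rightarrow> bool" where
  "tensor_left_ideal I \<longleftrightarrow> 0 \<in> I \<and> (\<forall>p\<in>I. \<forall>q\<in>I. p + q \<in> I) \<and> (\<forall>q. \<forall>p\<in>I. q * p \<in> I)"

lemma tensor_left_ideal_diff:
  assumes "tensor_left_ideal I" "p \<in> I" "q \<in> I" shows "p - q \<in> I"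
proof -
  have "(- 1) * q \<in> I" using assms by (simp only: tensor_left_ideal_def)
  then have "p + (- 1) * q \<in> I" using assms by (simp only: tensor_left_ideal_def)
  then show ?thesis by simp
qed

text \<open>
  A left ideal of the tensor algebra between the one that defines the Verma module and the common
  kernel of the functions \<open>w \<mapsto> F(wp)\<close>.
\<close>

locale highest_weight_ideal =
  fixes \<eta> \<epsilon> \<theta> :: complex and I :: "tensor_alg set"
  assumes left_ideal: "tensor_left_ideal I"
    and relations: "r \<in> env_ideal \<Longrightarrow> r * q \<in> I"
    and highest_weight: "0 < gkey x \<Longrightarrow> monom_word [x] - tensor_const (hw_char \<eta> \<epsilon> \<theta> x) \<in> I"
    and matrix_coeff_I: "p \<in> I \<Longrightarrow> matrix_coeff \<eta> \<epsilon> \<theta> p u = 0"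
begin

abbreviation "mcoeff \<equiv> matrix_coeff \<eta> \<epsilon> \<theta>"

lemma I_zero: "0 \<in> I" and I_add: "p \<in> I \<Longrightarrow> q \<in> I \<Longrightarrow> p + q \<in> I" and I_mult: "p \<in> I \<Longrightarrow> q * p \<in> I"
  using left_ideal by (auto simp: tensor_left_ideal_def)

text \<open>
  This span turns out to be the whole tensor algebra; its inductive form provides the induction over
  combinations of negative words modulo \<open>I\<close>.
\<close>

inductive_set neg_span :: "tensor_alg set" where
  ideal: "p \<in> I \<Longrightarrow> p \<in> neg_span"
| neg: "(\<And>g. g \<in> set w \<Longrightarrow> gkey g \<le> 0) \<Longrightarrow> single (Word w) c \<in> neg_span"
| add: "p \<in> neg_span \<Longrightarrow> q \<in> neg_span \<Longrightarrow> p + q \<in> neg_span"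

lemma neg_span_scale: "p \<in> neg_span \<Longrightarrow> tensor_const c * p \<in> neg_span"
  by (induction rule: neg_span.induct)
    (auto simp: mult_single distrib_left intro: neg_span.intros I_mult)

lemma neg_span_mult_neg: "p \<in> neg_span \<Longrightarrow> gkey g \<le> 0 \<Longrightarrow> monom_word [g] * p \<in> neg_span"
proof (induction rule: neg_span.induct)
  case (neg w c)
  then show ?case
    unfolding monom_word_Cons[symmetric] by (intro neg_span.neg) auto
qed (auto simp: distrib_left intro: neg_span.intros I_mult)

lemma neg_span_embed_mult:
  assumes "\<And>g. monom_word [g] * p \<in> neg_span"
  shows "word_embed x * p \<in> neg_span"
proof (induction x rule: poly_mapping_add_induct)
  case (single g c)
  have "word_embed (single g c) * p = tensor_const c * (monom_word [g] * p)"
    by (simp add: mult_single flip: mult.assoc)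
  then show ?case using neg_span_scale[OF assms] by simp
qed (simp add: distrib_right neg_span.add)

text \<open>
  A nonnegative generator is commuted to the right through a negative word. The bracket terms have a
  shorter negative word behind them, and a nonnegative generator at the end is a scalar modulo \<open>I\<close>.
\<close>

lemma neg_span_mult_word:
  assumes "\<And>g. g \<in> set w \<Longrightarrow> gkey g \<le> 0"
  shows "monom_word [g] * single (Word w) c \<in> neg_span"
  using assms
proof (induction w arbitrary: g)
  case Nil
  show ?case
  proof (cases "gkey g \<le> 0")
    case True
    then show ?thesis unfolding monom_word_Cons[symmetric] by (intro neg_span.neg) auto
  next
    case False
    have "monom_word [g] * single (Word []) c =
      tensor_const c * (monom_word [g] - tensor_const (hw_char \<eta> \<epsilon> \<theta> g)) + single (Word []) (c * hw_char \<eta> \<epsilon> \<theta> g)"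
      by (simp add: mult_single right_diff_distrib flip: zero_word_def)
    moreover have "tensor_const c * (monom_word [g] - tensor_const (hw_char \<eta> \<epsilon> \<theta> g)) \<in> I"
      using False by (intro I_mult highest_weight) simp
    ultimately show ?thesis by (simp only:) (rule neg_span.add[OF neg_span.ideal neg_span.neg]; simp)
  qed
next
  case (Cons h w)
  show ?case
  proof (cases "gkey g \<le> 0")
    case True
    then show ?thesis
      unfolding monom_word_Cons[of g "h # w", symmetric] using Cons.prems by (intro neg_span.neg) auto
  next
    case False
    let ?p = "single (Word w) c"
    have "monom_word [g] * single (Word (h # w)) c =
      word_relation g h * ?p + monom_word [h] * (monom_word [g] * ?p) + word_embed (gen_bracket g h) * ?p"
      unfolding monom_word_Cons[of h w] by (simp add: algebra_simps)
    moreover have "monom_word [h] * (monom_word [g] * ?p) \<in> neg_span"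
      using Cons by (auto intro: neg_span_mult_neg)
    moreover have "word_embed (gen_bracket g h) * ?p \<in> neg_span"
      using Cons by (intro neg_span_embed_mult) auto
    ultimately show ?thesis
      by (simp only:) (rule neg_span.add[OF neg_span.add[OF neg_span.ideal[OF relations[OF word_relation_mem]]]])
  qed
qed

lemma neg_span_UNIV: "p \<in> neg_span"
proof (induction p rule: poly_mapping_add_induct)
  case (single v c)
  obtain w where v: "v = Word w" by (cases v)
  have mult: "monom_word [g] * p \<in> neg_span" if "p \<in> neg_span" for p g
    using that by (induction rule: neg_span.induct)
      (auto simp: distrib_left intro: neg_span.intros I_mult neg_span_mult_word)
  show ?case unfolding v
  proof (induction w)
    case Nil
    show ?case by (rule neg_span.neg) simp
  next
    case (Cons g w)
    then show ?case unfolding monom_word_Cons[of g w] by (rule mult)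
  qed
qed (rule neg_span.add)

definition top_weight :: complex where "top_weight = 3 * \<eta> + \<epsilon>"

lemma grading_elt_word:
  "grading_elt * monom_word w - tensor_const (top_weight + of_int (sum_list (map weight w))) * monom_word w \<in> I"
proof (induction w)
  case Nil
  have "grading_elt * monom_word [] - tensor_const top_weight * monom_word [] =
    tensor_const 3 * (monom_word [Dgen 0] - tensor_const (hw_char \<eta> \<epsilon> \<theta> (Dgen 0)))
    + (monom_word [Hgen 0] - tensor_const (hw_char \<eta> \<epsilon> \<theta> (Hgen 0)))"
    by (simp add: grading_elt_def top_weight_def right_diff_distrib mult_single single_add
        del: single_numeral flip: zero_word_def)
  moreover have "\<dots> \<in> I"
    by (intro I_add I_mult highest_weight) simp_all
  ultimately have "grading_elt * monom_word [] - tensor_const top_weight * monom_word [] \<in> I" by (simp only:)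
  then show ?case by (simp only: list.map sum_list.Nil of_int_0 add_0_right)
next
  case (Cons g w)
  let ?c = "tensor_const (top_weight + of_int (sum_list (map weight w)))" and ?d = "tensor_const (of_int (weight g))"
  let ?g = "monom_word [g]" and ?w = "monom_word w"
  have "grading_elt * (?g * ?w) - (?c + ?d) * (?g * ?w) =
    (grading_elt * ?g - ?g * grading_elt - ?d * ?g) * ?w + ?g * (grading_elt * ?w - ?c * ?w)"
    using single_zero_central[of ?g "top_weight + of_int (sum_list (map weight w))"]
    by (simp add: algebra_simps) (simp flip: mult.assoc)
  also have "\<dots> \<in> I"
    unfolding grading_commutator
    unfolding distrib_right mult.assoc[of "tensor_const 3"]
    by (intro I_add I_mult Cons.IH relations word_relation_mem)
  finally show ?case
    unfolding monom_word_Cons[of g w] by (simp add: ac_simps del: single_of_int flip: single_add)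
qed

text \<open>
  The product of \<open>A - (a - j)\<close> over \<open>j = 1, ..., m\<close>, where \<open>A = 3d\<^sub>0 + h\<^sub>0\<close> and \<open>a\<close> is its eigenvalue on the
  highest weight vector. It kills the eigenvectors with eigenvalues \<open>a - 1, ..., a - m\<close> and multiplies the
  highest weight vector by \<open>m!\<close>.
\<close>

primrec annihilator :: "nat \<Rightarrow> tensor_alg" where
  "annihilator 0 = 1"
| "annihilator (Suc m) = (grading_elt - tensor_const (top_weight - of_nat (Suc m))) * annihilator m"

lemma annihilator_word:
  "annihilator m * monom_word w -
    tensor_const (\<Prod>j=1..m. of_int (sum_list (map weight w)) + of_nat j) * monom_word w \<in> I"
proof (induction m)
  case (Suc m)
  let ?B = "grading_elt - tensor_const (top_weight - of_nat (Suc m))" and ?w = "monom_word w"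
  define e where "e = (\<Prod>j=1..m. of_int (sum_list (map weight w)) + of_nat j :: complex)"
  define s where "s = (of_int (sum_list (map weight w)) + of_nat (Suc m) :: complex)"
  have "?B * ?w - tensor_const s * ?w = grading_elt * ?w - tensor_const (top_weight + of_int (sum_list (map weight w))) * ?w"
    by (simp add: s_def algebra_simps single_add single_diff)
  then have "?B * ?w - tensor_const s * ?w \<in> I" using grading_elt_word by simp
  moreover have "?B * (annihilator m * ?w) - tensor_const (e * s) * ?w =
    ?B * (annihilator m * ?w - tensor_const e * ?w) + tensor_const e * (?B * ?w - tensor_const s * ?w)"
    using single_zero_central[of ?B e] mult_single[of "0::word" e 0 s]
    by (simp add: right_diff_distrib flip: mult.assoc)
  ultimately have "?B * (annihilator m * ?w) - tensor_const (e * s) * ?w \<in> I"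
    using Suc.IH by (auto simp: e_def intro!: I_add I_mult)
  then show ?case by (simp add: e_def s_def mult.assoc)
qed (simp add: I_zero)

text \<open>
  Negative words span everything modulo \<open>I\<close>; the nonempty ones are killed for large \<open>m\<close>, and \<open>F\<close>
  vanishes on them.
\<close>

lemma annihilator_eventually:
  "\<exists>M. \<forall>m\<ge>M. annihilator m * p - tensor_const (fact m * mcoeff p []) \<in> I"
proof -
  have "p \<in> neg_span" by (rule neg_span_UNIV)
  then show ?thesis
  proof (induction rule: neg_span.induct)
    case (ideal p)
    then show ?case by (auto simp: matrix_coeff_I intro!: I_mult)
  next
    case (neg w c)
    show ?case
    proof (cases "w = []")
      case True
      have "annihilator m * single (Word w) c -
        tensor_const (fact m * mcoeff (single (Word w) c) []) =
        tensor_const c * (annihilator m * monom_word w -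
    tensor_const (\<Prod>j=1..m. of_int (sum_list (map weight w)) + of_nat j) * monom_word w)" for m
        using True single_zero_central[of "annihilator m" c]
        by (simp add: matrix_coeff_single fact_prod mult_single right_diff_distrib mult.commute flip: zero_word_def)
      then show ?thesis using annihilator_word[THEN I_mult] by auto
    next
      case False
      have neg_weight: "sum_list (map weight w) < 0"
        using False neg.hyps
      proof (induction w)
        case (Cons g w)
        then show ?case using weight_neg[of g] by (cases "w = []") (auto simp: add_neg_neg)
      qed simp
      have zero: "mcoeff (single (Word w) c) [] = 0"
        using verma_functional_neg[OF False, of \<eta> \<epsilon> \<theta>] neg.hyps by (simp add: matrix_coeff_single)
      have "annihilator m * single (Word w) c \<in> I" if "m \<ge> nat (- sum_list (map weight w))" for m
      proof -
        \<comment> \<open>The factor of the product with index minus the weight of the word is zero.\<close>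
        have "nat (- sum_list (map weight w)) \<in> {1..m}" using that neg_weight by auto
        then have "(\<Prod>j=1..m. of_int (sum_list (map weight w)) + of_nat j :: complex) = 0"
          using neg_weight by (intro prod_zero bexI[of _ "nat (- sum_list (map weight w))"]) (auto simp: of_nat_nat)
        then have "annihilator m * monom_word w \<in> I" using annihilator_word[of m w] by (simp only: single_zero) simp
        then have "tensor_const c * (annihilator m * monom_word w) \<in> I" by (rule I_mult)
        then show ?thesis
          by (simp add: mult_single flip: mult.assoc single_zero_central) (simp add: mult.assoc mult_single)
      qed
      then show ?thesis unfolding zero by auto
    qed
  next
    case (add p q)
    then obtain K L where KL: "\<And>m. m \<ge> K \<Longrightarrow> annihilator m * p - tensor_const (fact m * mcoeff p []) \<in> I"
      "\<And>m. m \<ge> L \<Longrightarrow> annihilator m * q - tensor_const (fact m * mcoeff q []) \<in> I" by blast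
    show ?case
    proof (intro exI[of _ "max K L"] allI impI)
      fix m assume "max K L \<le> m"
      then have "(annihilator m * p - tensor_const (fact m * mcoeff p [])) +
        (annihilator m * q - tensor_const (fact m * mcoeff q [])) \<in> I"
        using KL by (intro I_add) auto
      then show "annihilator m * (p + q) - tensor_const (fact m * mcoeff (p + q) []) \<in> I"
        by (simp add: distrib_left single_add algebra_simps)
    qed
  qed
qed

text \<open>
  After multiplying \<open>p\<close> by a word \<open>u\<close> with \<open>F(up) \<noteq> 0\<close>, the annihilators isolate a nonzero multiple of \<open>1\<close>.
\<close>

lemma highest_weight_vector_generated:
  assumes "tensor_left_ideal N" "I \<subseteq> N" "p \<in> N" "mcoeff p u \<noteq> 0"
  shows "1 \<in> N"
proof -
  define q where "q = monom_word u * p"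
  have q: "q \<in> N" "mcoeff q [] \<noteq> 0"
    using assms by (auto simp: q_def tensor_left_ideal_def matrix_coeff_mult)
  obtain m where m: "annihilator m * q - tensor_const (fact m * mcoeff q []) \<in> I"
    using annihilator_eventually by blast
  define c where "c = fact m * mcoeff q []"
  have "annihilator m * q - (annihilator m * q - tensor_const c) \<in> N"
    by (rule tensor_left_ideal_diff) (use assms q m in \<open>auto simp: tensor_left_ideal_def c_def\<close>)
  then have "tensor_const c \<in> N" by simp
  moreover have "c \<noteq> 0" using q(2) by (simp add: c_def)
  moreover from calculation have "tensor_const (inverse c) * tensor_const c \<in> N"
    using assms(1) by (simp only: tensor_left_ideal_def)
  ultimately show ?thesis by (simp add: mult_single)
qed

end

section \<open>Verma modules and their irreducible quotients\<close>

lemma ring_env: "ring env"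
  unfolding env_def by (rule ideal.quotient_is_ring[OF ideal_env_ideal])

lemma env_minus: "\<ominus>\<^bsub>env\<^esub> env_proj p = env_proj (- p)"
proof -
  interpret ring env by (rule ring_env)
  show ?thesis by (rule minus_equality) (auto simp: carrier_env)
qed

lemma left_ideal_env_proj:
  assumes "tensor_left_ideal P" shows "left_ideal (env_proj ` P) env"
proof -
  interpret ring env by (rule ring_env)
  have P: "0 \<in> P" "\<And>p q. p \<in> P \<Longrightarrow> q \<in> P \<Longrightarrow> p + q \<in> P" "\<And>p q. p \<in> P \<Longrightarrow> q * p \<in> P"
    using assms by (auto simp: tensor_left_ideal_def)
  have neg: "- p \<in> P" if "p \<in> P" for p using P(3)[OF that, of "- 1"] by simp
  have "subgroup (env_proj ` P) (add_monoid env)"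
  proof (rule group.subgroupI[OF a_group])
    fix a assume "a \<in> env_proj ` P"
    then show "inv\<^bsub>add_monoid env\<^esub> a \<in> env_proj ` P"
      unfolding a_inv_def[symmetric] using neg by (auto simp: env_minus)
  next
    show "env_proj ` P \<noteq> {}" using P(1) by auto
  qed (use P in \<open>auto simp: carrier_env\<close>)
  then show ?thesis
    using P(3) by (auto simp: left_ideal_def additive_subgroup_def carrier_env)
qed

lemma left_ideal_Inter:
  assumes "ring R" "\<And>I. I \<in> A \<Longrightarrow> left_ideal I R" "A \<noteq> {}" shows "left_ideal (\<Inter>A) R"
proof -
  interpret ring R by fact
  have "subgroup (\<Inter>A) (add_monoid R)"
    by (rule group.subgroups_Inter[OF a_group]) (use assms in \<open>auto simp: left_ideal_def additive_subgroup_def\<close>)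
  then show ?thesis using assms(2) by (auto simp: left_ideal_def additive_subgroup_def)
qed

context
  fixes \<eta> \<epsilon> \<theta> :: complex
begin

abbreviation "hw_generator x \<equiv> monom_word [x] - tensor_const (hw_char \<eta> \<epsilon> \<theta> x)"
abbreviation "mcoeff \<equiv> matrix_coeff \<eta> \<epsilon> \<theta>"
abbreviation "VI \<equiv> verma_ideal \<eta> \<epsilon> \<theta>"
abbreviation "Verma \<equiv> verma \<eta> \<epsilon> \<theta>"

text \<open>
  The generators of the defining left ideal, uniformly as \<open>x - \<chi>(x)\<close> over the generators \<open>x\<close> with positive
  key.
\<close>

lemma verma_gens_eq:
  "verma_gens \<eta> \<epsilon> \<theta> = (\<lambda>x. env_proj (hw_generator x)) ` {x. 0 < gkey x}"
proof
  show "verma_gens \<eta> \<epsilon> \<theta> \<subseteq> (\<lambda>x. env_proj (hw_generator x)) ` {x. 0 < gkey x}"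
    (is "_ \<subseteq> ?R")
  proof -
    have R: "0 < gkey x \<Longrightarrow> env_proj (hw_generator x) \<in> ?R" for x
      by auto
    have "env_proj (monom_word [Egen 0]) \<in> ?R" "env_proj (monom_word [Dgen 0] - tensor_const \<eta>) \<in> ?R"
      "env_proj (monom_word [Hgen 0] - tensor_const \<epsilon>) \<in> ?R" "env_proj (monom_word [Cgen] - tensor_const \<theta>) \<in> ?R"
      using R[of "Egen 0"] R[of "Dgen 0"] R[of "Hgen 0"] R[of Cgen] by simp_all
    moreover have "env_proj (monom_word [g i]) \<in> ?R" if "g \<in> {Egen, Fgen, Hgen, Dgen}" "0 < i" for g i
    proof -
      have "0 < gkey (g i)" "hw_char \<eta> \<epsilon> \<theta> (g i) = 0" using that by auto
      then show ?thesis using R[of "g i"] by (simp del: image_iff)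
    qed
    ultimately show ?thesis unfolding verma_gens_def scale_conv_mult by auto
  qed
next
  have "env_proj (hw_generator x) \<in> verma_gens \<eta> \<epsilon> \<theta>" if "0 < gkey x" for x
  proof (cases x)
    case (Egen i)
    then show ?thesis using that by (cases "i = 0") (force simp: verma_gens_def)+
  next
    case (Fgen i)
    then show ?thesis using that by (force simp: verma_gens_def)
  next
    case (Hgen i)
    then show ?thesis using that by (cases "i = 0") (force simp: verma_gens_def scale_conv_mult)+
  next
    case (Dgen i)
    then show ?thesis using that by (cases "i = 0") (force simp: verma_gens_def scale_conv_mult)+
  next
    case Cgen
    then show ?thesis by (simp add: verma_gens_def scale_conv_mult)
  qed
  then show "(\<lambda>x. env_proj (hw_generator x)) ` {x. 0 < gkey x} \<subseteq> verma_gens \<eta> \<epsilon> \<theta>"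
    by auto
qed

lemma left_ideal_verma_ideal: "left_ideal VI env"
proof -
  have "left_ideal (env_proj ` UNIV) env" by (rule left_ideal_env_proj) (simp add: tensor_left_ideal_def)
  then show ?thesis
    unfolding verma_ideal_def
    by (intro left_ideal_Inter ring_env) (auto simp: verma_gens_eq)
qed

lemma verma_gens_subset: "verma_gens \<eta> \<epsilon> \<theta> \<subseteq> VI"
  by (auto simp: verma_ideal_def)

lemma submodule_verma_ideal: "lie_submodule VI env_module"
proof -
  have "subgroup VI (add_monoid env)"
    using left_ideal_verma_ideal by (simp add: left_ideal_def additive_subgroup_def)
  then have "subgroup VI (add_monoid env_module)"
    by (simp add: subgroup_def m_inv_def env_module_def)
  then show ?thesis
    using left_ideal_verma_ideal
    by (auto simp: lie_submodule_def submodule_complex_iff left_ideal_def env_module_def carrier_env)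
qed

text \<open>
  The common kernel of all \<open>F(u \<cdot>)\<close> is a left ideal that contains the generators of the defining ideal.
\<close>

lemma matrix_coeff_verma_ideal:
  assumes "env_proj p \<in> VI" shows "mcoeff p u = 0"
proof -
  let ?S = "{p. \<forall>u. mcoeff p u = 0}"
  have "tensor_left_ideal ?S"
    by (auto simp: tensor_left_ideal_def matrix_coeff_mult evalf_def)
  moreover have "verma_gens \<eta> \<epsilon> \<theta> \<subseteq> env_proj ` ?S"
    using matrix_coeff_highest_weight[of _ \<eta> \<epsilon> \<theta> 1] by (auto simp: verma_gens_eq)
  ultimately have "VI \<subseteq> env_proj ` ?S"
    unfolding verma_ideal_def using left_ideal_env_proj by blast
  then obtain q where q: "q \<in> ?S" "env_proj p = env_proj q" using assms by auto
  then have "mcoeff ((p - q) * 1) u = 0"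
    unfolding env_proj_eq_iff by (intro matrix_coeff_env_ideal)
  then show ?thesis using q(1) by simp
qed

lemma highest_weight_ideal_verma: "highest_weight_ideal \<eta> \<epsilon> \<theta> {p. env_proj p \<in> VI}"
proof
  have L: "env_proj 0 \<in> VI"
    "\<And>a b. a \<in> VI \<Longrightarrow> b \<in> VI \<Longrightarrow> a \<oplus>\<^bsub>env\<^esub> b \<in> VI"
    "\<And>r a. r \<in> carrier env \<Longrightarrow> a \<in> VI \<Longrightarrow> r \<otimes>\<^bsub>env\<^esub> a \<in> VI"
    using left_ideal_verma_ideal additive_subgroup.zero_closed[of "VI" env]
      additive_subgroup.a_closed[of "VI" env]
    by (auto simp: left_ideal_def)
  show "tensor_left_ideal {p. env_proj p \<in> VI}"
    using L(1) L(2)[of "env_proj p" "env_proj q" for p q] L(3)[of "env_proj q" "env_proj p" for p q]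
    by (auto simp: tensor_left_ideal_def carrier_env)
  show "r * q \<in> {p. env_proj p \<in> VI}" if "r \<in> env_ideal" for r q
  proof -
    have "r * q \<in> env_ideal" using ideal.I_r_closed[OF ideal_env_ideal that, of q] by simp
    then have "env_proj (r * q) = env_proj 0" by (simp add: env_proj_eq_iff)
    then show ?thesis using L(1) by simp
  qed
  show "hw_generator x \<in> {p. env_proj p \<in> VI}" if "0 < gkey x" for x
    using verma_gens_subset that by (auto simp: verma_gens_eq)
qed (simp add: matrix_coeff_verma_ideal)

interpretation E: linear_module env_module by (rule linear_module_env_module)

definition verma_proj :: "tensor_alg \<Rightarrow> tensor_alg set set" where
  "verma_proj p = VI +>\<^bsub>env_module\<^esub> env_proj p"

lemma verma_simps:
  "carrier Verma = range verma_proj"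
  "\<zero>\<^bsub>Verma\<^esub> = verma_proj 0"
  "verma_proj p \<oplus>\<^bsub>Verma\<^esub> verma_proj q = verma_proj (p + q)"
  "c \<odot>\<^bsub>Verma\<^esub> verma_proj p = verma_proj (scale c p)"
  "act Verma x (verma_proj p) = verma_proj (word_embed x * p)"
  using E.carrier_lie_quot[OF submodule_verma_ideal] E.zero_lie_quot[OF submodule_verma_ideal]
    E.add_lie_quot[OF submodule_verma_ideal, of "env_proj p" "env_proj q"]
    E.smult_lie_quot[OF submodule_verma_ideal, of "env_proj p" c]
    E.act_lie_quot[OF submodule_verma_ideal, of "env_proj p" x]
  by (auto simp: verma_def verma_proj_def image_image)

lemma linear_module_verma: "linear_module Verma"
  unfolding verma_def by (rule E.linear_module_lie_quot[OF submodule_verma_ideal])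

lemma verma_proj_zero: "env_proj p \<in> VI \<Longrightarrow> verma_proj p = verma_proj 0"
  unfolding verma_proj_def
  by (metis E.a_coset_join2 E.submodule_subgroup E.zero_closed additive_subgroup.zero_closed
      additive_subgroup_def env_module_simps(1,3) rangeI submodule_verma_ideal)

abbreviation "hw_functions \<equiv> function_module (coeff_functions \<eta> \<epsilon> \<theta>)"

lemma linear_module_hw_functions: "linear_module hw_functions"
  by (rule linear_module_function_module[OF translation_closed_coeff_functions])

definition env_coeff :: "tensor_alg set \<Rightarrow> gen list \<Rightarrow> complex" where
  "env_coeff A = mcoeff (SOME p. env_proj p = A)"

lemma env_coeff_proj: "env_coeff (env_proj p) = mcoeff p"
proof
  fix u
  define q where "q = (SOME q. env_proj q = env_proj p)"
  have "env_proj q = env_proj p" unfolding q_def by (rule someI) (rule refl)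
  then have "mcoeff ((q - p) * 1) u = 0"
    unfolding env_proj_eq_iff by (rule matrix_coeff_env_ideal)
  then show "env_coeff (env_proj p) u = mcoeff p u" by (simp add: env_coeff_def q_def)
qed

lemma env_coeff_hom: "env_coeff \<in> lie_hom env_module hw_functions"
  by (auto simp: lie_hom_def env_coeff_proj function_module_def matrix_coeff_embed_mult)

lemma env_coeff_kernel: "a \<in> VI \<Longrightarrow> env_coeff a = \<zero>\<^bsub>hw_functions\<^esub>"
proof -
  assume a: "a \<in> VI"
  then have "a \<in> carrier env"
    using left_ideal_verma_ideal by (auto simp: left_ideal_def dest: additive_subgroup.a_Hcarr)
  then obtain p where "a = env_proj p" by (auto simp: carrier_env)
  then show ?thesis using a by (auto simp: env_coeff_proj function_module_def matrix_coeff_verma_ideal)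
qed

definition verma_coeff :: "tensor_alg set set \<Rightarrow> gen list \<Rightarrow> complex" where
  "verma_coeff = induced_map env_coeff"

lemma verma_coeff_hom: "verma_coeff \<in> lie_hom Verma hw_functions"
  unfolding verma_coeff_def verma_def
  by (rule E.induced_map_hom[OF submodule_verma_ideal env_coeff_hom linear_module_hw_functions env_coeff_kernel])

lemma verma_coeff_proj: "verma_coeff (verma_proj p) = mcoeff p"
  unfolding verma_coeff_def verma_proj_def
  using E.induced_map_coset[OF submodule_verma_ideal env_coeff_hom linear_module_hw_functions env_coeff_kernel,
      of "env_proj p"] by (simp add: env_coeff_proj)

text \<open>
  The kernel of the map from the Verma module to functions on words. It is the radical of the
  pairing \<open>(u, p) \<mapsto> F(up)\<close>.
\<close>

definition radical :: "tensor_alg set set set" where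
  "radical = {v \<in> carrier Verma. verma_coeff v = \<zero>\<^bsub>hw_functions\<^esub>}"

lemma submodule_radical: "lie_submodule radical Verma"
  unfolding radical_def
  by (rule kernel_submodule[OF linear_module_verma linear_module_hw_functions verma_coeff_hom])

lemma proper_submodule_radical: "proper_submodule radical Verma"
proof -
  have "mcoeff 1 [] \<noteq> 0" by (simp add: matrix_coeff_one)
  then have "verma_proj 1 \<notin> radical"
    by (auto simp: radical_def verma_coeff_proj function_module_def)
  then show ?thesis
    using submodule_radical by (auto simp: proper_submodule_def verma_simps)
qed

text \<open>
  A submodule that contains a vector outside the radical contains the highest weight vector, and this
  vector generates the Verma module.
\<close>

lemma proper_submodule_subset_radical:
  assumes "proper_submodule N Verma" shows "N \<subseteq> radical"
proof (rule ccontr)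
  interpret hw: highest_weight_ideal \<eta> \<epsilon> \<theta> "{p. env_proj p \<in> VI}"
    by (rule highest_weight_ideal_verma)
  have sub: "subgroup N (add_monoid Verma)" and
    smult: "\<And>c v. v \<in> N \<Longrightarrow> c \<odot>\<^bsub>Verma\<^esub> v \<in> N" and
    act: "\<And>x v. v \<in> N \<Longrightarrow> act Verma x v \<in> N"
    using assms by (auto simp: proper_submodule_def lie_submodule_def submodule_complex_iff)
  have zero: "verma_proj 0 \<in> N" using subgroup.one_closed[OF sub] by (simp add: verma_simps)
  have add: "verma_proj (p + q) \<in> N" if "verma_proj p \<in> N" "verma_proj q \<in> N" for p q
    using subgroup.m_closed[OF sub that] by (simp add: verma_simps)
  have N: "N \<subseteq> range verma_proj" using subgroup.subset[OF sub] by (simp add: verma_simps)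
  assume "\<not> N \<subseteq> radical"
  then obtain p where p: "verma_proj p \<in> N" "verma_proj p \<notin> radical" using N by auto
  then obtain u where u: "mcoeff p u \<noteq> 0"
    by (auto simp: radical_def verma_simps verma_coeff_proj function_module_def)
  have mult: "verma_proj (q * p) \<in> N" if p: "verma_proj p \<in> N" for p q
  proof (induction q rule: poly_mapping_add_induct)
    case (single v c)
    obtain w where v: "v = Word w" by (cases v)
    have "verma_proj (monom_word w * p) \<in> N"
    proof (induction w)
      case Nil
      then show ?case using p by (simp flip: zero_word_def)
    next
      case (Cons g w)
      from act[OF Cons, of "basis_vec g"] show ?case
        unfolding monom_word_Cons[of g w] by (simp add: verma_simps mult.assoc)
    qed
    from smult[OF this, of c] show ?case
      unfolding v by (simp add: verma_simps scale_conv_mult mult_single flip: mult.assoc)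
  qed (simp add: distrib_right add)
  have "1 \<in> {p. verma_proj p \<in> N}"
  proof (rule hw.highest_weight_vector_generated[of _ p u])
    show "tensor_left_ideal {p. verma_proj p \<in> N}"
      using zero add mult by (auto simp: tensor_left_ideal_def)
    show "{p. env_proj p \<in> VI} \<subseteq> {p. verma_proj p \<in> N}"
      using verma_proj_zero zero by auto
  qed (use p u in auto)
  then have "verma_proj q \<in> N" for q using mult[of 1 q] by simp
  then have "N = carrier Verma" using N by (auto simp: verma_simps)
  then show False using assms by (simp add: proper_submodule_def)
qed

text \<open>
  The radical is proper since \<open>F(1) = 1\<close>, and it contains all proper submodules. This identifies the
  description \<open>THE J\<close> in the definition of the irreducible quotient.
\<close>

lemma maximal_submodule_iff: "maximal_submodule J Verma \<longleftrightarrow> J = radical"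
  using proper_submodule_radical proper_submodule_subset_radical
  unfolding maximal_submodule_def by blast

lemma irr_hw_eq: "irr_hw \<eta> \<epsilon> \<theta> = lie_quot Verma radical"
  unfolding irr_hw_def maximal_submodule_iff by simp

lemma linear_module_irr_hw: "linear_module (irr_hw \<eta> \<epsilon> \<theta>)"
  unfolding irr_hw_eq by (rule linear_module.linear_module_lie_quot[OF linear_module_verma submodule_radical])

theorem irr_hw_isomorphic: "irr_hw \<eta> \<epsilon> \<theta> \<cong>\<^sub>L hw_functions"
proof -
  have "induced_map verma_coeff \<in> lie_iso (irr_hw \<eta> \<epsilon> \<theta>) hw_functions"
    unfolding irr_hw_eq
  proof (rule linear_module.induced_map_iso[OF linear_module_verma submodule_radical verma_coeff_hom linear_module_hw_functions])
    show "verma_coeff ` carrier Verma = carrier hw_functions"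
      by (simp add: verma_simps image_image verma_coeff_proj function_module_def)
  qed (auto simp: radical_def)
  then show ?thesis by (auto simp: lie_isomorphic_def)
qed

end

section \<open>Functions on words with polynomial values\<close>

lemma const2_simps [simp]:
  "const2 0 = 0" "const2 1 = 1" "const2 (a + b) = const2 a + const2 b" "const2 (a * b) = const2 a * const2 b"
  "const2 (- a) = - const2 a" "const2 (a - b) = const2 a - const2 b"
  by (simp_all add: const2_def one_pCons)

lemma const2_eq_0_iff [simp]: "const2 c = 0 \<longleftrightarrow> c = 0"
  by (simp add: const2_def)

lemma const2_mult_smult: "const2 c * g = smult [:c:] g"
  by (simp add: const2_def)

lemma coeff_const2_mult [simp]: "coeff (const2 c * g) i = smult c (coeff g i)"
  by (simp add: const2_mult_smult)

text \<open>
  The shifts, and with them the generators, act linearly on polynomials.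
\<close>

lemma shift_add [simp]: "shift i c (g + h) = shift i c g + shift i c h"
proof -
  have "map_poly (\<lambda>p. pcompose p [:c, 1:]) (g + h) = map_poly (\<lambda>p. pcompose p [:c, 1:]) g + map_poly (\<lambda>p. pcompose p [:c, 1:]) h"
    by (rule poly_eqI) (simp add: coeff_map_poly pcompose_add)
  then show ?thesis by (simp add: shift_def pcompose_add)
qed

lemma shift_const2_mult [simp]: "shift i c (const2 d * g) = const2 d * shift i c g"
proof -
  have "map_poly (\<lambda>p. pcompose p [:c, 1:]) (smult [:d:] g) = smult [:d:] (map_poly (\<lambda>p. pcompose p [:c, 1:]) g)"
    by (rule poly_eqI) (simp add: coeff_map_poly pcompose_smult)
  then show ?thesis by (simp add: shift_def const2_mult_smult pcompose_smult)
qed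

lemma shift_zero [simp]: "shift i c 0 = 0"
  by (simp add: shift_def)

lemma gen_act_add: "gen_act lam \<alpha> \<beta> \<gamma> M a (g + h) = gen_act lam \<alpha> \<beta> \<gamma> M a g + gen_act lam \<alpha> \<beta> \<gamma> M a h"
  by (cases M; cases a) (simp_all add: algebra_simps)

lemma gen_act_const2_mult:
  "gen_act lam \<alpha> \<beta> \<gamma> M a (const2 c * g) = const2 c * gen_act lam \<alpha> \<beta> \<gamma> M a g"
  by (cases M; cases a; (simp only: gen_act.simps shift_const2_mult mult_zero_right)?; (simp only: ac_simps)?)

definition eval_poly2 :: "('a \<Rightarrow> poly2) \<Rightarrow> ('a \<Rightarrow>\<^sub>0 complex) \<Rightarrow> poly2" where
  "eval_poly2 f x = (\<Sum>a\<in>keys x. const2 (lookup x a) * f a)"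

lemma eval_poly2_add [simp]: "eval_poly2 f (x + y) = eval_poly2 f x + eval_poly2 f y"
  unfolding eval_poly2_def by (rule sum_keys_add) (auto simp: algebra_simps)

lemma eval_poly2_single [simp]: "eval_poly2 f (single a c) = const2 c * f a"
  unfolding eval_poly2_def by (cases "c = 0") auto

lemma eval_poly2_zero [simp]: "eval_poly2 f 0 = 0"
  by (simp add: eval_poly2_def)

lemma eval_poly2_scale [simp]: "eval_poly2 f (scale c x) = const2 c * eval_poly2 f x"
  using sum_keys_superset[OF _ keys_scale_subset[of c x], of "\<lambda>a d. const2 d * f a"]
  unfolding eval_poly2_def by (simp add: sum_distrib_left mult.assoc)

lemma eval_poly2_diff [simp]: "eval_poly2 f (x - y) = eval_poly2 f x - eval_poly2 f y"
  using eval_poly2_add[of f "x - y" y] by simp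

lemma eval_poly2_fun_add: "eval_poly2 (\<lambda>a. f a + g a) x = eval_poly2 f x + eval_poly2 g x"
  unfolding eval_poly2_def by (simp add: algebra_simps sum.distrib)

lemma eval_poly2_fun_mult: "eval_poly2 (\<lambda>a. h * f a) x = h * eval_poly2 f x"
  unfolding eval_poly2_def by (simp add: algebra_simps sum_distrib_left)

lemma const2_evalf_mult: "const2 (evalf f x) * g = eval_poly2 (\<lambda>a. const2 (f a) * g) x"
proof (induction x rule: poly_mapping_add_induct)
qed (simp_all add: algebra_simps)

lemma poly_module_simps [simp]:
  "carrier (poly_module M lam \<alpha> \<beta> \<gamma>) = UNIV"
  "g \<oplus>\<^bsub>poly_module M lam \<alpha> \<beta> \<gamma>\<^esub> h = g + h"
  "\<zero>\<^bsub>poly_module M lam \<alpha> \<beta> \<gamma>\<^esub> = 0"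
  "c \<odot>\<^bsub>poly_module M lam \<alpha> \<beta> \<gamma>\<^esub> g = const2 c * g"
  "act (poly_module M lam \<alpha> \<beta> \<gamma>) x g = eval_poly2 (\<lambda>a. gen_act lam \<alpha> \<beta> \<gamma> M a g) x"
  by (simp_all add: poly_module_def eval_poly2_def)

text \<open>
  The functions from words to polynomials of the form \<open>w \<mapsto> \<Sum> \<rho>\<^sub>i(w) u\<^sub>i\<close> with \<open>\<rho>\<^sub>i\<close> in \<open>R\<close>. They stand for the tensors
  \<open>\<Sum> u\<^sub>i \<otimes> \<rho>\<^sub>i\<close>.
\<close>

inductive_set poly_span :: "(gen list \<Rightarrow> complex) set \<Rightarrow> (gen list \<Rightarrow> poly2) set"
  for R :: "(gen list \<Rightarrow> complex) set" where
  zero: "(\<lambda>_. 0) \<in> poly_span R"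
| add_pure: "G \<in> poly_span R \<Longrightarrow> \<rho> \<in> R \<Longrightarrow> (\<lambda>w. G w + const2 (\<rho> w) * u) \<in> poly_span R"

text \<open>
  The action is \<open>x(u \<otimes> \<rho>) = xu \<otimes> \<rho> + u \<otimes> x\<rho>\<close>: a generator acts on the polynomial values and by translation
  of the argument.
\<close>

definition tensor_model :: "family \<Rightarrow> complex \<Rightarrow> complex \<Rightarrow> complex \<Rightarrow> complex \<Rightarrow>
    (gen list \<Rightarrow> complex) set \<Rightarrow> (gen list \<Rightarrow> poly2) lie_module" where
  "tensor_model M lam \<alpha> \<beta> \<gamma> R = \<lparr>carrier = poly_span R, monoid.mult = undefined, one = undefined,
     ring.zero = (\<lambda>_. 0), add = (\<lambda>G H w. G w + H w), module.smult = (\<lambda>c G w. const2 c * G w),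
     act = (\<lambda>x G w. eval_poly2 (\<lambda>a. gen_act lam \<alpha> \<beta> \<gamma> M a (G w) + G (w @ [a])) x)\<rparr>"

lemma poly_span_pure: "\<rho> \<in> R \<Longrightarrow> (\<lambda>w. const2 (\<rho> w) * u) \<in> poly_span R"
  using poly_span.add_pure[OF poly_span.zero] by simp

lemma poly_span_add: "H \<in> poly_span R \<Longrightarrow> G \<in> poly_span R \<Longrightarrow> (\<lambda>w. G w + H w) \<in> poly_span R"
proof (induction rule: poly_span.induct)
  case (add_pure H \<rho> u)
  then show ?case using poly_span.add_pure[of "\<lambda>w. G w + H w" R \<rho> u] by (simp add: add.assoc)
qed simp

lemma poly_span_eval:
  "(\<And>a. a \<in> keys x \<Longrightarrow> (\<lambda>w. f w a) \<in> poly_span R) \<Longrightarrow>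
   (\<And>G c. G \<in> poly_span R \<Longrightarrow> (\<lambda>w. const2 c * G w) \<in> poly_span R) \<Longrightarrow>
   (\<lambda>w. eval_poly2 (f w) x) \<in> poly_span R"
proof -
  assume f: "\<And>a. a \<in> keys x \<Longrightarrow> (\<lambda>w. f w a) \<in> poly_span R"
    and sc: "\<And>G c. G \<in> poly_span R \<Longrightarrow> (\<lambda>w. const2 c * G w) \<in> poly_span R"
  have "(\<lambda>w. \<Sum>a\<in>A. const2 (lookup x a) * f w a) \<in> poly_span R"
    if "finite A" "A \<subseteq> keys x" for A
    using that
  proof (induction A)
    case (insert a A)
    then have "(\<lambda>w. const2 (lookup x a) * f w a) \<in> poly_span R" by (intro sc f) auto
    from poly_span_add[OF _ this] insert show ?case by simp
  qed (simp add: poly_span.zero)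
  then show ?thesis unfolding eval_poly2_def by auto
qed

context
  fixes R assumes R: "translation_closed R"
begin

lemma poly_span_smult: "G \<in> poly_span R \<Longrightarrow> (\<lambda>w. const2 c * G w) \<in> poly_span R"
proof (induction rule: poly_span.induct)
  case (add_pure G \<rho> u)
  have "(\<lambda>w. c * \<rho> w) \<in> R" using R add_pure by (simp add: translation_closed_def)
  from poly_span.add_pure[OF add_pure.IH this, of u] show ?case by (simp add: algebra_simps)
qed (simp add: poly_span.zero)

lemma poly_span_gen_act:
  "G \<in> poly_span R \<Longrightarrow> (\<lambda>w. gen_act lam \<alpha> \<beta> \<gamma> M a (G w) + G (w @ [a])) \<in> poly_span R"
proof (induction rule: poly_span.induct)
  case zero
  have "gen_act lam \<alpha> \<beta> \<gamma> M a 0 = 0" by (cases M; cases a) simp_all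
  then show ?case by (simp add: poly_span.zero)
next
  case (add_pure G \<rho> u)
  have "(\<lambda>w. \<rho> (w @ [a])) \<in> R" using R add_pure by (simp add: translation_closed_def)
  from poly_span.add_pure[OF poly_span.add_pure[OF add_pure.IH add_pure.hyps(2), of "gen_act lam \<alpha> \<beta> \<gamma> M a u"] this, of u]
  show ?case by (simp add: gen_act_add gen_act_const2_mult) (simp add: add_ac)
qed

lemma poly_span_act:
  "G \<in> poly_span R \<Longrightarrow> (\<lambda>w. eval_poly2 (\<lambda>a. gen_act lam \<alpha> \<beta> \<gamma> M a (G w) + G (w @ [a])) x) \<in> poly_span R"
  by (rule poly_span_eval) (auto intro: poly_span_gen_act poly_span_smult)

lemma linear_module_tensor_model: "linear_module (tensor_model M lam \<alpha> \<beta> \<gamma> R)"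
proof (intro linear_module.intro linear_module_axioms.intro abelian_groupI)
  fix G assume "G \<in> carrier (tensor_model M lam \<alpha> \<beta> \<gamma> R)"
  then have "(\<lambda>w. const2 (- 1) * G w) \<in> poly_span R"
    by (intro poly_span_smult) (simp add: tensor_model_def)
  then show "\<exists>y\<in>carrier (tensor_model M lam \<alpha> \<beta> \<gamma> R). y \<oplus>\<^bsub>tensor_model M lam \<alpha> \<beta> \<gamma> R\<^esub> G = \<zero>\<^bsub>tensor_model M lam \<alpha> \<beta> \<gamma> R\<^esub>"
    by (auto simp: tensor_model_def intro!: bexI)
next
  fix u x assume "u \<in> carrier (tensor_model M lam \<alpha> \<beta> \<gamma> R)"
  then show "act (tensor_model M lam \<alpha> \<beta> \<gamma> R) x u \<in> carrier (tensor_model M lam \<alpha> \<beta> \<gamma> R)"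
    by (auto simp: tensor_model_def intro: poly_span_act)
qed (auto simp: tensor_model_def add_ac distrib_left gen_act_add eval_poly2_fun_add
   intro: poly_span.zero poly_span_add poly_span_smult)

end

text \<open>
  Contracting the polynomial factor of a tensor with a coefficient functional leads back to \<open>R\<close>.
\<close>

lemma coeff_poly_span:
  assumes "translation_closed R" "G \<in> poly_span R"
  shows "(\<lambda>w. coeff (coeff (G w) i) j) \<in> R"
  using assms(2)
proof (induction rule: poly_span.induct)
  case (add_pure G \<rho> u)
  have "(\<lambda>w. \<rho> w * coeff (coeff u i) j) \<in> R"
    using assms(1) add_pure unfolding mult.commute[of "\<rho> _"] by (simp add: translation_closed_def)
  then have "(\<lambda>w. coeff (coeff (G w) i) j + \<rho> w * coeff (coeff u i) j) \<in> R"
    using assms(1) add_pure.IH by (simp add: translation_closed_def)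
  then show ?case by simp
qed (use assms(1) in \<open>simp add: translation_closed_def\<close>)

lemma poly2_expansion:
  "\<exists>n. \<forall>m\<ge>n. (u :: poly2) = (\<Sum>i\<le>m. \<Sum>j\<le>m. const2 (coeff (coeff u i) j) * monom (monom 1 j) i)"
proof -
  define n where "n = Max (insert (degree u) ((\<lambda>i. degree (coeff u i)) ` {..degree u}))"
  have n: "degree u \<le> n" unfolding n_def by (rule Max_ge) auto
  have c: "degree (coeff u i) \<le> n" for i
  proof (cases "i \<le> degree u")
    case True
    then show ?thesis unfolding n_def by (intro Max_ge) auto
  next
    case False
    then show ?thesis by (simp add: coeff_eq_0)
  qed
  show ?thesis
  proof (intro exI[of _ n] allI impI)
    fix m assume m: "n \<le> m"
    have "(\<Sum>j\<le>m. const2 (coeff (coeff u i) j) * monom (monom 1 j) i) = monom (coeff u i) i" for i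
    proof -
      have "(\<Sum>j\<le>m. const2 (coeff (coeff u i) j) * monom (monom 1 j) i) =
        (\<Sum>j\<le>m. monom (monom (coeff (coeff u i) j) j) i)"
        by (simp add: const2_mult_smult smult_monom)
      also have "\<dots> = monom (\<Sum>j\<le>m. monom (coeff (coeff u i) j) j) i"
        by (rule poly_eqI) (simp add: coeff_sum)
      also have "\<dots> = monom (coeff u i) i"
        using poly_as_sum_of_monoms'[OF order_trans[OF c m]] by simp
      finally show ?thesis .
    qed
    then show "u = (\<Sum>i\<le>m. \<Sum>j\<le>m. const2 (coeff (coeff u i) j) * monom (monom 1 j) i)"
      using poly_as_sum_of_monoms'[OF order_trans[OF n m]] by simp
  qed
qed

section \<open>Tensor products as spaces of functions\<close>

lemma pair_module_simps [simp]:
  "carrier (pair_module M N) = {p. keys p \<subseteq> carrier M \<times> carrier N}"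
  "p \<oplus>\<^bsub>pair_module M N\<^esub> q = p + q"
  "\<zero>\<^bsub>pair_module M N\<^esub> = 0"
  "c \<odot>\<^bsub>pair_module M N\<^esub> p = scale c p"
  "act (pair_module M N) x p =
     lin_extend (\<lambda>(u, v). basis_vec (act M x u, v) + basis_vec (u, act N x v)) p"
  by (simp_all add: pair_module_def)

lemma keys_single_subset: "k \<in> A \<Longrightarrow> keys (single k c) \<subseteq> A"
  by auto

lemma keys_add_subset:
  "keys p \<subseteq> A \<Longrightarrow> keys q \<subseteq> A \<Longrightarrow> keys (p + q) \<subseteq> A"
  using Poly_Mapping.keys_add[of p q] by blast

lemma keys_subset_induct [consumes 1, case_names single add zero]:
  fixes p :: "'a \<Rightarrow>\<^sub>0 'b::comm_monoid_add"
  assumes "keys p \<subseteq> A" "\<And>k c. k \<in> A \<Longrightarrow> P (single k c)"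
    "\<And>p q. keys p \<subseteq> A \<Longrightarrow> keys q \<subseteq> A \<Longrightarrow> P p \<Longrightarrow> P q \<Longrightarrow> P (p + q)" "P 0"
  shows "P p"
proof -
  have "P (\<Sum>k\<in>B. single k (lookup p k)) \<and>
     keys (\<Sum>k\<in>B. single k (lookup p k)) \<subseteq> A"
    if "finite B" "B \<subseteq> keys p" for B
    using that
  proof (induction B)
    case (insert k B)
    then have "k \<in> A" using assms(1) by auto
    moreover have "P (\<Sum>k\<in>B. single k (lookup p k))"
      "keys (\<Sum>k\<in>B. single k (lookup p k)) \<subseteq> A"
      using insert by auto
    ultimately show ?case
      unfolding sum.insert[OF insert.hyps] by (intro conjI assms(2,3) keys_add_subset keys_single_subset)
  qed (simp add: assms)
  from this[OF finite_keys subset_refl] show ?thesis using poly_mapping_monomials[of p] by simp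
qed

lemma scale_distrib: "scale c (p + q) = scale c p + scale c q"
  by (rule poly_mapping_eqI) (simp add: lookup_add distrib_left)

lemma scale_zero [simp]: "scale c 0 = 0"
  by (rule poly_mapping_eqI) simp

lemma scale_minus_one: "scale (- 1) p = - p"
  by (rule poly_mapping_eqI) simp

lemma linear_module_pair_module:
  assumes "linear_module M" "linear_module N"
  shows "linear_module (pair_module M N)"
proof (intro linear_module.intro linear_module_axioms.intro abelian_groupI)
  interpret M: linear_module M by fact
  interpret N: linear_module N by fact
  fix p assume p: "p \<in> carrier (pair_module M N)"
  have "- p \<in> carrier (pair_module M N)"
    using p by (auto simp: in_keys_iff)
  then show "\<exists>q\<in>carrier (pair_module M N). q \<oplus>\<^bsub>pair_module M N\<^esub> p = \<zero>\<^bsub>pair_module M N\<^esub>"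
    by (intro bexI[of _ "- p"]) auto
  show "c \<odot>\<^bsub>pair_module M N\<^esub> p \<in> carrier (pair_module M N)" for c
    using p keys_scale_subset[of c p] by auto
  show "act (pair_module M N) x p \<in> carrier (pair_module M N)" for x
    using p unfolding pair_module_simps mem_Collect_eq
  proof (induction p rule: keys_subset_induct)
    case (single k c)
    then obtain u v where "k = (u, v)" "u \<in> carrier M" "v \<in> carrier N" by auto
    then show ?case by (simp add: scale_distrib keys_add_subset)
  next
    case (add p q)
    then show ?case by (simp add: keys_add_subset)
  qed (simp add: lin_extend_def)
qed (simp_all add: scale_distrib add_ac keys_add_subset)

lemma linear_module_poly_module: "linear_module (poly_module M lam \<alpha> \<beta> \<gamma>)"
proof (intro linear_module.intro linear_module_axioms.intro abelian_groupI)
  fix g assume "g \<in> carrier (poly_module M lam \<alpha> \<beta> \<gamma>)"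
  have "- g \<oplus>\<^bsub>poly_module M lam \<alpha> \<beta> \<gamma>\<^esub> g = \<zero>\<^bsub>poly_module M lam \<alpha> \<beta> \<gamma>\<^esub>" by simp
  then show "\<exists>h\<in>carrier (poly_module M lam \<alpha> \<beta> \<gamma>). h \<oplus>\<^bsub>poly_module M lam \<alpha> \<beta> \<gamma>\<^esub> g = \<zero>\<^bsub>poly_module M lam \<alpha> \<beta> \<gamma>\<^esub>"
    by (intro bexI[of _ "- g"]) simp_all
qed (auto simp: algebra_simps gen_act_add eval_poly2_fun_add)

text \<open>
  A module \<open>V\<close> that is identified by \<open>r\<close> with a module of functions on words.
\<close>

locale tensor_factor =
  fixes M :: family and lam \<alpha> \<beta> \<gamma> :: complex and V :: "'v lie_module"
    and R :: "(gen list \<Rightarrow> complex) set" and r :: "'v \<Rightarrow> gen list \<Rightarrow> complex"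
  assumes V: "linear_module V" and R: "translation_closed R" and r: "r \<in> lie_iso V (function_module R)"
begin

abbreviation "P \<equiv> poly_module M lam \<alpha> \<beta> \<gamma>"
abbreviation "Q \<equiv> pair_module P V"

lemma r_simps: "v \<in> carrier V \<Longrightarrow> r v \<in> R"
  "u \<in> carrier V \<Longrightarrow> v \<in> carrier V \<Longrightarrow> r (u \<oplus>\<^bsub>V\<^esub> v) w = r u w + r v w"
  "v \<in> carrier V \<Longrightarrow> r (c \<odot>\<^bsub>V\<^esub> v) w = c * r v w"
  "v \<in> carrier V \<Longrightarrow> r (act V x v) w = evalf (\<lambda>g. r v (w @ [g])) x"
  using r by (auto simp: lie_iso_def function_module_def bij_betw_def)

lemma r_bij: "bij_betw r (carrier V) R"
  using r by (auto simp: lie_iso_def function_module_def)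

text \<open>
  The map from formal sums of pairs to functions on words that sends \<open>(u,v)\<close> to \<open>w \<mapsto> r(v)(w) u\<close>. Its kernel
  will be the span of the tensor relations.
\<close>

definition realize :: "(poly2 \<times> 'v \<Rightarrow>\<^sub>0 complex) \<Rightarrow> gen list \<Rightarrow> poly2" where
  "realize p w = eval_poly2 (\<lambda>(u, v). const2 (r v w) * u) p"

lemma realize_add [simp]: "realize (p + q) w = realize p w + realize q w"
  and realize_diff [simp]: "realize (p - q) w = realize p w - realize q w"
  and realize_scale [simp]: "realize (scale c p) w = const2 c * realize p w"
  and realize_single [simp]: "realize (single (u, v) c) w = const2 c * (const2 (r v w) * u)"
  and realize_zero [simp]: "realize 0 w = 0"
  by (simp_all add: realize_def)

lemma realize_mem: "p \<in> carrier Q \<Longrightarrow> realize p \<in> poly_span R"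
  unfolding realize_def
  by (rule poly_span_eval) (auto intro: poly_span_pure r_simps poly_span_smult R)

text \<open>
  Also on formal sums, before any relations are imposed, the action corresponds to that of the model;
  hence the kernel of \<open>realize\<close> is stable under the Lie algebra.
\<close>

lemma realize_act:
  assumes "p \<in> carrier Q"
  shows "realize (act Q x p) w = eval_poly2 (\<lambda>a. gen_act lam \<alpha> \<beta> \<gamma> M a (realize p w) + realize p (w @ [a])) x"
  using assms unfolding pair_module_simps mem_Collect_eq
proof (induction p rule: keys_subset_induct)
  case (single k c)
  obtain u v where k: "k = (u, v)" "v \<in> carrier V" using single by auto
  have "const2 (r v w) * eval_poly2 (\<lambda>a. gen_act lam \<alpha> \<beta> \<gamma> M a u) x + const2 (r (act V x v) w) * u =
     eval_poly2 (\<lambda>a. const2 (r v w) * gen_act lam \<alpha> \<beta> \<gamma> M a u + const2 (r v (w @ [a])) * u) x"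
    using k by (simp add: r_simps const2_evalf_mult eval_poly2_fun_add eval_poly2_fun_mult)
  then have "realize (act Q x (single k c)) w =
      const2 c * eval_poly2 (\<lambda>a. const2 (r v w) * gen_act lam \<alpha> \<beta> \<gamma> M a u + const2 (r v (w @ [a])) * u) x"
    using k by (simp add: scale_distrib flip: distrib_left)
  also have "\<dots> = eval_poly2 (\<lambda>a. gen_act lam \<alpha> \<beta> \<gamma> M a (realize (single k c) w)
      + realize (single k c) (w @ [a])) x"
    using k unfolding eval_poly2_fun_mult[symmetric] by (simp add: gen_act_const2_mult distrib_left)
  finally show ?case by simp
next
  case (add p q)
  then show ?case by (simp add: gen_act_add eval_poly2_fun_add)
next
  case zero
  have "gen_act lam \<alpha> \<beta> \<gamma> M a 0 = 0" for a using gen_act_const2_mult[of lam \<alpha> \<beta> \<gamma> M a 0 0] by simp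
  then show ?case by (simp add: lin_extend_def eval_poly2_def)
qed

abbreviation "T \<equiv> tensor_model M lam \<alpha> \<beta> \<gamma> R"

lemma realize_hom: "realize \<in> lie_hom Q T"
  using realize_mem realize_act by (auto simp: lie_hom_def tensor_model_def simp del: pair_module_simps(1,5))

lemma linear_module_Q: "linear_module Q"
  by (rule linear_module_pair_module[OF linear_module_poly_module V])

lemma realize_image: "realize ` carrier Q = poly_span R"
proof
  show "poly_span R \<subseteq> realize ` carrier Q"
  proof
    fix G assume "G \<in> poly_span R"
    then show "G \<in> realize ` carrier Q"
    proof (induction rule: poly_span.induct)
      case zero
      show ?case by (rule image_eqI[of _ _ 0]) (auto)
    next
      case (add_pure G \<rho> u)
      then obtain p where p: "p \<in> carrier Q" "G = realize p" by blast
      obtain v where v: "v \<in> carrier V" "r v = \<rho>" using r_bij add_pure by (auto simp: bij_betw_def)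
      show ?case
      proof (rule image_eqI[of _ _ "p + single (u, v) 1"])
        show "p + single (u, v) 1 \<in> carrier Q"
          using p v by (simp add: keys_add_subset)
      qed (use p v in auto)
    qed
  qed
qed (use realize_mem in blast)

lemma tensor_relations_subset: "tensor_relations P V \<subseteq> {p \<in> carrier Q. realize p = (\<lambda>_. 0)}"
proof -
  interpret V: linear_module V by (rule V)
  have neg: "keys (- p) \<subseteq> A" if "keys p \<subseteq> A" for p :: "poly2 \<times> 'v \<Rightarrow>\<^sub>0 complex" and A
    using that by (auto simp: in_keys_iff)
  have diff: "keys (p - q) \<subseteq> A" if "keys p \<subseteq> A" "keys q \<subseteq> A"
    for p q :: "poly2 \<times> 'v \<Rightarrow>\<^sub>0 complex" and A
    using keys_add_subset[OF that(1) neg[OF that(2)]] by simp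
  have "x \<in> carrier Q \<and> (\<forall>w. realize x w = 0)" if "x \<in> tensor_relations P V" for x
    using that unfolding tensor_relations_def
    by (elim UnE CollectE exE conjE; hypsubst) (simp_all add: diff r_simps distrib_left distrib_right mult.assoc)
  then show ?thesis by blast
qed

text \<open>
  The tensor relations in the notation of \<open>\<complex>[s,t]\<close>.
\<close>

lemma tensor_relations_mem:
  assumes "v \<in> carrier V" "v' \<in> carrier V"
  shows "basis_vec (u + u', v) - basis_vec (u, v) - basis_vec (u', v) \<in> tensor_relations P V"
    "basis_vec (u, v \<oplus>\<^bsub>V\<^esub> v') - basis_vec (u, v) - basis_vec (u, v') \<in> tensor_relations P V"
    "basis_vec (const2 c * u, v) - scale c (basis_vec (u, v)) \<in> tensor_relations P V"
    "basis_vec (u, c \<odot>\<^bsub>V\<^esub> v) - scale c (basis_vec (u, v)) \<in> tensor_relations P V"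
  unfolding tensor_relations_def
     apply (rule UnI1, rule UnI1, rule UnI1, rule CollectI, rule exI[of _ u], rule exI[of _ u'], rule exI[of _ v])
     apply (simp add: assms)
    apply (rule UnI1, rule UnI1, rule UnI2, rule CollectI, rule exI[of _ u], rule exI[of _ v], rule exI[of _ v'])
    apply (simp add: assms)
   apply (rule UnI1, rule UnI2, rule CollectI, rule exI[of _ c], rule exI[of _ u], rule exI[of _ v])
   apply (simp add: assms)
  apply (rule UnI2, rule CollectI, rule exI[of _ c], rule exI[of _ u], rule exI[of _ v])
  apply (simp add: assms)
  done

definition unrealize :: "(gen list \<Rightarrow> complex) \<Rightarrow> 'v" where
  "unrealize = inv_into (carrier V) r"

lemma unrealize_mem: "\<rho> \<in> R \<Longrightarrow> unrealize \<rho> \<in> carrier V"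
  using r_bij unfolding unrealize_def bij_betw_def by (metis inv_into_into)

lemma unrealize_r: "v \<in> carrier V \<Longrightarrow> unrealize (r v) = v"
  using r_bij unfolding unrealize_def bij_betw_def by simp

lemma r_unrealize: "\<rho> \<in> R \<Longrightarrow> r (unrealize \<rho>) = \<rho>"
  using r_bij unfolding unrealize_def bij_betw_def by (simp add: f_inv_into_f)

lemma unrealize_add:
  assumes "\<rho> \<in> R" "\<sigma> \<in> R"
  shows "unrealize (\<lambda>w. \<rho> w + \<sigma> w) = unrealize \<rho> \<oplus>\<^bsub>V\<^esub> unrealize \<sigma>"
proof -
  interpret V: linear_module V by (rule V)
  have "(\<lambda>w. \<rho> w + \<sigma> w) = r (unrealize \<rho> \<oplus>\<^bsub>V\<^esub> unrealize \<sigma>)"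
    using assms by (auto simp: r_simps unrealize_mem r_unrealize)
  then show ?thesis using assms by (simp add: unrealize_r unrealize_mem)
qed

lemma unrealize_smult:
  assumes "v \<in> carrier V" shows "unrealize (\<lambda>w. c * r v w) = c \<odot>\<^bsub>V\<^esub> v"
proof -
  interpret V: linear_module V by (rule V)
  have "(\<lambda>w. c * r v w) = r (c \<odot>\<^bsub>V\<^esub> v)" using assms by (auto simp: r_simps)
  then show ?thesis using assms by (simp add: unrealize_r)
qed

text \<open>
  The vector in \<open>V\<close> that accompanies the monomial \<open>s\<^sup>i t\<^sup>j\<close>, for \<open>a = (i,j)\<close>, in the tensor represented by \<open>p\<close>. It
  is defined through the realization and therefore depends on the realization of \<open>p\<close> only.
\<close>

definition coefficient :: "nat \<times> nat \<Rightarrow> (poly2 \<times> 'v \<Rightarrow>\<^sub>0 complex) \<Rightarrow> 'v" where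
  "coefficient a p = unrealize (\<lambda>w. coeff (coeff (realize p w) (fst a)) (snd a))"

definition monomial :: "nat \<times> nat \<Rightarrow> poly2" where
  "monomial a = monom (monom 1 (snd a)) (fst a)"

definition normal_form :: "nat \<Rightarrow> (poly2 \<times> 'v \<Rightarrow>\<^sub>0 complex) \<Rightarrow> (poly2 \<times> 'v \<Rightarrow>\<^sub>0 complex)" where
  "normal_form m p = (\<Sum>a\<in>{..m} \<times> {..m}. basis_vec (monomial a, coefficient a p))"

lemma coefficient_mem: "p \<in> carrier Q \<Longrightarrow> coefficient a p \<in> carrier V"
  unfolding coefficient_def by (intro unrealize_mem coeff_poly_span[OF R] realize_mem)

lemma coefficient_add:
  "p \<in> carrier Q \<Longrightarrow> q \<in> carrier Q \<Longrightarrow> coefficient a (p + q) = coefficient a p \<oplus>\<^bsub>V\<^esub> coefficient a q"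
  unfolding coefficient_def
  by (simp add: unrealize_add[symmetric] coeff_poly_span[OF R] realize_mem del: pair_module_simps)

lemma coefficient_single:
  "v \<in> carrier V \<Longrightarrow> coefficient a (single (u, v) c) = (c * coeff (coeff u (fst a)) (snd a)) \<odot>\<^bsub>V\<^esub> v"
  unfolding coefficient_def
  by (simp add: unrealize_smult[symmetric]) (simp add: ac_simps)

context
  fixes K assumes K: "submodule K complex_ring Q" "tensor_relations P V \<subseteq> K"
begin

lemma K_zero: "0 \<in> K"
  using K(1) subgroup.one_closed[of K "add_monoid Q"] by (simp add: submodule_complex_iff)

lemma K_add: "p \<in> K \<Longrightarrow> q \<in> K \<Longrightarrow> p + q \<in> K"
  using K(1) subgroup.m_closed[of K "add_monoid Q" p q] by (simp add: submodule_complex_iff)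

lemma K_scale: "p \<in> K \<Longrightarrow> scale c p \<in> K"
  using K(1) by (simp add: submodule_complex_iff)

lemma K_diff: "p \<in> K \<Longrightarrow> q \<in> K \<Longrightarrow> p - q \<in> K"
  using K_add[OF _ K_scale[of q "- 1"]] by (simp add: scale_minus_one)

lemma K_sum: "(\<And>i. i \<in> A \<Longrightarrow> f i \<in> K) \<Longrightarrow> sum f A \<in> K"
  by (induction A rule: infinite_finite_induct) (auto intro: K_zero K_add)

lemmas K_relations = tensor_relations_mem[THEN subsetD[OF K(2)]]

lemma K_sum_left:
  assumes "v \<in> carrier V" "finite A"
  shows "basis_vec (\<Sum>i\<in>A. f i, v) - (\<Sum>i\<in>A. basis_vec (f i, v)) \<in> K"
  using assms(2)
proof (induction A)
  case empty
  show ?case using K_relations(3)[OF assms(1) assms(1), of 0 0] by simp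
next
  case (insert i A)
  have "(basis_vec (f i + sum f A, v) - basis_vec (f i, v) - basis_vec (sum f A, v)) +
    (basis_vec (sum f A, v) - (\<Sum>i\<in>A. basis_vec (f i, v))) \<in> K"
    by (rule K_add[OF K_relations(1)[OF assms(1) assms(1)] insert.IH])
  then show ?case using insert.hyps by (simp add: algebra_simps)
qed

lemma K_zero_right: "basis_vec (u, unrealize (\<lambda>_. 0)) \<in> K"
proof -
  interpret V: linear_module V by (rule V)
  show ?thesis
    using K_relations(4)[of "\<zero>\<^bsub>V\<^esub>" "\<zero>\<^bsub>V\<^esub>" u 0] unrealize_smult[of "\<zero>\<^bsub>V\<^esub>" 0] by simp
qed

text \<open>
  Expand \<open>u\<close> into monomials on the left of the tensor sign and move the coefficients to the right.
\<close>

lemma normal_form_single: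
  assumes v: "v \<in> carrier V"
    and u: "u = (\<Sum>i\<le>m. \<Sum>j\<le>m. const2 (coeff (coeff u i) j) * monom (monom 1 j) i)"
  shows "single (u, v) c - normal_form m (single (u, v) c) \<in> K"
proof -
  let ?A = "{..m} \<times> {..m}"
  define k where "k a = coeff (coeff u (fst a)) (snd a)" for a
  have u': "u = (\<Sum>a\<in>?A. const2 (k a) * monomial a)"
    using u by (simp add: sum.cartesian_product k_def monomial_def case_prod_unfold)
  \<comment> \<open>The first relation expands the sum on the left, the others move the scalars of each term across.\<close>
  have "scale c (basis_vec (u, v) - (\<Sum>a\<in>?A. basis_vec (const2 (k a) * monomial a, v))) +
    (\<Sum>a\<in>?A. scale c (basis_vec (const2 (k a) * monomial a, v) - scale (k a) (basis_vec (monomial a, v)))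
      - (basis_vec (monomial a, (c * k a) \<odot>\<^bsub>V\<^esub> v) - scale (c * k a) (basis_vec (monomial a, v)))) \<in> K"
    by (subst u') (intro K_add K_sum K_diff K_scale K_sum_left K_relations[OF v v] v finite_cartesian_product finite_atMost)
  also have "scale c (basis_vec (u, v) - (\<Sum>a\<in>?A. basis_vec (const2 (k a) * monomial a, v))) +
    (\<Sum>a\<in>?A. scale c (basis_vec (const2 (k a) * monomial a, v) - scale (k a) (basis_vec (monomial a, v)))
      - (basis_vec (monomial a, (c * k a) \<odot>\<^bsub>V\<^esub> v) - scale (c * k a) (basis_vec (monomial a, v)))) =
    single (u, v) c - (\<Sum>a\<in>?A. basis_vec (monomial a, (c * k a) \<odot>\<^bsub>V\<^esub> v))"
  proof -
    have sd: "scale c (p - q) = scale c p - scale c q" for p q :: "poly2 \<times> 'v \<Rightarrow>\<^sub>0 complex"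
      by (rule poly_mapping_eqI) (simp add: lookup_minus right_diff_distrib)
    have ss: "scale c (\<Sum>a\<in>?A. f a) = (\<Sum>a\<in>?A. scale c (f a))" for f :: "nat \<times> nat \<Rightarrow> (poly2 \<times> 'v \<Rightarrow>\<^sub>0 complex)"
      by (rule poly_mapping_eqI) (simp add: lookup_sum sum_distrib_left)
    show ?thesis by (simp add: sd ss sum_subtractf)
  qed
  finally show ?thesis
    using v by (simp add: normal_form_def coefficient_single k_def)
qed

text \<open>
  Modulo the relations every tensor equals its normal form \<open>\<Sum> s\<^sup>i t\<^sup>j \<otimes> v\<^sub>i\<^sub>j\<close>, provided that the bound on the
  exponents is large enough.
\<close>

lemma normal_form_mod_K:
  assumes "p \<in> carrier Q" shows "\<exists>n. \<forall>m\<ge>n. p - normal_form m p \<in> K"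
  using assms unfolding pair_module_simps mem_Collect_eq
proof (induction p rule: keys_subset_induct)
  case (single k c)
  then obtain u v where k: "k = (u, v)" "v \<in> carrier V" by auto
  then show ?case using poly2_expansion[of u] normal_form_single[OF k(2)] by blast
next
  case (add p q)
  then obtain n n' where n: "\<And>m. m \<ge> n \<Longrightarrow> p - normal_form m p \<in> K" "\<And>m. m \<ge> n' \<Longrightarrow> q - normal_form m q \<in> K"
    by blast
  have pq: "p \<in> carrier Q" "q \<in> carrier Q" using add by auto
  show ?case
  proof (intro exI[of _ "max n n'"] allI impI)
    fix m assume m: "max n n' \<le> m"
    have "(p - normal_form m p) + (q - normal_form m q) -
      (\<Sum>a\<in>{..m} \<times> {..m}. basis_vec (monomial a, coefficient a p \<oplus>\<^bsub>V\<^esub> coefficient a q)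
        - basis_vec (monomial a, coefficient a p) - basis_vec (monomial a, coefficient a q)) \<in> K"
      using m by (intro K_diff K_add K_sum n K_relations coefficient_mem pq) auto
    then show "p + q - normal_form m (p + q) \<in> K"
      by (simp add: normal_form_def coefficient_add[OF pq] sum_subtractf sum.distrib algebra_simps)
  qed
next
  case zero
  have "normal_form m 0 \<in> K" for m
    unfolding normal_form_def coefficient_def by (intro K_sum) (simp add: K_zero_right)
  then show ?case using K_diff[OF K_zero] by auto
qed

text \<open>
  If the realization vanishes then so do all coefficients of the normal form.
\<close>

lemma kernel_subset_K:
  assumes "p \<in> carrier Q" "realize p = (\<lambda>_. 0)" shows "p \<in> K"
proof -
  obtain n where n: "p - normal_form n p \<in> K" using normal_form_mod_K[OF assms(1)] by blast
  have "normal_form n p \<in> K"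
    unfolding normal_form_def coefficient_def assms(2) by (intro K_sum) (simp add: K_zero_right)
  from K_add[OF n this] show ?thesis by simp
qed

end

lemma tensor_eq: "P \<otimes>\<^sub>L V = lie_quot Q {p \<in> carrier Q. realize p = (\<lambda>_. 0)}"
  and submodule_kernel_realize: "lie_submodule {p \<in> carrier Q. realize p = (\<lambda>_. 0)} Q"
proof -
  have zero: "\<zero>\<^bsub>T\<^esub> = (\<lambda>_. 0)" by (simp add: tensor_model_def)
  show sub: "lie_submodule {p \<in> carrier Q. realize p = (\<lambda>_. 0)} Q"
    using kernel_submodule[OF linear_module_Q linear_module_tensor_model[OF R] realize_hom]
    by (simp only: zero)
  then have "\<Inter>{K. submodule K complex_ring Q \<and> tensor_relations P V \<subseteq> K} =
    {p \<in> carrier Q. realize p = (\<lambda>_. 0)}"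
    using tensor_relations_subset kernel_subset_K by (intro equalityI Inter_lower Inter_greatest) (auto simp: lie_submodule_def)
  then show "P \<otimes>\<^sub>L V = lie_quot Q {p \<in> carrier Q. realize p = (\<lambda>_. 0)}"
    by (simp only: tensor_def)
qed

theorem tensor_isomorphic: "P \<otimes>\<^sub>L V \<cong>\<^sub>L T"
proof -
  have T: "carrier T = poly_span R" "\<zero>\<^bsub>T\<^esub> = (\<lambda>_. 0)" by (simp_all add: tensor_model_def)
  have "induced_map realize \<in> lie_iso (P \<otimes>\<^sub>L V) T"
    unfolding tensor_eq
    by (rule linear_module.induced_map_iso[OF linear_module_Q submodule_kernel_realize realize_hom
          linear_module_tensor_model[OF R]]) (simp_all add: T realize_image del: pair_module_simps)
  then show ?thesis by (auto simp: lie_isomorphic_def)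
qed

lemma linear_module_tensor: "linear_module (P \<otimes>\<^sub>L V)"
  unfolding tensor_eq by (rule linear_module.linear_module_lie_quot[OF linear_module_Q submodule_kernel_realize])

end

section \<open>Isomorphisms, and polynomials related by shifts\<close>

lemma lie_iso_inv_into:
  assumes "linear_module M" "\<phi> \<in> lie_iso M N" shows "inv_into (carrier M) \<phi> \<in> lie_iso N M"
proof -
  interpret linear_module M by fact
  note \<phi> = assms(2)
  then have bij: "bij_betw \<phi> (carrier M) (carrier N)" by (simp add: lie_iso_def)
  define \<psi> where "\<psi> = inv_into (carrier M) \<phi>"
  have \<psi>: "\<psi> (\<phi> u) = u" if "u \<in> carrier M" for u
    using that bij by (simp add: \<psi>_def bij_betw_def)
  have surj: "\<exists>v'\<in>carrier M. v = \<phi> v'" if "v \<in> carrier N" for v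
    using that bij by (auto simp: bij_betw_def)
  have "\<psi> \<in> lie_iso N M"
    unfolding lie_iso_def mem_Collect_eq
  proof (intro conjI ballI allI)
    show "bij_betw \<psi> (carrier N) (carrier M)" unfolding \<psi>_def by (rule bij_betw_inv_into[OF bij])
  next
    fix u v assume "u \<in> carrier N" "v \<in> carrier N"
    then obtain u' v' where "u' \<in> carrier M" "v' \<in> carrier M" "u = \<phi> u'" "v = \<phi> v'" using surj by blast
    then show "\<psi> (u \<oplus>\<^bsub>N\<^esub> v) = \<psi> u \<oplus>\<^bsub>M\<^esub> \<psi> v"
      using \<phi> \<psi>[of "u' \<oplus>\<^bsub>M\<^esub> v'"] \<psi> by (simp add: lie_iso_def)
  next
    fix c v assume "v \<in> carrier N"
    then obtain v' where "v' \<in> carrier M" "v = \<phi> v'" using surj by blast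
    then show "\<psi> (c \<odot>\<^bsub>N\<^esub> v) = c \<odot>\<^bsub>M\<^esub> \<psi> v"
      using \<phi> \<psi>[of "c \<odot>\<^bsub>M\<^esub> v'"] \<psi> by (simp add: lie_iso_def)
  next
    fix x v assume "v \<in> carrier N"
    then obtain v' where "v' \<in> carrier M" "v = \<phi> v'" using surj by blast
    then show "\<psi> (act N x v) = act M x (\<psi> v)"
      using \<phi> \<psi>[of "act M x v'"] \<psi> by (simp add: lie_iso_def)
  qed
  then show ?thesis by (simp only: \<psi>_def)
qed

lemma lie_isomorphic_sym: "linear_module M \<Longrightarrow> M \<cong>\<^sub>L N \<Longrightarrow> N \<cong>\<^sub>L M"
  unfolding lie_isomorphic_def using lie_iso_inv_into by blast

lemma lie_isomorphic_trans:
  assumes "L \<cong>\<^sub>L M" "M \<cong>\<^sub>L N" shows "L \<cong>\<^sub>L N"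
proof -
  obtain \<phi> \<psi> where \<phi>: "\<phi> \<in> lie_iso L M" and \<psi>: "\<psi> \<in> lie_iso M N"
    using assms by (auto simp: lie_isomorphic_def)
  have "\<phi> v \<in> carrier M" if "v \<in> carrier L" for v
    using \<phi> that by (auto simp: lie_iso_def bij_betw_def)
  then have "\<psi> \<circ> \<phi> \<in> lie_iso L N"
    using \<phi> \<psi> by (auto simp: lie_iso_def intro: bij_betw_trans)
  then show ?thesis by (auto simp: lie_isomorphic_def)
qed

text \<open>
  Such a polynomial takes the value \<open>p(0)\<close> at all multiples of \<open>c\<close>. The coefficient ring is arbitrary because
  this is used both for polynomials in \<open>t\<close> over the complex numbers and for polynomials in \<open>s\<close> over
  \<open>\<complex>[t]\<close>.
\<close>

lemma periodic_poly_degree: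
  fixes p :: "'a::{idom, ring_char_0} poly"
  assumes "c \<noteq> 0" "\<And>x. poly p (x + c) = poly p x" shows "degree p = 0"
proof -
  have "poly p (of_nat k * c) = poly p 0" for k
    by (induction k) (simp_all add: distrib_right add.commute[of c] assms(2))
  then have "range (\<lambda>k. of_nat k * c) \<subseteq> {x. poly (p - [:poly p 0:]) x = 0}" by auto
  moreover have "infinite (range (\<lambda>k. of_nat k * c))"
    by (rule range_inj_infinite) (use assms(1) in \<open>auto simp: inj_on_def\<close>)
  ultimately have "p - [:poly p 0:] = 0"
    using poly_roots_finite finite_subset by blast
  then have "p = [:poly p 0:]" by simp
  then show ?thesis by (metis degree_pCons_0)
qed

lemma smult_right_cancel: "(q :: 'a::idom poly) \<noteq> 0 \<Longrightarrow> smult a q = smult b q \<Longrightarrow> a = b"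
  using smult_diff_left[of a b q] by simp

lemma smult_left_cancel: "(a :: 'a::idom) \<noteq> 0 \<Longrightarrow> smult a p = smult a q \<Longrightarrow> p = q"
  using smult_diff_right[of a p q] by simp

lemma shift_zero_pcompose: "shift i 0 g = pcompose g [:- of_int i, 1:]"
  by (simp add: shift_def map_poly_idI)

lemma shift_const: "shift i c [:p:] = [:pcompose p [:c, 1:]:]"
  by (simp add: shift_def map_poly_pCons)

lemma shift_one [simp]: "shift i c 1 = 1"
  using shift_const[of i c 1] by (simp add: one_pCons)

text \<open>
  The shape of the action of \<open>h\<^sub>m\<close> for large \<open>m\<close>. A shift preserves the leading coefficient in \<open>s\<close>, so
  comparing leading coefficients for two consecutive \<open>m\<close> gives equality of the bases. Then the shifted
  polynomials do not depend on \<open>m\<close>, and \<open>G\<close> is periodic.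
\<close>

lemma exponential_shift_poly:
  fixes G H :: poly2
  assumes "l1 \<noteq> 0" "l2 \<noteq> 0" "G \<noteq> 0"
    and eq: "\<And>m. K \<le> m \<Longrightarrow> const2 (l1 powi m) * H = const2 (l2 powi m) * (t_var * shift m 0 G)"
  shows "l1 = l2" "degree G = 0"
proof -
  define n where "n = degree G"
  define q where "q = [:0, 1:] * lead_coeff G"
  have q: "q \<noteq> 0" using assms(3) by (simp add: q_def)
  have lead: "coeff (shift m 0 G) n = lead_coeff G" for m
    using lead_coeff_comp[of "[:- of_int m, 1:]" G] by (simp add: shift_zero_pcompose n_def degree_pcompose)
  have "coeff (t_var * g) n = [:0, 1:] * coeff g n" for g
    by (simp add: t_var_def)
  then have c: "smult (l1 powi m) (coeff H n) = smult (l2 powi m) q" if "K \<le> m" for m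
    using arg_cong[OF eq[OF that], of "\<lambda>g. coeff g n"] lead by (simp add: q_def)
  have "smult (l2 powi (K + 1)) q = smult (l1 powi (K + 1)) (coeff H n)" using c[of "K + 1"] by simp
  also have "\<dots> = smult l1 (smult (l1 powi K) (coeff H n))" using assms by (simp add: power_int_add mult.commute)
  also have "\<dots> = smult (l1 * l2 powi K) q" using c[of K] by simp
  finally have "l2 powi (K + 1) = l1 * l2 powi K" using q by (rule smult_right_cancel[rotated])
  then show l: "l1 = l2" using assms by (simp add: power_int_add)
  have "H = t_var * shift m 0 G" if "K \<le> m" for m
    using eq[OF that] assms(1) l by simp
  from this[of K] this[of "K + 1"] have "t_var * shift (K + 1) 0 G = t_var * shift K 0 G" by simp
  then have "shift (K + 1) 0 G = shift K 0 G" by (simp add: t_var_def del: mult_pCons_left)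
  then have "pcompose G [:- of_int (K + 1), 1:] = pcompose G [:- of_int K, 1:]" by (simp add: shift_zero_pcompose)
  then have "poly (pcompose G [:- of_int (K + 1), 1:]) x = poly (pcompose G [:- of_int K, 1:]) x" for x
    by (rule arg_cong)
  then have "poly G (- of_int (K + 1) + x) = poly G (- of_int K + x)" for x
    unfolding poly_pcompose by simp
  note step = this
  have "poly G (x + 1) = poly G x" for x
    using step[of "x + of_int (K + 1)"] by (simp add: algebra_simps)
  then show "degree G = 0" by (intro periodic_poly_degree[of 1]) auto
qed

lemma scaled_shift_poly:
  fixes p :: "complex poly"
  assumes "p \<noteq> 0" "c \<noteq> 0" "smult a p = smult b (pcompose p [:c, 1:])"
  shows "a = b" "a \<noteq> 0 \<Longrightarrow> degree p = 0"
proof -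
  have "lead_coeff (smult a p) = lead_coeff (smult b (pcompose p [:c, 1:]))"
    using assms(3) by (rule arg_cong)
  then have "a * lead_coeff p = b * lead_coeff p"
    using lead_coeff_comp[of "[:c, 1:]" p] unfolding lead_coeff_smult by simp
  then show "a = b" using assms(1) by simp
  assume "a \<noteq> 0"
  then have "pcompose p [:c, 1:] = p"
    using assms(3) smult_left_cancel[of a "pcompose p [:c, 1:]" p] \<open>a = b\<close> by simp
  have "poly p (x + c) = poly p x" for x
  proof -
    have "poly (pcompose p [:c, 1:]) x = poly p x" using \<open>pcompose p _ = p\<close> by (rule arg_cong)
    then show ?thesis by (simp add: poly_pcompose add.commute)
  qed
  then show "degree p = 0" by (rule periodic_poly_degree[OF assms(2)])
qed

text \<open>
  The shape of the actions of \<open>e\<^sub>m\<close> and \<open>f\<^sub>m\<close> in the family \<open>\<Theta>\<close>. Leading coefficients give \<open>a1 = a2\<close>. Applying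
  the first relation at \<open>x + 2\<close> after the second one shows that \<open>b(b + 1)\<close> is the same for \<open>b1\<close> and \<open>b2\<close>, so
  \<open>b1 = b2\<close> or \<open>b1 = -1 - b2\<close>. In the second case the first relation forces zeros of \<open>p\<close> at \<open>2 * b2\<close> and,
  descending in steps of 2 as long as \<open>2 * b2\<close> is not the number of steps, at infinitely many places.
\<close>

lemma theta_shift_poly:
  fixes p :: "complex poly"
  assumes p: "p \<noteq> 0" and a: "a1 \<noteq> 0" "a2 \<noteq> 0"
    and e: "smult a1 ([:b1, 1/2:] * p) = smult a2 ([:b2, 1/2:] * pcompose p [:-2, 1:])"
    and f: "smult (1 / a1) ([:- b1, 1/2:] * p) = smult (1 / a2) ([:- b2, 1/2:] * pcompose p [:2, 1:])"
    and b2: "2 * b2 \<notin> \<nat>"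
  shows "a1 = a2" "b1 = b2" "degree p = 0"
proof -
  have "lead_coeff (smult a1 ([:b1, 1/2:] * p)) = a1 * (1/2 * lead_coeff p)"
    unfolding lead_coeff_smult lead_coeff_mult by simp
  moreover have "lead_coeff (smult a2 ([:b2, 1/2:] * pcompose p [:-2, 1:])) = a2 * (1/2 * lead_coeff p)"
    unfolding lead_coeff_smult lead_coeff_mult using lead_coeff_comp[of "[:-2, 1:]" p] by simp
  ultimately have "a1 * (1/2 * lead_coeff p) = a2 * (1/2 * lead_coeff p)"
    using arg_cong[OF e, of lead_coeff] by (simp only:)
  then show a12: "a1 = a2" using p by simp
  have lin: "poly ([:b, 1/2:] * q) x = (x / 2 + b) * poly q x" for b x :: complex and q
    by (simp add: algebra_simps)
  have e': "(x / 2 + b1) * poly p x = (x / 2 + b2) * poly p (x - 2)" for x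
  proof -
    have "a1 * ((x / 2 + b1) * poly p x) = a2 * ((x / 2 + b2) * poly p (- 2 + x * 1))"
      using arg_cong[OF e, of "\<lambda>q. poly q x"] unfolding poly_smult lin by (simp add: poly_pcompose)
    then show ?thesis unfolding a12 using a(2) by simp
  qed
  have f': "(x / 2 - b1) * poly p x = (x / 2 - b2) * poly p (x + 2)" for x
  proof -
    have "1 / a1 * ((x / 2 - b1) * poly p x) = 1 / a2 * ((x / 2 - b2) * poly p (2 + x * 1))"
      using arg_cong[OF f, of "\<lambda>q. poly q x"] unfolding poly_smult lin by (simp add: poly_pcompose)
    then show ?thesis unfolding a12 using a(2) by (simp add: add.commute)
  qed
  obtain x where x: "poly p x \<noteq> 0" using p poly_all_0_iff_0[of p] by auto
  have "(x / 2 + 1 + b1) * (x / 2 - b1) * poly p x = (x / 2 + 1 + b1) * ((x / 2 - b2) * poly p (x + 2))"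
    using f'[of x] by (simp only: mult.assoc)
  also have "\<dots> = (x / 2 - b2) * (((x + 2) / 2 + b1) * poly p (x + 2))"
    by (simp add: add_divide_distrib mult.left_commute)
  also have "\<dots> = (x / 2 - b2) * (x / 2 + 1 + b2) * poly p x"
    unfolding e'[of "x + 2"] by (simp add: add_divide_distrib mult.assoc)
  finally have "(x / 2 + 1 + b1) * (x / 2 - b1) = (x / 2 - b2) * (x / 2 + 1 + b2)" using x by simp
  moreover have "(x / 2 - b2) * (x / 2 + 1 + b2) - (x / 2 + 1 + b1) * (x / 2 - b1) = (b1 - b2) * (b1 + b2 + 1)"
    by (simp add: algebra_simps)
  ultimately have "(b1 - b2) * (b1 + b2 + 1) = 0" by simp
  then have "b1 = b2 \<or> b1 + b2 + 1 = 0" by simp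
  moreover have "b1 = - 1 - b2" if "b1 + b2 + 1 = 0"
    using that by (simp add: eq_diff_eq add_eq_0_iff2)
  ultimately consider "b1 = b2" | "b1 = - 1 - b2" "b1 \<noteq> b2" by blast
  then show b12: "b1 = b2"
  proof cases
    case 2
    \<comment> \<open>The zeros propagate downwards because \<open>2 * b2 - k\<close> never vanishes.\<close>
    have "poly p (2 * b2 - 2 * of_nat k) = 0" for k
    proof (induction k)
      case 0
      have "b1 - b2 = - (2 * b2 + 1)" using 2(1) by simp
      then have "2 * b2 + 1 \<noteq> 0" using 2(2) by (metis minus_zero right_minus_eq)
      moreover have "(2 * b2 + 1) * poly p (2 * b2) = 0"
        using e'[of "2 * b2 + 2"] 2(1) by (simp add: algebra_simps add_divide_distrib)
      ultimately show ?case by simp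
    next
      case (Suc k)
      have "2 * b2 - of_nat k \<noteq> 0" using b2 by (auto simp: Nats_def)
      moreover have "(2 * b2 - of_nat k) * poly p (2 * b2 - 2 * of_nat (Suc k)) = 0"
      proof -
        have "(2 * b2 - 2 * of_nat k) / 2 + b2 = 2 * b2 - of_nat k"
          "2 * b2 - 2 * of_nat k - 2 = 2 * b2 - 2 * of_nat (Suc k)" by (simp_all add: field_simps)
        then show ?thesis using e'[of "2 * b2 - 2 * of_nat k"] unfolding Suc by (simp only: mult_zero_right)
      qed
      ultimately show ?case by simp
    qed
    then have "range (\<lambda>k::nat. 2 * b2 - 2 * of_nat k) \<subseteq> {x. poly p x = 0}" by auto
    moreover have "infinite (range (\<lambda>k::nat. 2 * b2 - 2 * of_nat k))"
      by (rule range_inj_infinite) (auto simp: inj_on_def)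
    ultimately show ?thesis using p poly_roots_finite finite_subset by blast
  qed
  have "[:b2, 1/2:] * p = [:b2, 1/2:] * pcompose p [:-2, 1:]"
    by (rule smult_left_cancel[OF a(2)]) (rule e[unfolded a12 b12])
  then have "[:b2, 1/2:] * (p - pcompose p [:-2, 1:]) = 0"
    unfolding right_diff_distrib right_minus_eq .
  then have "[:b2, 1/2:] = 0 \<or> p - pcompose p [:-2, 1:] = 0" by (simp only: mult_eq_0_iff)
  moreover have "[:b2, 1/2:] \<noteq> 0" by simp
  ultimately have "p - pcompose p [:-2, 1:] = 0" by blast
  then have "smult 1 p = smult 1 (pcompose p [:-2, 1:])" by (simp only: smult_1_left right_minus_eq)
  from scaled_shift_poly(2)[OF p _ this one_neq_zero] show "degree p = 0" by simp
qed

section \<open>Rigidity of tensor products\<close>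

text \<open>
  The function that represents the pure tensor \<open>u \<otimes> \<rho>\<close>.
\<close>

definition pure :: "(gen list \<Rightarrow> complex) \<Rightarrow> poly2 \<Rightarrow> gen list \<Rightarrow> poly2" where
  "pure \<rho> u = (\<lambda>w. const2 (\<rho> w) * u)"

lemma smooth_poly_span:
  assumes "smooth R" "G \<in> poly_span R"
  shows "\<exists>K. \<forall>g. K \<le> index g \<longrightarrow> (\<forall>w. G (w @ [g]) = 0)"
  using assms(2)
proof (induction rule: poly_span.induct)
  case (add_pure G \<rho> u)
  then obtain K L where "\<And>g w. K \<le> index g \<Longrightarrow> G (w @ [g]) = 0" "\<And>g w. L \<le> index g \<Longrightarrow> \<rho> (w @ [g]) = 0"
    using assms(1) by (fastforce simp: smooth_def)
  then show ?case by (intro exI[of _ "max K L"]) simp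
qed simp

lemma degree_zero_poly2:
  fixes g :: poly2
  assumes "degree g = 0" obtains p where "g = [:p:]"
  by (rule degree_eq_zeroE[OF assms]) (rule that)

text \<open>
  Each generator acts by a power of \<open>\<lambda>\<close> times an operator in which only the shift and, for \<open>d\<^sub>m\<close>, one scalar
  depend on \<open>m\<close>. The factors are nested to the right, so that they can be treated one at a time.
\<close>

lemma gen_act_factor_linear:
  "gen_act lam \<alpha> \<beta> \<gamma> M (Hgen m) g = const2 (lam powi m) * (t_var * shift m 0 g)"
  "gen_act lam \<alpha> \<beta> \<gamma> M (Dgen m) g = const2 (lam powi m) * ((s_var + const2 (of_int m * \<gamma>)) * shift m 0 g)"
  "gen_act lam \<alpha> \<beta> \<gamma> Omega (Egen m) g = const2 (lam powi m) * (const2 \<alpha> * shift m (-2) g)"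
  "gen_act lam \<alpha> \<beta> \<gamma> Delta (Fgen m) g = const2 (lam powi m) * (const2 \<alpha> * shift m 2 g)"
  "gen_act lam \<alpha> \<beta> \<gamma> Theta (Egen m) g = const2 (lam powi m) * (const2 \<alpha> *
     ((const2 (1/2) * t_var + const2 \<beta>) * shift m (-2) g))"
  by (simp_all only: gen_act.simps const2_simps(4) mult.assoc)

lemma gen_act_factor_inverse:
  "gen_act lam \<alpha> \<beta> \<gamma> Omega (Fgen m) g = const2 (lam powi m) * (const2 (- (1 / \<alpha>)) *
     ((const2 (1/2) * t_var + const2 (- \<beta>)) * ((const2 (1/2) * t_var + const2 (\<beta> + 1)) * shift m 2 g)))" (is ?OmegaF)
  "gen_act lam \<alpha> \<beta> \<gamma> Delta (Egen m) g = const2 (lam powi m) * (const2 (- (1 / \<alpha>)) *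
     ((const2 (1/2) * t_var + const2 \<beta>) * ((const2 (1/2) * t_var + const2 (- \<beta> - 1)) * shift m (-2) g)))" (is ?DeltaE)
  "gen_act lam \<alpha> \<beta> \<gamma> Theta (Fgen m) g = const2 (lam powi m) * (const2 (- (1 / \<alpha>)) *
     ((const2 (1/2) * t_var + const2 (- \<beta>)) * shift m 2 g))" (is ?ThetaF)
proof -
  have d: "const2 (lam powi m / \<alpha>) = const2 (lam powi m) * const2 (1 / \<alpha>)"
    using const2_simps(4)[of "lam powi m" "1 / \<alpha>"] by simp
  \<comment> \<open>Abstract letters keep the simplifier from multiplying out the scalars.\<close>
  have ring: "- (l * k) * (h - b) * (h + b + 1) * f = l * (- k * ((h + - b) * ((h + (b + 1)) * f)))"
    "- (l * k) * (h + b) * (h - b - 1) * f = l * (- k * ((h + b) * ((h + (- b - 1)) * f)))"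
    "- (l * k) * (h - b) * f = l * (- k * ((h + - b) * f))" for l k h b f :: poly2
    by (simp_all add: algebra_simps)
  note inst = ring[of "const2 (lam powi m)" "const2 (1 / \<alpha>)" "const2 (1/2) * t_var" "const2 \<beta>"]
  show ?OmegaF
    using inst(1)[of "shift m 2 g"] unfolding gen_act.simps(5) d[symmetric] const2_simps(3,5,6) const2_simps(2) .
  show ?DeltaE
    using inst(2)[of "shift m (-2) g"] unfolding gen_act.simps(6) d[symmetric] const2_simps(3,5,6) const2_simps(2) .
  show ?ThetaF
    using inst(3)[of "shift m 2 g"] unfolding gen_act.simps(9) d[symmetric] const2_simps(3,5,6) const2_simps(2) .
qed

lemmas gen_act_factor = gen_act_factor_linear gen_act_factor_inverse

text \<open>
  An injective homomorphism between two tensor products with polynomial modules of the same family.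
  Only one direction is fixed; it is instantiated both with an isomorphism and with its inverse.
\<close>

locale tensor_embedding =
  fixes M :: family and lam1 lam2 \<alpha>1 \<alpha>2 \<beta>1 \<beta>2 \<gamma>1 \<gamma>2 :: complex
    and R1 R2 :: "(gen list \<Rightarrow> complex) set" and \<phi> :: "(gen list \<Rightarrow> poly2) \<Rightarrow> (gen list \<Rightarrow> poly2)"
  assumes nonzero: "lam1 \<noteq> 0" "lam2 \<noteq> 0" "\<alpha>1 \<noteq> 0" "\<alpha>2 \<noteq> 0"
    and theta: "M = Theta \<Longrightarrow> 2 * \<beta>2 \<notin> \<nat>"
    and R1: "translation_closed R1" "smooth R1" and R2: "translation_closed R2" "smooth R2"
    and hom: "\<phi> \<in> lie_hom (tensor_model M lam1 \<alpha>1 \<beta>1 \<gamma>1 R1) (tensor_model M lam2 \<alpha>2 \<beta>2 \<gamma>2 R2)"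
    and inj: "inj_on \<phi> (poly_span R1)"
    and nontrivial: "\<exists>\<rho>\<in>R1. \<exists>w. \<rho> w \<noteq> 0"
begin

abbreviation "act1 \<equiv> gen_act lam1 \<alpha>1 \<beta>1 \<gamma>1 M"
abbreviation "act2 \<equiv> gen_act lam2 \<alpha>2 \<beta>2 \<gamma>2 M"

lemma pure_mem: "\<rho> \<in> R1 \<Longrightarrow> pure \<rho> u \<in> poly_span R1"
  unfolding pure_def by (rule poly_span_pure)

lemma hom_mem: "G \<in> poly_span R1 \<Longrightarrow> \<phi> G \<in> poly_span R2"
  and hom_add: "G \<in> poly_span R1 \<Longrightarrow> H \<in> poly_span R1 \<Longrightarrow> \<phi> (\<lambda>w. G w + H w) w = \<phi> G w + \<phi> H w"
  and hom_smult: "G \<in> poly_span R1 \<Longrightarrow> \<phi> (\<lambda>w. const2 c * G w) w = const2 c * \<phi> G w"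
  using hom by (auto simp: lie_hom_def tensor_model_def)

lemma hom_act: "G \<in> poly_span R1 \<Longrightarrow>
    \<phi> (\<lambda>w. act1 a (G w) + G (w @ [a])) w = act2 a (\<phi> G w) + \<phi> G (w @ [a])"
proof -
  assume G: "G \<in> poly_span R1"
  have "\<phi> (act (tensor_model M lam1 \<alpha>1 \<beta>1 \<gamma>1 R1) (basis_vec a) G) =
    act (tensor_model M lam2 \<alpha>2 \<beta>2 \<gamma>2 R2) (basis_vec a) (\<phi> G)"
    using hom G unfolding lie_hom_def by (simp add: tensor_model_def del: eval_poly2_single)
  then show ?thesis by (simp add: tensor_model_def fun_eq_iff)
qed

lemma hom_pure_add: "\<rho> \<in> R1 \<Longrightarrow> \<phi> (pure \<rho> (u + v)) w = \<phi> (pure \<rho> u) w + \<phi> (pure \<rho> v) w"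
  using hom_add[OF pure_mem pure_mem, of \<rho> \<rho> u v w] by (simp add: pure_def distrib_left)

lemma hom_pure_smult: "\<rho> \<in> R1 \<Longrightarrow> \<phi> (pure \<rho> (const2 c * u)) w = const2 c * \<phi> (pure \<rho> u) w"
  using hom_smult[OF pure_mem, of \<rho> c u w] by (simp add: pure_def mult.left_commute)

lemma hom_zero_iff: "G \<in> poly_span R1 \<Longrightarrow> (\<forall>w. \<phi> G w = 0) \<longleftrightarrow> (\<forall>w. G w = 0)"
proof -
  assume G: "G \<in> poly_span R1"
  have 0: "\<phi> (\<lambda>_. 0) = (\<lambda>_. 0)" using hom_smult[OF G, of 0] by (auto simp: fun_eq_iff)
  have "(\<forall>w. \<phi> G w = 0) \<longleftrightarrow> \<phi> G = \<phi> (\<lambda>_. 0)" unfolding 0 by (auto simp: fun_eq_iff)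
  also have "\<dots> \<longleftrightarrow> G = (\<lambda>_. 0)" using inj G by (auto simp: inj_on_eq_iff poly_span.zero)
  finally show ?thesis by (auto simp: fun_eq_iff)
qed

text \<open>
  For generators of large index the second tensor factors are annihilated, in the source and in the
  target.
\<close>

lemma hom_large_index:
  assumes "\<rho> \<in> R1"
  shows "\<exists>K. \<forall>a. K \<le> index a \<longrightarrow> (\<forall>w. \<phi> (pure \<rho> (act1 a u)) w = act2 a (\<phi> (pure \<rho> u) w))"
proof -
  obtain K where K: "\<And>a w. K \<le> index a \<Longrightarrow> pure \<rho> u (w @ [a]) = 0"
    using smooth_poly_span[OF R1(2) pure_mem[OF assms]] by blast
  obtain L where L: "\<And>a w. L \<le> index a \<Longrightarrow> \<phi> (pure \<rho> u) (w @ [a]) = 0"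
    using smooth_poly_span[OF R2(2) hom_mem[OF pure_mem[OF assms]]] by blast
  show ?thesis
  proof (intro exI[of _ "max K L"] allI impI)
    fix a w assume "max K L \<le> index a"
    then have a: "K \<le> index a" "L \<le> index a" by auto
    have "(\<lambda>w. act1 a (pure \<rho> u w) + pure \<rho> u (w @ [a])) = pure \<rho> (act1 a u)"
      unfolding K[OF a(1)] by (simp add: pure_def gen_act_const2_mult)
    then show "\<phi> (pure \<rho> (act1 a u)) w = act2 a (\<phi> (pure \<rho> u) w)"
      using hom_act[OF pure_mem[OF assms], of a u w] by (simp add: L[OF a(2)])
  qed
qed

lemma hom_large:
  assumes "\<rho> \<in> R1"
  obtains K where "\<And>m w. K \<le> m \<Longrightarrow> \<phi> (pure \<rho> (act1 (Egen m) u)) w = act2 (Egen m) (\<phi> (pure \<rho> u) w)"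
    "\<And>m w. K \<le> m \<Longrightarrow> \<phi> (pure \<rho> (act1 (Fgen m) u)) w = act2 (Fgen m) (\<phi> (pure \<rho> u) w)"
    "\<And>m w. K \<le> m \<Longrightarrow> \<phi> (pure \<rho> (act1 (Hgen m) u)) w = act2 (Hgen m) (\<phi> (pure \<rho> u) w)"
    "\<And>m w. K \<le> m \<Longrightarrow> \<phi> (pure \<rho> (act1 (Dgen m) u)) w = act2 (Dgen m) (\<phi> (pure \<rho> u) w)"
proof -
  obtain K where K: "\<And>a w. K \<le> index a \<Longrightarrow> \<phi> (pure \<rho> (act1 a u)) w = act2 a (\<phi> (pure \<rho> u) w)"
    using hom_large_index[OF assms, of u] by blast
  show thesis by (rule that[of K]) (rule K, simp)+
qed

lemma hom_h_one:
  assumes \<rho>: "\<rho> \<in> R1" and w: "\<phi> (pure \<rho> 1) w \<noteq> 0"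
  shows "lam1 = lam2" "degree (\<phi> (pure \<rho> 1) w) = 0"
proof -
  obtain K where K: "\<And>m w. K \<le> m \<Longrightarrow> \<phi> (pure \<rho> (act1 (Hgen m) 1)) w = act2 (Hgen m) (\<phi> (pure \<rho> 1) w)"
    using hom_large[OF \<rho>, of 1] by metis
  have "const2 (lam1 powi m) * \<phi> (pure \<rho> t_var) w =
      const2 (lam2 powi m) * (t_var * shift m 0 (\<phi> (pure \<rho> 1) w))" if "K \<le> m" for m
    using K[OF that, of w] by (simp add: hom_pure_smult[OF \<rho>] mult.assoc)
  from exponential_shift_poly[OF nonzero(1,2) w this] show "lam1 = lam2" "degree (\<phi> (pure \<rho> 1) w) = 0" by auto
qed

lemma hom_one_nonzero:
  assumes "\<rho> \<in> R1" "\<rho> w0 \<noteq> 0" obtains w where "\<phi> (pure \<rho> 1) w \<noteq> 0"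
  using hom_zero_iff[OF pure_mem[OF assms(1), of 1]] assms(2) by (auto simp: pure_def)

lemma lam: "lam1 = lam2"
proof -
  obtain \<rho> w0 where \<rho>: "\<rho> \<in> R1" "\<rho> w0 \<noteq> 0" using nontrivial by blast
  obtain w where "\<phi> (pure \<rho> 1) w \<noteq> 0" by (rule hom_one_nonzero[OF \<rho>])
  then show ?thesis by (rule hom_h_one(1)[OF \<rho>(1)])
qed

lemma hom_one_s_free: "\<rho> \<in> R1 \<Longrightarrow> \<exists>p. \<phi> (pure \<rho> 1) w = [:p:]"
proof -
  assume \<rho>: "\<rho> \<in> R1"
  have "degree (\<phi> (pure \<rho> 1) w) = 0"
    using hom_h_one(2)[OF \<rho>, of w] by (cases "\<phi> (pure \<rho> 1) w = 0") simp_all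
  then obtain p where "\<phi> (pure \<rho> 1) w = [:p:]" by (rule degree_zero_poly2)
  then show ?thesis by blast
qed

text \<open>
  On tensors that are free of \<open>s\<close>, multiplication by \<open>t\<close> is \<open>h\<^sub>m\<close> up to the scalar \<open>\<lambda>\<^sup>m\<close>, for large \<open>m\<close>.
\<close>

lemma hom_t_mult:
  assumes \<rho>: "\<rho> \<in> R1" and u: "u = [:p:]" and G: "\<And>w. \<exists>q. \<phi> (pure \<rho> u) w = [:q:]"
  shows "\<phi> (pure \<rho> (t_var * u)) w = t_var * \<phi> (pure \<rho> u) w"
proof -
  obtain K where K: "\<And>m w. K \<le> m \<Longrightarrow> \<phi> (pure \<rho> (act1 (Hgen m) u)) w = act2 (Hgen m) (\<phi> (pure \<rho> u) w)"
    using hom_large[OF \<rho>, of u] by metis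
  obtain q where q: "\<phi> (pure \<rho> u) w = [:q:]" using G by blast
  have "shift K 0 u = u" "shift K 0 [:q:] = [:q:]" using u by (simp_all add: shift_zero_pcompose)
  then have "const2 (lam1 powi K) * \<phi> (pure \<rho> (t_var * u)) w = const2 (lam1 powi K) * (t_var * \<phi> (pure \<rho> u) w)"
    using K[of K w] q lam by (simp add: hom_pure_smult[OF \<rho>] mult.assoc)
  then show ?thesis using nonzero by simp
qed

lemma const2_mult_const: "const2 c * [:p:] = [:smult c p:]"
  by (simp add: const2_def)

text \<open>
  For \<open>\<Omega>\<close> and \<open>\<Delta>\<close> one of \<open>e\<^sub>m\<close>, \<open>f\<^sub>m\<close> acts on \<open>1\<close> by a scalar, and a single relation suffices. For \<open>\<Theta>\<close>
  both operators are combined.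
\<close>

lemma alpha_and_constancy:
  assumes \<rho>: "\<rho> \<in> R1" and w: "\<phi> (pure \<rho> 1) w = [:p:]" "p \<noteq> 0"
  shows "\<alpha>1 = \<alpha>2" "degree p = 0" "M = Theta \<Longrightarrow> \<beta>1 = \<beta>2"
proof -
  obtain K where K: "\<And>m w. K \<le> m \<Longrightarrow> \<phi> (pure \<rho> (act1 (Egen m) 1)) w = act2 (Egen m) (\<phi> (pure \<rho> 1) w)"
    "\<And>m w. K \<le> m \<Longrightarrow> \<phi> (pure \<rho> (act1 (Fgen m) 1)) w = act2 (Fgen m) (\<phi> (pure \<rho> 1) w)"
    using hom_large[OF \<rho>, of 1] by metis
  have k: "const2 (lam1 powi K) \<noteq> 0" using nonzero by simp
  have cancel: "g = h" if "const2 (lam1 powi K) * g = const2 (lam1 powi K) * h" for g h :: poly2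
    using that mult_left_cancel[OF k] by blast
  have "\<alpha>1 = \<alpha>2 \<and> degree p = 0 \<and> (M = Theta \<longrightarrow> \<beta>1 = \<beta>2)"
  proof (cases M)
    case Omega
    have "const2 \<alpha>1 * [:p:] = const2 \<alpha>2 * shift K (-2) [:p:]"
      using K(1)[of K w] w
      by - (rule cancel, simp only: Omega gen_act_factor hom_pure_smult[OF \<rho>] shift_one lam order_refl)
    then have "smult \<alpha>1 p = smult \<alpha>2 (pcompose p [:-2, 1:])"
      unfolding shift_const const2_mult_const pCons_eq_iff by (rule conjunct1)
    from scaled_shift_poly[OF w(2) _ this] show ?thesis using Omega nonzero by simp
  next
    case Delta
    have "const2 \<alpha>1 * [:p:] = const2 \<alpha>2 * shift K 2 [:p:]"
      using K(2)[of K w] w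
      by - (rule cancel, simp only: Delta gen_act_factor hom_pure_smult[OF \<rho>] shift_one lam order_refl)
    then have "smult \<alpha>1 p = smult \<alpha>2 (pcompose p [:2, 1:])"
      unfolding shift_const const2_mult_const pCons_eq_iff by (rule conjunct1)
    from scaled_shift_poly[OF w(2) _ this] show ?thesis using Delta nonzero by simp
  next
    case Theta
    have "\<phi> (pure \<rho> (t_var * 1)) w = t_var * \<phi> (pure \<rho> 1) w"
      by (rule hom_t_mult[OF \<rho> one_pCons]) (rule hom_one_s_free[OF \<rho>])
    then have t: "\<phi> (pure \<rho> t_var) w = t_var * [:p:]" unfolding w(1) mult_1_right .
    have lin: "\<phi> (pure \<rho> ((const2 (1/2) * t_var + const2 c) * 1)) w = (const2 (1/2) * t_var + const2 c) * [:p:]" for c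
      using hom_pure_smult[OF \<rho>, of c 1 w] hom_pure_smult[OF \<rho>, of "1/2" t_var w]
      by (simp only: mult_1_right hom_pure_add[OF \<rho>] t w(1) distrib_right mult.assoc)
    have lin': "(const2 (1/2) * t_var + const2 c) * [:q:] = [:[:c, 1/2:] * q:]" for c q
      by (simp add: t_var_def const2_def)
    have "const2 \<alpha>1 * ((const2 (1/2) * t_var + const2 \<beta>1) * [:p:]) =
       const2 \<alpha>2 * ((const2 (1/2) * t_var + const2 \<beta>2) * shift K (-2) [:p:])"
      using K(1)[of K w] w
      by - (rule cancel, simp only: Theta gen_act_factor hom_pure_smult[OF \<rho>] shift_one lam order_refl lin)
    then have e: "smult \<alpha>1 ([:\<beta>1, 1/2:] * p) = smult \<alpha>2 ([:\<beta>2, 1/2:] * pcompose p [:-2, 1:])"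
      unfolding shift_const lin' const2_mult_const pCons_eq_iff by (rule conjunct1)
    have "const2 (- (1 / \<alpha>1)) * ((const2 (1/2) * t_var + const2 (- \<beta>1)) * [:p:]) =
       const2 (- (1 / \<alpha>2)) * ((const2 (1/2) * t_var + const2 (- \<beta>2)) * shift K 2 [:p:])"
      using K(2)[of K w] w
      by - (rule cancel, simp only: Theta gen_act_factor hom_pure_smult[OF \<rho>] shift_one lam order_refl lin)
    then have f: "smult (1 / \<alpha>1) ([:- \<beta>1, 1/2:] * p) = smult (1 / \<alpha>2) ([:- \<beta>2, 1/2:] * pcompose p [:2, 1:])"
      unfolding shift_const lin' const2_mult_const pCons_eq_iff smult_minus_left neg_equal_iff_equal
      by (rule conjunct1)
    from theta_shift_poly[OF w(2) nonzero(3,4) e f theta[OF Theta]] show ?thesis by simp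
  qed
  then show "\<alpha>1 = \<alpha>2" "degree p = 0" "M = Theta \<Longrightarrow> \<beta>1 = \<beta>2" by auto
qed

text \<open>
  The map \<open>\<tau>\<close> with \<open>\<phi>(1 \<otimes> \<rho>) = 1 \<otimes> \<tau>(\<rho>)\<close>, read off from the constant coefficient.
\<close>

definition top_part :: "(gen list \<Rightarrow> complex) \<Rightarrow> gen list \<Rightarrow> complex" where
  "top_part \<rho> w = coeff (coeff (\<phi> (pure \<rho> 1) w) 0) 0"

lemma top_part_mem: "\<rho> \<in> R1 \<Longrightarrow> top_part \<rho> \<in> R2"
  unfolding top_part_def by (intro coeff_poly_span R2 hom_mem pure_mem)

lemma hom_one: "\<rho> \<in> R1 \<Longrightarrow> \<phi> (pure \<rho> 1) w = const2 (top_part \<rho> w)"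
proof -
  assume \<rho>: "\<rho> \<in> R1"
  obtain p where p: "\<phi> (pure \<rho> 1) w = [:p:]" using hom_one_s_free[OF \<rho>] by blast
  then have "degree p = 0" using alpha_and_constancy(2)[OF \<rho> p] by (cases "p = 0") auto
  then obtain c where "p = [:c:]" by (rule degree_eq_zeroE)
  then show ?thesis by (simp add: p top_part_def const2_def)
qed

lemma top_part_nonzero: "\<rho> \<in> R1 \<Longrightarrow> \<rho> w \<noteq> 0 \<Longrightarrow> \<exists>w. top_part \<rho> w \<noteq> 0"
proof -
  assume \<rho>: "\<rho> \<in> R1" "\<rho> w \<noteq> 0"
  obtain w' where "\<phi> (pure \<rho> 1) w' \<noteq> 0" by (rule hom_one_nonzero[OF \<rho>])
  then show ?thesis unfolding hom_one[OF \<rho>(1)] by auto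
qed

lemma alpha: "\<alpha>1 = \<alpha>2" and theta_beta: "M = Theta \<Longrightarrow> \<beta>1 = \<beta>2"
proof -
  obtain \<rho> w0 where \<rho>: "\<rho> \<in> R1" "\<rho> w0 \<noteq> 0" using nontrivial by blast
  obtain w where w: "top_part \<rho> w \<noteq> 0" using top_part_nonzero[OF \<rho>] by blast
  have "\<phi> (pure \<rho> 1) w = [:[:top_part \<rho> w:]:]" using hom_one[OF \<rho>(1)] by (simp add: const2_def)
  from alpha_and_constancy[OF \<rho>(1) this] w show "\<alpha>1 = \<alpha>2" "M = Theta \<Longrightarrow> \<beta>1 = \<beta>2" by auto
qed

text \<open>
  This says that \<open>\<phi>(u \<otimes> \<rho>) = u \<otimes> \<tau>(\<rho>)\<close>. The property propagates from \<open>u = 1\<close> to all polynomials \<open>x \<cdot> 1\<close> with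
  a generator \<open>x\<close>, which is what equivariance of \<open>\<tau>\<close> requires.
\<close>

definition transported :: "(gen list \<Rightarrow> complex) \<Rightarrow> poly2 \<Rightarrow> bool" where
  "transported \<rho> u \<longleftrightarrow> (\<forall>w. \<phi> (pure \<rho> u) w = const2 (top_part \<rho> w) * u)"

lemma transported_one: "\<rho> \<in> R1 \<Longrightarrow> transported \<rho> 1"
  by (simp add: transported_def hom_one)

lemma transported_add: "\<rho> \<in> R1 \<Longrightarrow> transported \<rho> u \<Longrightarrow> transported \<rho> v \<Longrightarrow> transported \<rho> (u + v)"
  by (simp add: transported_def hom_pure_add distrib_left)

lemma transported_const2: "\<rho> \<in> R1 \<Longrightarrow> transported \<rho> u \<Longrightarrow> transported \<rho> (const2 c * u)"
  by (simp add: transported_def hom_pure_smult mult.left_commute)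

lemma transported_t_var:
  assumes \<rho>: "\<rho> \<in> R1" and u: "transported \<rho> u" "degree u = 0"
  shows "transported \<rho> (t_var * u)"
proof -
  obtain p where p: "u = [:p:]" using u(2) by (rule degree_zero_poly2)
  have "\<exists>q. \<phi> (pure \<rho> u) w = [:q:]" for w
  proof -
    have "\<phi> (pure \<rho> u) w = const2 (top_part \<rho> w) * [:p:]" using u(1) by (simp only: transported_def p)
    then show ?thesis unfolding const2_mult_const by blast
  qed
  from hom_t_mult[OF \<rho> p this] show ?thesis
    using u by (simp add: transported_def mult.left_commute)
qed

definition s_free_transported :: "(gen list \<Rightarrow> complex) \<Rightarrow> poly2 \<Rightarrow> bool" where
  "s_free_transported \<rho> u \<longleftrightarrow> degree u = 0 \<and> transported \<rho> u"

lemma s_free_transported_intros: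
  assumes \<rho>: "\<rho> \<in> R1"
  shows "s_free_transported \<rho> 1"
    and "s_free_transported \<rho> u \<Longrightarrow> s_free_transported \<rho> (const2 c * u)"
    and "s_free_transported \<rho> u \<Longrightarrow> s_free_transported \<rho> (t_var * u)"
    and "s_free_transported \<rho> u \<Longrightarrow> s_free_transported \<rho> ((const2 a * t_var + const2 b) * u)"
proof -
  show one: "s_free_transported \<rho> 1" using transported_one[OF \<rho>] by (simp add: s_free_transported_def)
  have deg: "degree (const2 c * u) = 0" "degree (t_var * u) = 0" if d: "degree u = 0" for c u
  proof -
    obtain p where "u = [:p:]" using d by (rule degree_zero_poly2)
    then show "degree (const2 c * u) = 0" "degree (t_var * u) = 0" by (simp_all add: const2_def t_var_def)
  qed
  show const: "s_free_transported \<rho> u \<Longrightarrow> s_free_transported \<rho> (const2 c * u)" for c u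
    using transported_const2[OF \<rho>] by (auto simp: s_free_transported_def deg)
  show t: "s_free_transported \<rho> u \<Longrightarrow> s_free_transported \<rho> (t_var * u)" for u
    using transported_t_var[OF \<rho>] by (auto simp: s_free_transported_def deg)
  show "s_free_transported \<rho> u \<Longrightarrow> s_free_transported \<rho> ((const2 a * t_var + const2 b) * u)"
  proof -
    assume u: "s_free_transported \<rho> u"
    have "degree (const2 a * (t_var * u) + const2 b * u) \<le> 0"
      using const[OF t[OF u], of a] const[OF u, of b] by (intro degree_add_le) (auto simp: s_free_transported_def)
    moreover have "transported \<rho> (const2 a * (t_var * u) + const2 b * u)"
      using const[OF t[OF u], of a] const[OF u, of b] by (intro transported_add \<rho>) (auto simp: s_free_transported_def)
    ultimately show ?thesis by (simp add: s_free_transported_def distrib_right mult.assoc)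
  qed
qed

lemma transported_act_one:
  assumes \<rho>: "\<rho> \<in> R1" and a: "\<And>m. a \<noteq> Dgen m"
  shows "transported \<rho> (act1 a 1)"
proof -
  note intros = s_free_transported_intros[OF \<rho>]
  have "s_free_transported \<rho> (act1 a 1)"
  proof (cases a)
    case (Hgen m)
    then show ?thesis unfolding Hgen gen_act_factor shift_one by (intro intros)
  next
    case Cgen
    then show ?thesis using intros(2)[OF intros(1), of 0] by simp
  next
    case (Egen m)
    show ?thesis unfolding Egen
      by (cases M; hypsubst; unfold gen_act_factor shift_one; intro intros)
  next
    case (Fgen m)
    show ?thesis unfolding Fgen
      by (cases M; hypsubst; unfold gen_act_factor shift_one; intro intros)
  qed (use a in simp)
  then show ?thesis by (simp add: s_free_transported_def)
qed

text \<open>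
  Both sides give \<open>\<phi>(x1 \<otimes> \<rho>)\<close> after tensoring with \<open>\<tau>(\<rho>)\<close>: the left one since \<open>x1\<close> is transported, the right
  one since \<open>x\<close> has large index.
\<close>

lemma act_one_eq_large:
  "\<exists>K. \<forall>a. K \<le> index a \<longrightarrow> (\<forall>m. a \<noteq> Dgen m) \<longrightarrow> act1 a 1 = act2 a 1"
proof -
  obtain \<rho> w0 where \<rho>: "\<rho> \<in> R1" "\<rho> w0 \<noteq> 0" using nontrivial by blast
  obtain w where w: "top_part \<rho> w \<noteq> 0" using top_part_nonzero[OF \<rho>] by blast
  obtain K where K: "\<And>a. K \<le> index a \<Longrightarrow> \<phi> (pure \<rho> (act1 a 1)) w = act2 a (\<phi> (pure \<rho> 1) w)"
    using hom_large_index[OF \<rho>(1), of 1] by blast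
  have "act1 a 1 = act2 a 1" if "K \<le> index a" "\<And>m. a \<noteq> Dgen m" for a
  proof -
    have "const2 (top_part \<rho> w) * act1 a 1 = const2 (top_part \<rho> w) * act2 a 1"
      using K[OF that(1)] transported_act_one[OF \<rho>(1) that(2)]
        gen_act_const2_mult[of lam2 \<alpha>2 \<beta>2 \<gamma>2 M a "top_part \<rho> w" 1]
      by (simp add: transported_def hom_one[OF \<rho>(1)])
    then show ?thesis using w by simp
  qed
  then show ?thesis by blast
qed

text \<open>
  For large \<open>m\<close> the operator \<open>d\<^sub>m\<close> sends \<open>1\<close> to \<open>\<lambda>\<^sup>m(s + m\<gamma>)\<close>. Taking the difference of two consecutive \<open>m\<close>
  isolates \<open>\<gamma>\<close>, and the rest is the statement about \<open>s\<close>.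
\<close>

lemma s_linear_coefficients:
  assumes \<rho>: "\<rho> \<in> R1"
  shows "\<gamma>1 = \<gamma>2 \<or> top_part \<rho> w = 0" "transported \<rho> s_var"
proof -
  obtain K where K: "\<And>m w. K \<le> m \<Longrightarrow> \<phi> (pure \<rho> (act1 (Dgen m) 1)) w = act2 (Dgen m) (\<phi> (pure \<rho> 1) w)"
    using hom_large[OF \<rho>, of 1] by metis
  have D: "\<phi> (pure \<rho> s_var) w + const2 (of_int m * \<gamma>1) * const2 (top_part \<rho> w) =
    (s_var + const2 (of_int m * \<gamma>2)) * const2 (top_part \<rho> w)" if "K \<le> m" for m w
  proof -
    have k: "const2 (lam2 powi m) \<noteq> 0" using nonzero by simp
    have sh: "shift m 0 (const2 c) = const2 c" for c using shift_const2_mult[of m 0 c 1] by simp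
    have "const2 (lam2 powi m) * (\<phi> (pure \<rho> s_var) w + const2 (of_int m * \<gamma>1) * const2 (top_part \<rho> w)) =
      \<phi> (pure \<rho> (act1 (Dgen m) 1)) w"
      using hom_pure_smult[OF \<rho>, of "of_int m * \<gamma>1" 1 w]
      unfolding gen_act_factor shift_one hom_pure_smult[OF \<rho>] lam mult_1_right hom_pure_add[OF \<rho>] hom_one[OF \<rho>] by simp
    also have "\<dots> = act2 (Dgen m) (const2 (top_part \<rho> w))"
      unfolding K[OF that] hom_one[OF \<rho>] ..
    also have "\<dots> = const2 (lam2 powi m) * ((s_var + const2 (of_int m * \<gamma>2)) * const2 (top_part \<rho> w))"
      unfolding gen_act_factor sh ..
    finally show ?thesis using mult_left_cancel[OF k] by blast
  qed
  have "const2 (\<gamma>1 * top_part \<rho> w) = const2 (\<gamma>2 * top_part \<rho> w)" for w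
  proof -
    have cancel: "b = d" if "f + a = g + c" "f + (a + b) = g + (c + d)" for a b c d f g :: poly2
      using that by (metis add.assoc add_left_cancel)
    have "const2 (of_int (K + 1) * \<gamma>) = const2 (of_int K * \<gamma>) + const2 \<gamma>" for \<gamma>
      by (simp add: distrib_right)
    then show ?thesis
      using cancel[of "\<phi> (pure \<rho> s_var) w" "const2 (of_int K * \<gamma>1) * const2 (top_part \<rho> w)" "s_var * const2 (top_part \<rho> w)"
          "const2 (of_int K * \<gamma>2) * const2 (top_part \<rho> w)" "const2 \<gamma>1 * const2 (top_part \<rho> w)" "const2 \<gamma>2 * const2 (top_part \<rho> w)"]
        D[of K w] D[of "K + 1" w] by (simp only: distrib_right const2_simps(4))
  qed
  then have g: "\<gamma>1 * top_part \<rho> w = \<gamma>2 * top_part \<rho> w" for w by (simp only: const2_def pCons_eq_iff)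
  show "\<gamma>1 = \<gamma>2 \<or> top_part \<rho> w = 0" using g[of w] by auto
  show "transported \<rho> s_var"
    unfolding transported_def
  proof
    fix w
    have "const2 (of_int K * \<gamma>1) * const2 (top_part \<rho> w) = const2 (of_int K * \<gamma>2) * const2 (top_part \<rho> w)"
      using g[of w] by auto
    then have "\<phi> (pure \<rho> s_var) w = s_var * const2 (top_part \<rho> w)"
      using D[OF order_refl, of w] by (simp only: distrib_right add_right_cancel)
    then show "\<phi> (pure \<rho> s_var) w = const2 (top_part \<rho> w) * s_var" by (simp only: mult.commute)
  qed
qed

lemma gamma: "\<gamma>1 = \<gamma>2"
proof -
  obtain \<rho> w0 where \<rho>: "\<rho> \<in> R1" "\<rho> w0 \<noteq> 0" using nontrivial by blast
  obtain w where w: "top_part \<rho> w \<noteq> 0" using top_part_nonzero[OF \<rho>] by blast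
  show ?thesis using s_linear_coefficients(1)[OF \<rho>(1), of w] w by blast
qed

text \<open>
  For \<open>\<Omega>\<close> and \<open>\<Delta>\<close> the parameter \<open>\<beta>\<close> occurs only in a quadratic polynomial in \<open>t\<close>, by which \<open>f\<^sub>m\<close> or \<open>e\<^sub>m\<close>
  multiplies. One large index determines this polynomial, hence the action of all generators; \<open>\<beta>\<close> itself
  is determined only up to \<open>\<beta> \<mapsto> -1 - \<beta>\<close>.
\<close>

lemma act_eq: "act1 = act2"
proof (rule ext, rule ext)
  fix a g
  obtain K where K: "\<And>a. K \<le> index a \<Longrightarrow> (\<And>m. a \<noteq> Dgen m) \<Longrightarrow> act1 a 1 = act2 a 1"
    using act_one_eq_large by blast
  have KEF: "act1 (Egen K) 1 = act2 (Egen K) 1" "act1 (Fgen K) 1 = act2 (Fgen K) 1"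
    by (rule K; simp)+
  have k: "const2 (lam2 powi K) \<noteq> 0" "const2 (- (1 / \<alpha>2)) \<noteq> 0" using nonzero by simp_all
  have cancel: "p = q" if "const2 (lam2 powi K) * (const2 (- (1 / \<alpha>2)) * p) = const2 (lam2 powi K) * (const2 (- (1 / \<alpha>2)) * q)"
    for p q using that mult_left_cancel[OF k(1)] mult_left_cancel[OF k(2)] by blast
  show "act1 a g = act2 a g"
  proof (cases "a = Cgen \<or> (\<exists>m. a = Hgen m \<or> a = Dgen m)")
    case True
    then show ?thesis unfolding lam gamma by auto
  next
    case False
    then obtain m where a: "a = Egen m \<or> a = Fgen m" by (cases a) auto
    show ?thesis
    proof (cases M)
      case Omega
      have "(const2 (1/2) * t_var + const2 (- \<beta>1)) * ((const2 (1/2) * t_var + const2 (\<beta>1 + 1)) * 1) =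
        (const2 (1/2) * t_var + const2 (- \<beta>2)) * ((const2 (1/2) * t_var + const2 (\<beta>2 + 1)) * 1)"
        using KEF(2) by - (rule cancel, simp only: Omega gen_act_factor shift_one lam alpha)
      then have "((const2 (1/2) * t_var + const2 (- \<beta>1)) * (const2 (1/2) * t_var + const2 (\<beta>1 + 1))) * h =
        ((const2 (1/2) * t_var + const2 (- \<beta>2)) * (const2 (1/2) * t_var + const2 (\<beta>2 + 1))) * h" for h
        unfolding mult_1_right by (rule arg_cong)
      note eq = this[unfolded mult.assoc]
      from a show ?thesis
      proof
        assume "a = Egen m"
        then show ?thesis by (simp only: Omega gen_act_factor lam alpha)
      next
        assume "a = Fgen m"
        then show ?thesis by (simp only: Omega gen_act_factor lam alpha eq)
      qed
    next
      case Delta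
      have "(const2 (1/2) * t_var + const2 \<beta>1) * ((const2 (1/2) * t_var + const2 (- \<beta>1 - 1)) * 1) =
        (const2 (1/2) * t_var + const2 \<beta>2) * ((const2 (1/2) * t_var + const2 (- \<beta>2 - 1)) * 1)"
        using KEF(1) by - (rule cancel, simp only: Delta gen_act_factor shift_one lam alpha)
      then have "((const2 (1/2) * t_var + const2 \<beta>1) * (const2 (1/2) * t_var + const2 (- \<beta>1 - 1))) * h =
        ((const2 (1/2) * t_var + const2 \<beta>2) * (const2 (1/2) * t_var + const2 (- \<beta>2 - 1))) * h" for h
        unfolding mult_1_right by (rule arg_cong)
      note eq = this[unfolded mult.assoc]
      from a show ?thesis
      proof
        assume "a = Egen m"
        then show ?thesis by (simp only: Delta gen_act_factor lam alpha eq)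
      next
        assume "a = Fgen m"
        then show ?thesis by (simp only: Delta gen_act_factor lam alpha)
      qed
    next
      case Theta
      show ?thesis unfolding lam gamma alpha theta_beta[OF Theta] ..
    qed
  qed
qed

lemma transported_act:
  assumes \<rho>: "\<rho> \<in> R1" shows "transported \<rho> (act1 a 1)"
proof (cases "\<exists>m. a = Dgen m")
  case True
  then obtain m where a: "a = Dgen m" by blast
  have "transported \<rho> (const2 (lam1 powi m) * (s_var + const2 (of_int m * \<gamma>1) * 1))"
    by (intro transported_const2 transported_add transported_one s_linear_coefficients(2) \<rho>)
  then show ?thesis unfolding a gen_act_factor by (simp only: shift_one mult_1_right)
qed (use transported_act_one[OF \<rho>] in blast)

text \<open>
  Equivariance of \<open>\<tau>\<close>: subtract \<open>\<phi>(x1 \<otimes> \<rho>) = x1 \<otimes> \<tau>(\<rho>)\<close> from the equivariance of \<open>\<phi>\<close> at \<open>1 \<otimes> \<rho>\<close>.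
\<close>

lemma top_part_shift: "\<rho> \<in> R1 \<Longrightarrow> top_part (\<lambda>w. \<rho> (w @ [a])) w = top_part \<rho> (w @ [a])"
proof -
  assume \<rho>: "\<rho> \<in> R1"
  then have \<rho>a: "(\<lambda>w. \<rho> (w @ [a])) \<in> R1" using R1(1) by (simp add: translation_closed_def)
  have "(\<lambda>w. act1 a (pure \<rho> 1 w) + pure \<rho> 1 (w @ [a])) =
    (\<lambda>w. pure \<rho> (act1 a 1) w + pure (\<lambda>w. \<rho> (w @ [a])) 1 w)"
    using gen_act_const2_mult[of lam1 \<alpha>1 \<beta>1 \<gamma>1 M a _ 1] by (simp add: pure_def)
  then have "\<phi> (pure \<rho> (act1 a 1)) w + \<phi> (pure (\<lambda>w. \<rho> (w @ [a])) 1) w =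
    act2 a (\<phi> (pure \<rho> 1) w) + \<phi> (pure \<rho> 1) (w @ [a])"
    using hom_act[OF pure_mem[OF \<rho>], of a 1 w] hom_add[OF pure_mem[OF \<rho>] pure_mem[OF \<rho>a], of "act1 a 1" 1 w] by simp
  then have "const2 (top_part (\<lambda>w. \<rho> (w @ [a])) w) = const2 (top_part \<rho> (w @ [a]))"
    using transported_act[OF \<rho>, of a] gen_act_const2_mult[of lam2 \<alpha>2 \<beta>2 \<gamma>2 M a "top_part \<rho> w" 1]
    by (simp add: transported_def hom_one[OF \<rho>] hom_one[OF \<rho>a] act_eq)
  then show ?thesis by (simp only: const2_def pCons_eq_iff)
qed

lemma top_part_add: "\<rho> \<in> R1 \<Longrightarrow> \<sigma> \<in> R1 \<Longrightarrow> top_part (\<lambda>w. \<rho> w + \<sigma> w) w = top_part \<rho> w + top_part \<sigma> w"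
  using hom_add[OF pure_mem pure_mem, of \<rho> \<sigma> 1 1 w] by (simp add: top_part_def pure_def)

lemma top_part_smult: "\<rho> \<in> R1 \<Longrightarrow> top_part (\<lambda>w. c * \<rho> w) w = c * top_part \<rho> w"
  using hom_smult[OF pure_mem, of \<rho> c 1 w] by (simp add: top_part_def pure_def)

lemma top_part_act:
  assumes \<rho>: "\<rho> \<in> R1"
  shows "top_part (\<lambda>w. evalf (\<lambda>g. \<rho> (w @ [g])) x) w = evalf (\<lambda>g. top_part \<rho> (w @ [g])) x"
proof (induction x rule: poly_mapping_add_induct)
  case (single g c)
  have "(\<lambda>w. \<rho> (w @ [g])) \<in> R1" using R1(1) \<rho> by (simp add: translation_closed_def)
  from top_part_smult[OF this, of c w] show ?case by (simp add: top_part_shift[OF \<rho>])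
next
  case (add x y)
  from top_part_add[OF translation_closed_act[OF R1(1) \<rho>, of x] translation_closed_act[OF R1(1) \<rho>, of y], of w] add
  show ?case by simp
qed

lemma top_part_hom: "top_part \<in> lie_hom (function_module R1) (function_module R2)"
  using top_part_mem by (auto simp: lie_hom_def function_module_def top_part_add top_part_smult top_part_act)

lemma top_part_inj: "inj_on top_part R1"
proof (rule inj_onI)
  fix \<rho> \<sigma> assume \<rho>: "\<rho> \<in> R1" "\<sigma> \<in> R1" "top_part \<rho> = top_part \<sigma>"
  then have "\<phi> (pure \<rho> 1) = \<phi> (pure \<sigma> 1)" by (auto simp: hom_one)
  then have "pure \<rho> 1 = pure \<sigma> 1" using inj \<rho> pure_mem by (auto simp: inj_on_eq_iff)
  then show "\<rho> = \<sigma>" by (auto simp: pure_def fun_eq_iff const2_def)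
qed

end

text \<open>
  Surjectivity of \<open>\<tau>\<close> comes from the corresponding map of the inverse isomorphism.
\<close>

theorem tensor_model_rigidity:
  assumes nonzero: "lam1 \<noteq> 0" "lam2 \<noteq> 0" "\<alpha>1 \<noteq> 0" "\<alpha>2 \<noteq> 0"
    and theta: "M = Theta \<Longrightarrow> 2 * \<beta>1 \<notin> \<nat> \<and> 2 * \<beta>2 \<notin> \<nat>"
    and R1: "translation_closed R1" "smooth R1" "\<exists>\<rho>\<in>R1. \<exists>w. \<rho> w \<noteq> 0"
    and R2: "translation_closed R2" "smooth R2"
    and iso: "tensor_model M lam1 \<alpha>1 \<beta>1 \<gamma>1 R1 \<cong>\<^sub>L tensor_model M lam2 \<alpha>2 \<beta>2 \<gamma>2 R2"
  shows "poly_module M lam1 \<alpha>1 \<beta>1 \<gamma>1 = poly_module M lam2 \<alpha>2 \<beta>2 \<gamma>2"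
    and "function_module R1 \<cong>\<^sub>L function_module R2"
proof -
  obtain \<phi> where \<phi>: "\<phi> \<in> lie_iso (tensor_model M lam1 \<alpha>1 \<beta>1 \<gamma>1 R1) (tensor_model M lam2 \<alpha>2 \<beta>2 \<gamma>2 R2)"
    using iso by (auto simp: lie_isomorphic_def)
  have bij: "bij_betw \<phi> (poly_span R1) (poly_span R2)" using \<phi> by (simp add: lie_iso_def tensor_model_def)
  define \<psi> where "\<psi> = inv_into (poly_span R1) \<phi>"
  have \<psi>: "\<psi> \<in> lie_iso (tensor_model M lam2 \<alpha>2 \<beta>2 \<gamma>2 R2) (tensor_model M lam1 \<alpha>1 \<beta>1 \<gamma>1 R1)"
    using lie_iso_inv_into[OF linear_module_tensor_model[OF R1(1)] \<phi>] by (simp add: \<psi>_def tensor_model_def)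
  have hom: "\<chi> \<in> lie_hom L N" if "\<chi> \<in> lie_iso L N" for \<chi> :: "'x \<Rightarrow> 'y" and L N
    using that by (auto simp: lie_iso_def lie_hom_def bij_betw_def)
  interpret forward: tensor_embedding M lam1 lam2 \<alpha>1 \<alpha>2 \<beta>1 \<beta>2 \<gamma>1 \<gamma>2 R1 R2 \<phi>
    by unfold_locales (use nonzero theta R1 R2 hom[OF \<phi>] bij in \<open>auto simp: bij_betw_def\<close>)
  show "poly_module M lam1 \<alpha>1 \<beta>1 \<gamma>1 = poly_module M lam2 \<alpha>2 \<beta>2 \<gamma>2"
    using forward.act_eq by (simp add: poly_module_def)
  have R2': "\<exists>\<rho>\<in>R2. \<exists>w. \<rho> w \<noteq> 0"
    using R1(3) forward.top_part_nonzero forward.top_part_mem by blast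
  interpret backward: tensor_embedding M lam2 lam1 \<alpha>2 \<alpha>1 \<beta>2 \<beta>1 \<gamma>2 \<gamma>1 R2 R1 \<psi>
    by unfold_locales (use nonzero theta R1 R2 R2' hom[OF \<psi>] bij_betw_inv_into[OF bij] in \<open>auto simp: bij_betw_def \<psi>_def\<close>)
  have "\<sigma> \<in> forward.top_part ` R1" if \<sigma>: "\<sigma> \<in> R2" for \<sigma>
  proof (rule image_eqI)
    show mem: "backward.top_part \<sigma> \<in> R1" by (rule backward.top_part_mem[OF \<sigma>])
    have "\<psi> (pure \<sigma> 1) = pure (backward.top_part \<sigma>) 1"
      using backward.hom_one[OF \<sigma>] by (auto simp: pure_def)
    moreover have "\<phi> (\<psi> (pure \<sigma> 1)) = pure \<sigma> 1"
      unfolding \<psi>_def by (rule bij_betw_inv_into_right[OF bij backward.pure_mem[OF \<sigma>]])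
    ultimately have "pure (forward.top_part (backward.top_part \<sigma>)) 1 = pure \<sigma> 1"
      using forward.hom_one[OF mem] by (auto simp: pure_def)
    then show "\<sigma> = forward.top_part (backward.top_part \<sigma>)" by (auto simp: pure_def fun_eq_iff const2_def)
  qed
  then have "bij_betw forward.top_part R1 R2"
    using forward.top_part_inj forward.top_part_mem by (auto simp: bij_betw_def)
  then have "forward.top_part \<in> lie_iso (function_module R1) (function_module R2)"
    using forward.top_part_hom by (auto simp: lie_iso_def lie_hom_def function_module_def)
  then show "function_module R1 \<cong>\<^sub>L function_module R2" by (auto simp: lie_isomorphic_def)
qed

section \<open>The isomorphism criterion\<close>

text \<open>
  The one-dimensional trivial module as a space of functions: all nonempty words act by zero.
\<close>

definition trivial_functions :: "(gen list \<Rightarrow> complex) set" where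
  "trivial_functions = range (\<lambda>c w. if w = [] then c else 0)"

lemma trivial_functions:
  "translation_closed trivial_functions" "smooth trivial_functions" "\<exists>\<rho>\<in>trivial_functions. \<exists>w. \<rho> w \<noteq> 0"
proof -
  have mem: "\<rho> \<in> trivial_functions \<longleftrightarrow> (\<forall>w. w \<noteq> [] \<longrightarrow> \<rho> w = 0)" for \<rho>
    by (auto simp: trivial_functions_def fun_eq_iff image_iff)
  show "translation_closed trivial_functions" "smooth trivial_functions"
    by (auto simp: translation_closed_def smooth_def mem)
  show "\<exists>\<rho>\<in>trivial_functions. \<exists>w. \<rho> w \<noteq> 0"
    by (rule bexI[of _ "\<lambda>w. if w = [] then 1 else 0"]) (auto simp: mem)
qed

lemma poly_span_trivial: "poly_span trivial_functions = range (\<lambda>g w. if w = [] then g else 0)"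
proof
  show "poly_span trivial_functions \<subseteq> range (\<lambda>g w. if w = [] then g else 0)"
  proof
    fix G assume "G \<in> poly_span trivial_functions"
    then have "\<forall>w. w \<noteq> [] \<longrightarrow> G w = 0"
      by (induction rule: poly_span.induct) (auto simp: trivial_functions_def)
    then show "G \<in> range (\<lambda>g w. if w = [] then g else 0)"
      by (intro range_eqI[of _ _ "G []"]) auto
  qed
  have "(\<lambda>w. if w = [] then g else 0) \<in> poly_span trivial_functions" for g
  proof -
    have "(\<lambda>w. const2 (if w = [] then 1 else 0) * g) \<in> poly_span trivial_functions"
      by (rule poly_span_pure) (auto simp: trivial_functions_def)
    also have "(\<lambda>w. const2 (if w = [] then 1 else 0) * g) = (\<lambda>w. if w = [] then g else 0)" by auto
    finally show ?thesis .
  qed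
  then show "range (\<lambda>g w. if w = [] then g else 0) \<subseteq> poly_span trivial_functions" by auto
qed

lemma poly_module_tensor_model:
  "poly_module M lam \<alpha> \<beta> \<gamma> \<cong>\<^sub>L tensor_model M lam \<alpha> \<beta> \<gamma> trivial_functions"
proof -
  let ?\<psi> = "\<lambda>g (w :: gen list). if w = [] then g else (0 :: poly2)"
  have zero: "gen_act lam \<alpha> \<beta> \<gamma> M a 0 = 0" for a
    using gen_act_const2_mult[of lam \<alpha> \<beta> \<gamma> M a 0 0] by simp
  have "inj ?\<psi>" by (rule injI) (metis (full_types))
  then have "?\<psi> \<in> lie_iso (poly_module M lam \<alpha> \<beta> \<gamma>) (tensor_model M lam \<alpha> \<beta> \<gamma> trivial_functions)"
    by (auto simp: lie_iso_def tensor_model_def poly_span_trivial bij_betw_def zero eval_poly2_def fun_eq_iff)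
  then show ?thesis by (auto simp: lie_isomorphic_def)
qed

text \<open>
  A polynomial module is its tensor product with the trivial module, which is smooth and nonzero.
\<close>

lemma poly_module_rigidity:
  assumes "lam1 \<noteq> 0" "lam2 \<noteq> 0" "\<alpha>1 \<noteq> 0" "\<alpha>2 \<noteq> 0"
    and "M = Theta \<Longrightarrow> 2 * \<beta>1 \<notin> \<nat> \<and> 2 * \<beta>2 \<notin> \<nat>"
    and "poly_module M lam1 \<alpha>1 \<beta>1 \<gamma>1 \<cong>\<^sub>L poly_module M lam2 \<alpha>2 \<beta>2 \<gamma>2"
  shows "poly_module M lam1 \<alpha>1 \<beta>1 \<gamma>1 = poly_module M lam2 \<alpha>2 \<beta>2 \<gamma>2"
proof (rule tensor_model_rigidity(1)[OF assms(1-4) assms(5) trivial_functions trivial_functions(1,2)])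
  show "tensor_model M lam1 \<alpha>1 \<beta>1 \<gamma>1 trivial_functions \<cong>\<^sub>L tensor_model M lam2 \<alpha>2 \<beta>2 \<gamma>2 trivial_functions"
    by (rule lie_isomorphic_trans[OF lie_isomorphic_sym[OF linear_module_poly_module poly_module_tensor_model]
          lie_isomorphic_trans[OF assms(6) poly_module_tensor_model]])
qed

lemma tensor_irr_hw_isomorphic:
  assumes "irr_hw \<eta> \<epsilon> \<theta> \<cong>\<^sub>L function_module R" "translation_closed R"
  shows "poly_module M lam \<alpha> \<beta> \<gamma> \<otimes>\<^sub>L irr_hw \<eta> \<epsilon> \<theta> \<cong>\<^sub>L tensor_model M lam \<alpha> \<beta> \<gamma> R"
    and "linear_module (poly_module M lam \<alpha> \<beta> \<gamma> \<otimes>\<^sub>L irr_hw \<eta> \<epsilon> \<theta>)"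
proof -
  obtain r where "r \<in> lie_iso (irr_hw \<eta> \<epsilon> \<theta>) (function_module R)"
    using assms(1) by (auto simp: lie_isomorphic_def)
  then interpret tensor_factor M lam \<alpha> \<beta> \<gamma> "irr_hw \<eta> \<epsilon> \<theta>" R r
    by (intro tensor_factor.intro linear_module_irr_hw assms(2))
  show "poly_module M lam \<alpha> \<beta> \<gamma> \<otimes>\<^sub>L irr_hw \<eta> \<epsilon> \<theta> \<cong>\<^sub>L tensor_model M lam \<alpha> \<beta> \<gamma> R" by (rule tensor_isomorphic)
  show "linear_module (poly_module M lam \<alpha> \<beta> \<gamma> \<otimes>\<^sub>L irr_hw \<eta> \<epsilon> \<theta>)" by (rule linear_module_tensor)
qed

theorem theorem4p1:
  fixes M :: family
    and lam1 lam2 \<alpha>1 \<alpha>2 \<beta>1 \<beta>2 \<gamma>1 \<gamma>2 \<eta>1 \<eta>2 \<epsilon>1 \<epsilon>2 \<theta>1 \<theta>2 :: complex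
  assumes "lam1 \<noteq> 0" and "lam2 \<noteq> 0" and "\<alpha>1 \<noteq> 0" and "\<alpha>2 \<noteq> 0"
    and "M = Theta \<Longrightarrow> 2 * \<beta>1 \<notin> \<nat> \<and> 2 * \<beta>2 \<notin> \<nat>"
  shows "poly_module M lam1 \<alpha>1 \<beta>1 \<gamma>1 \<otimes>\<^sub>L irr_hw \<eta>1 \<epsilon>1 \<theta>1 \<cong>\<^sub>L
           poly_module M lam2 \<alpha>2 \<beta>2 \<gamma>2 \<otimes>\<^sub>L irr_hw \<eta>2 \<epsilon>2 \<theta>2
         \<longleftrightarrow> poly_module M lam1 \<alpha>1 \<beta>1 \<gamma>1 \<cong>\<^sub>L poly_module M lam2 \<alpha>2 \<beta>2 \<gamma>2 \<and>
             irr_hw \<eta>1 \<epsilon>1 \<theta>1 \<cong>\<^sub>L irr_hw \<eta>2 \<epsilon>2 \<theta>2"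
proof
  let ?R1 = "coeff_functions \<eta>1 \<epsilon>1 \<theta>1" and ?R2 = "coeff_functions \<eta>2 \<epsilon>2 \<theta>2"
  note V1 = irr_hw_isomorphic[of \<eta>1 \<epsilon>1 \<theta>1] and V2 = irr_hw_isomorphic[of \<eta>2 \<epsilon>2 \<theta>2]
  note R1 = translation_closed_coeff_functions[of \<eta>1 \<epsilon>1 \<theta>1] and R2 = translation_closed_coeff_functions[of \<eta>2 \<epsilon>2 \<theta>2]
  {
    assume tensors: "poly_module M lam1 \<alpha>1 \<beta>1 \<gamma>1 \<otimes>\<^sub>L irr_hw \<eta>1 \<epsilon>1 \<theta>1 \<cong>\<^sub>L
      poly_module M lam2 \<alpha>2 \<beta>2 \<gamma>2 \<otimes>\<^sub>L irr_hw \<eta>2 \<epsilon>2 \<theta>2"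
    have models: "tensor_model M lam1 \<alpha>1 \<beta>1 \<gamma>1 ?R1 \<cong>\<^sub>L tensor_model M lam2 \<alpha>2 \<beta>2 \<gamma>2 ?R2"
      by (rule lie_isomorphic_trans[OF lie_isomorphic_sym[OF tensor_irr_hw_isomorphic(2,1)[OF V1 R1]]
            lie_isomorphic_trans[OF tensors tensor_irr_hw_isomorphic(1)[OF V2 R2]]])
    have R1': "\<exists>\<rho>\<in>?R1. \<exists>w. \<rho> w \<noteq> 0" using coeff_functions_nonzero by blast
    note rigidity = tensor_model_rigidity[OF assms(1-4) _ R1 smooth_coeff_functions R1' R2 smooth_coeff_functions models]
    have rigid: "poly_module M lam1 \<alpha>1 \<beta>1 \<gamma>1 = poly_module M lam2 \<alpha>2 \<beta>2 \<gamma>2"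
      "function_module ?R1 \<cong>\<^sub>L function_module ?R2"
      by (rule rigidity, erule assms(5))+
    have "irr_hw \<eta>1 \<epsilon>1 \<theta>1 \<cong>\<^sub>L irr_hw \<eta>2 \<epsilon>2 \<theta>2"
      by (rule lie_isomorphic_trans[OF V1 lie_isomorphic_trans[OF rigid(2)
            lie_isomorphic_sym[OF linear_module_irr_hw V2]]])
    moreover have "poly_module M lam1 \<alpha>1 \<beta>1 \<gamma>1 \<cong>\<^sub>L poly_module M lam2 \<alpha>2 \<beta>2 \<gamma>2"
      unfolding rigid(1)
      by (rule lie_isomorphic_trans[OF poly_module_tensor_model
          lie_isomorphic_sym[OF linear_module_poly_module poly_module_tensor_model]])
    ultimately show "poly_module M lam1 \<alpha>1 \<beta>1 \<gamma>1 \<cong>\<^sub>L poly_module M lam2 \<alpha>2 \<beta>2 \<gamma>2 \<and>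
      irr_hw \<eta>1 \<epsilon>1 \<theta>1 \<cong>\<^sub>L irr_hw \<eta>2 \<epsilon>2 \<theta>2" by blast
  }
  assume factors: "poly_module M lam1 \<alpha>1 \<beta>1 \<gamma>1 \<cong>\<^sub>L poly_module M lam2 \<alpha>2 \<beta>2 \<gamma>2 \<and>
    irr_hw \<eta>1 \<epsilon>1 \<theta>1 \<cong>\<^sub>L irr_hw \<eta>2 \<epsilon>2 \<theta>2"
  then have eq: "poly_module M lam1 \<alpha>1 \<beta>1 \<gamma>1 = poly_module M lam2 \<alpha>2 \<beta>2 \<gamma>2"
    using poly_module_rigidity[OF assms(1-4), of M \<beta>1 \<beta>2] assms(5) by blast
  \<comment> \<open>Both second factors are identified with the same space of functions, so the two models coincide.\<close>
  have "irr_hw \<eta>1 \<epsilon>1 \<theta>1 \<cong>\<^sub>L function_module ?R2"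
    using factors lie_isomorphic_trans[OF _ V2] by blast
  from tensor_irr_hw_isomorphic(1)[OF this R2]
  show "poly_module M lam1 \<alpha>1 \<beta>1 \<gamma>1 \<otimes>\<^sub>L irr_hw \<eta>1 \<epsilon>1 \<theta>1 \<cong>\<^sub>L
    poly_module M lam2 \<alpha>2 \<beta>2 \<gamma>2 \<otimes>\<^sub>L irr_hw \<eta>2 \<epsilon>2 \<theta>2"
    unfolding eq
    by (rule lie_isomorphic_trans[OF _ lie_isomorphic_sym[OF tensor_irr_hw_isomorphic(2,1)[OF V2 R2]]])
qed

end
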